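(* Let $F=\mathbb F_q(\mathcal X)$ be the function field of the Kummer curve $y^m=f(x)$ with $f$ separable of degree $n$, with the places $Q_0,Q_1,\dots,Q_n$ and $R_1,\dots,R_N$, as described in the context, and suppose that $R_1,\dots,R_m$ are the places lying over $P_1$. Let $$D=\sum_{k=m+1}^NR_k+R_2$$ and let $E=\sum_{k=0}^n\alpha_kQ_k$ (with $\alpha_k\in\mathbb Z$) be a non-special divisor of degree $g$. For an integer $s$ with $\frac{g-1}{n}<s<\frac{N-m-g+2}{n}$ define $$G=\sum_{k=1}^n\alpha_kQ_k+(N-m+\alpha_0-sn)Q_0\quad\text{and}\quad H=\sum_{k=1}^n(s+\alpha_k)Q_k+\alpha_0Q_0-R_1.$$ Then $(C_{\mathcal L}(D,G),C_{\mathcal L}(D,H))$ is a linear complementary pair of algebraic geometry codes with parameters (length and dimension) $$[N-m+1,\,N-m+1-sn]\quad\text{and}\quad[N-m+1,\,sn],$$ respectively.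
   Context: Let $\mathbb F_q$ be the finite field with $q$ elements, $m,n\ge2$ integers with $\operatorname{char}(\mathbb F_q)\nmid m$ and $\gcd(m,n)=1$, and $a_1,\dots,a_n\in\mathbb F_q$ pairwise distinct. Let $\mathcal X$ be the curve over $\mathbb F_q$ defined by $y^m=f(x)=\prod_{k=1}^n(x-a_k)$, with function field $F=\mathbb F_q(\mathcal X)=\mathbb F_q(x,y)$ of genus $g\ge1$. Let $Q_0$ be the only place at infinity of $F$ and let $Q_k$ be the (unique, totally ramified) place of $F$ over the place of $\mathbb F_q(x)$ corresponding to $a_k$, $1\le k\le n$. Let $P_1,\dots,P_t$ be pairwise distinct rational places of $\mathbb F_q(x)$ that split completely in $F/\mathbb F_q(x)$, and let $R_1,\dots,R_N$ be all the $N=mt$ rational places of $F$ lying over $P_1,\dots,P_t$. A divisor $A$ of $F$ is non-special if $\ell(A)=\deg(A)+1-g$, where $\ell(A)=\dim_{\mathbb F_q}\mathcal L(A)$. If $D$ is a sum of $M$ distinct rational places $S_1,\dots,S_M$ and $A$ is a divisor with support disjoint from that of $D$, then $C_{\mathcal L}(D,A)=\{(z(S_1),\dots,z(S_M)):z\in\mathcal L(A)\}\subseteq\mathbb F_q^M$. A pair $(\mathcal C_1,\mathcal C_2)$ of linear codes in $\mathbb F_q^M$ is a linear complementary pair (LCP) if $\mathcal C_1\oplus\mathcal C_2=\mathbb F_q^M$. An $[M,k]$ code is a linear code of length $M$ and dimension $k$. *)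

theory Defs
  imports
    Complex_Main
    "HOL-Library.FuncSet"
    "HOL-Library.Function_Algebras"
    "HOL-Library.Poly_Mapping"
    "HOL-Computational_Algebra.Polynomial"
begin

text \<open>
  Throughout, the constant field \<open>K\<close> is a type \<open>'k\<close>, the function field \<open>F\<close> is a type \<open>'f\<close>, and
  \<open>K\<close> is regarded as a subfield of \<open>F\<close> through a homomorphism \<open>\<iota> :: 'k \<Rightarrow> 'f\<close>. Intermediate
  fields \<open>L\<close> such as \<open>K(x)\<close> are subsets of \<open>'f\<close>; \<open>F\<close> itself is \<open>UNIV\<close>.
\<close>

section \<open>Field extensions\<close>

definition field_embedding :: "('k::field \<Rightarrow> 'f::field) \<Rightarrow> bool" where
  "field_embedding \<iota> \<longleftrightarrow>
     \<iota> 1 = 1 \<and> (\<forall>a b. \<iota> (a + b) = \<iota> a + \<iota> b) \<and> (\<forall>a b. \<iota> (a * b) = \<iota> a * \<iota> b)"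

definition is_subring :: "'f::field set \<Rightarrow> bool" where
  "is_subring S \<longleftrightarrow> 1 \<in> S \<and> (\<forall>u\<in>S. \<forall>v\<in>S. u - v \<in> S \<and> u * v \<in> S)"

definition is_subfield :: "'f::field set \<Rightarrow> bool" where
  "is_subfield S \<longleftrightarrow> is_subring S \<and> (\<forall>u\<in>S. inverse u \<in> S)"

definition adjoin :: "('k::field \<Rightarrow> 'f::field) \<Rightarrow> 'f set \<Rightarrow> 'f set" where
  "adjoin \<iota> X = \<Inter>{S. is_subfield S \<and> range \<iota> \<subseteq> S \<and> X \<subseteq> S}"

definition transcendental_over :: "('k::field \<Rightarrow> 'f::field) \<Rightarrow> 'f \<Rightarrow> bool" where
  "transcendental_over \<iota> x \<longleftrightarrow> (\<forall>p. p \<noteq> 0 \<longrightarrow> poly (map_poly \<iota> p) x \<noteq> 0)"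

text \<open>
  \<open>B\<close> represents a finite basis of the quotient \<open>V/U\<close> of \<open>C\<close>-vector spaces, where \<open>C\<close> is a subfield
  of \<open>F\<close> and \<open>U \<subseteq> V\<close> are \<open>C\<close>-subspaces of \<open>F\<close>. As for the library's \<^term>\<open>vector_space.dim\<close>,
  the dimension is \<open>0\<close> by convention if there is no finite basis.
\<close>

definition quotient_basis :: "'f::field set \<Rightarrow> 'f set \<Rightarrow> 'f set \<Rightarrow> 'f set \<Rightarrow> bool" where
  "quotient_basis C V U B \<longleftrightarrow>
     finite B \<and> B \<subseteq> V \<and>
     (\<forall>v\<in>V. \<exists>!c. c \<in> B \<rightarrow>\<^sub>E C \<and> v - (\<Sum>b\<in>B. c b * b) \<in> U)"

definition quotient_dim :: "'f::field set \<Rightarrow> 'f set \<Rightarrow> 'f set \<Rightarrow> nat" where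
  "quotient_dim C V U =
     (if \<exists>B. quotient_basis C V U B then card (SOME B. quotient_basis C V U B) else 0)"

definition extension_degree :: "'f::field set \<Rightarrow> nat" where
  "extension_degree L = quotient_dim L UNIV {0}"


section \<open>Places\<close>

definition valuation_ring :: "('k::field \<Rightarrow> 'f::field) \<Rightarrow> 'f set \<Rightarrow> 'f set \<Rightarrow> bool" where
  "valuation_ring \<iota> L \<O> \<longleftrightarrow>
     is_subring \<O> \<and> range \<iota> \<subset> \<O> \<and> \<O> \<subset> L \<and> (\<forall>z\<in>L. z \<in> \<O> \<or> inverse z \<in> \<O>)"

text \<open>A place of \<open>L/K\<close> is the maximal ideal (the set of non-units) of a valuation ring of \<open>L/K\<close>.
  The disjunct \<open>z = 0\<close> is needed because \<^term>\<open>inverse 0 = 0\<close>.\<close>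

definition nonunits :: "'f::field set \<Rightarrow> 'f set" where
  "nonunits \<O> = {z \<in> \<O>. z = 0 \<or> inverse z \<notin> \<O>}"

definition places :: "('k::field \<Rightarrow> 'f::field) \<Rightarrow> 'f set \<Rightarrow> 'f set set" where
  "places \<iota> L = {P. \<exists>\<O>. valuation_ring \<iota> L \<O> \<and> P = nonunits \<O>}"

text \<open>The valuation ring is recovered from the place \<open>P\<close> of \<open>L/K\<close>: \<open>z \<in> \<O>\<^sub>P\<close> iff \<open>z\<inverse> \<notin> P\<close>
  (for \<open>z \<noteq> 0\<close>).\<close>

definition ring_of_place :: "'f::field set \<Rightarrow> 'f set \<Rightarrow> 'f set" where
  "ring_of_place L P = {z \<in> L. z = 0 \<or> inverse z \<notin> P}"

definition place_degree :: "('k::field \<Rightarrow> 'f::field) \<Rightarrow> 'f set \<Rightarrow> 'f set \<Rightarrow> nat" where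
  "place_degree \<iota> L P = quotient_dim (range \<iota>) (ring_of_place L P) P"

definition rational_places :: "('k::field \<Rightarrow> 'f::field) \<Rightarrow> 'f set \<Rightarrow> 'f set set" where
  "rational_places \<iota> L = {P \<in> places \<iota> L. place_degree \<iota> L P = 1}"

definition places_over :: "('k::field \<Rightarrow> 'f::field) \<Rightarrow> 'f set \<Rightarrow> 'f set set" where
  "places_over \<iota> P = {Q \<in> places \<iota> UNIV. P \<subseteq> Q}"

text \<open>A place \<open>P\<close> of \<open>L\<close> splits completely in the finite extension \<open>F/L\<close>.\<close>

definition splits_completely :: "('k::field \<Rightarrow> 'f::field) \<Rightarrow> 'f set \<Rightarrow> 'f set \<Rightarrow> bool" where
  "splits_completely \<iota> L P \<longleftrightarrow> card (places_over \<iota> P) = extension_degree L"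

text \<open>The place of \<open>K(x)\<close> corresponding to \<open>b \<in> K\<close> and the place of \<open>K(x)\<close> at infinity.\<close>

definition finite_place :: "('k::field \<Rightarrow> 'f::field) \<Rightarrow> 'f \<Rightarrow> 'k \<Rightarrow> 'f set" where
  "finite_place \<iota> x b =
     {poly (map_poly \<iota> p) x / poly (map_poly \<iota> r) x | p r. poly p b = 0 \<and> poly r b \<noteq> 0}"

definition infinite_place :: "('k::field \<Rightarrow> 'f::field) \<Rightarrow> 'f \<Rightarrow> 'f set" where
  "infinite_place \<iota> x =
     {poly (map_poly \<iota> p) x / poly (map_poly \<iota> r) x | p r. degree p < degree r}"

text \<open>The normalised valuation \<open>v\<^sub>P(z)\<close> of \<open>z \<noteq> 0\<close> at a place \<open>P\<close> of \<open>F\<close>: \<open>z = t\<^sup>n u\<close> with \<open>t\<close> a prime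
  element for \<open>P\<close> and \<open>u\<close> a unit of \<open>\<O>\<^sub>P\<close>. The value at \<open>z = 0\<close> is irrelevant.\<close>

definition prime_element :: "'f::field set \<Rightarrow> 'f \<Rightarrow> bool" where
  "prime_element P t \<longleftrightarrow> P = {t * w | w. w \<in> ring_of_place UNIV P}"

definition place_val :: "'f::field set \<Rightarrow> 'f \<Rightarrow> int" where
  "place_val P z =
     (THE n. \<exists>t u. prime_element P t \<and> u \<in> ring_of_place UNIV P - P \<and> z = t powi n * u)"

text \<open>The value \<open>z(P) \<in> K\<close> at a rational place \<open>P\<close> of \<open>F\<close> of an element \<open>z \<in> \<O>\<^sub>P\<close>, i.e. its residue
  class under the identification \<open>\<O>\<^sub>P/P = K\<close>.\<close>

definition eval_at :: "('k::field \<Rightarrow> 'f::field) \<Rightarrow> 'f set \<Rightarrow> 'f \<Rightarrow> 'k" where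
  "eval_at \<iota> P z = (THE c. z - \<iota> c \<in> P)"


section \<open>Divisors\<close>

type_synonym 'f divisor = "'f set \<Rightarrow>\<^sub>0 int"

definition divisors :: "('k::field \<Rightarrow> 'f::field) \<Rightarrow> 'f divisor set" where
  "divisors \<iota> = {A. Poly_Mapping.keys A \<subseteq> places \<iota> UNIV}"

definition divisor_degree :: "('k::field \<Rightarrow> 'f::field) \<Rightarrow> 'f divisor \<Rightarrow> int" where
  "divisor_degree \<iota> A =
     (\<Sum>P\<in>Poly_Mapping.keys A. Poly_Mapping.lookup A P * int (place_degree \<iota> UNIV P))"

definition riemann_roch_space :: "('k::field \<Rightarrow> 'f::field) \<Rightarrow> 'f divisor \<Rightarrow> 'f set" where
  "riemann_roch_space \<iota> A =
     {z. z = 0 \<or> (\<forall>P\<in>places \<iota> UNIV. place_val P z \<ge> - Poly_Mapping.lookup A P)}"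

definition ell :: "('k::field \<Rightarrow> 'f::field) \<Rightarrow> 'f divisor \<Rightarrow> nat" where
  "ell \<iota> A = vector_space.dim (\<lambda>c z. \<iota> c * z) (riemann_roch_space \<iota> A)"

text \<open>The genus is \<open>max {deg A - \<ell>(A) + 1 | A \<in> Div(F)}\<close>. It is a relation here because \<^term>\<open>Max\<close> only
  makes sense for finite sets.\<close>

definition has_genus :: "('k::field \<Rightarrow> 'f::field) \<Rightarrow> int \<Rightarrow> bool" where
  "has_genus \<iota> g \<longleftrightarrow>
     (\<exists>A\<in>divisors \<iota>. g = divisor_degree \<iota> A - int (ell \<iota> A) + 1) \<and>
     (\<forall>A\<in>divisors \<iota>. divisor_degree \<iota> A - int (ell \<iota> A) + 1 \<le> g)"

definition non_special :: "('k::field \<Rightarrow> 'f::field) \<Rightarrow> int \<Rightarrow> 'f divisor \<Rightarrow> bool" where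
  "non_special \<iota> g A \<longleftrightarrow> A \<in> divisors \<iota> \<and> int (ell \<iota> A) = divisor_degree \<iota> A + 1 - g"


section \<open>Linear codes and algebraic geometry codes\<close>

text \<open>\<open>K\<^sup>M\<close> consists of the functions \<open>v :: nat \<Rightarrow> 'k\<close> (with coordinates \<open>v 1, \<dots>, v M\<close>) that vanish
  outside \<open>{1..M}\<close>.\<close>

definition words :: "nat \<Rightarrow> (nat \<Rightarrow> 'k::field) set" where
  "words M = {v. \<forall>i. i \<notin> {1..M} \<longrightarrow> v i = 0}"

definition word_scale :: "'k::field \<Rightarrow> (nat \<Rightarrow> 'k) \<Rightarrow> nat \<Rightarrow> 'k" where
  "word_scale c v = (\<lambda>i. c * v i)"

lemma vector_space_word_scale: "vector_space word_scale"
  by unfold_locales (auto simp: word_scale_def fun_eq_iff algebra_simps)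

definition linear_code :: "nat \<Rightarrow> (nat \<Rightarrow> 'k::field) set \<Rightarrow> bool" where
  "linear_code M C \<longleftrightarrow> C \<subseteq> words M \<and> module.subspace word_scale C"

definition has_parameters :: "(nat \<Rightarrow> 'k::field) set \<Rightarrow> nat \<Rightarrow> int \<Rightarrow> bool" where
  "has_parameters C M k \<longleftrightarrow> linear_code M C \<and> int (vector_space.dim word_scale C) = k"

definition LCP :: "nat \<Rightarrow> (nat \<Rightarrow> 'k::field) set \<Rightarrow> (nat \<Rightarrow> 'k) set \<Rightarrow> bool" where
  "LCP M C1 C2 \<longleftrightarrow>
     linear_code M C1 \<and> linear_code M C2 \<and>
     C1 \<inter> C2 = {0} \<and> {u + v | u v. u \<in> C1 \<and> v \<in> C2} = words M"

text \<open>\<open>C\<^sub>\<L>(D, A)\<close> for \<open>D = S\<^sub>1 + \<dots> + S\<^sub>M\<close>. A code depends on the enumeration of the places in the support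
  of \<open>D\<close>, so this enumeration is the argument.\<close>

definition ag_code ::
    "('k::field \<Rightarrow> 'f::field) \<Rightarrow> nat \<Rightarrow> (nat \<Rightarrow> 'f set) \<Rightarrow> 'f divisor \<Rightarrow> (nat \<Rightarrow> 'k) set" where
  "ag_code \<iota> M S A =
     {\<lambda>i. if i \<in> {1..M} then eval_at \<iota> (S i) z else 0 | z. z \<in> riemann_roch_space \<iota> A}"


section \<open>Kummer curves\<close>

text \<open>\<open>F = K(x, y)\<close> is the function field of \<open>y\<^sup>m = (x - a\<^sub>1) \<dots> (x - a\<^sub>n)\<close>.\<close>

definition kummer_function_field ::
    "('k::field \<Rightarrow> 'f::field) \<Rightarrow> nat \<Rightarrow> nat \<Rightarrow> (nat \<Rightarrow> 'k) \<Rightarrow> 'f \<Rightarrow> 'f \<Rightarrow> bool" where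
  "kummer_function_field \<iota> m n a x y \<longleftrightarrow>
     field_embedding \<iota> \<and> transcendental_over \<iota> x \<and> adjoin \<iota> {x, y} = UNIV \<and>
     y ^ m = poly (map_poly \<iota> (\<Prod>k=1..n. [:- a k, 1:])) x"

end

theory Submission
  imports Defs
begin

text \<open>
  The proof rests on two facts: (1) no nonzero function of \<open>\<L>(E)\<close> vanishes at a place over \<open>P\<^sub>1\<close>, so
  \<open>\<L>(E - R\<^sub>1) = \<L>(E - R\<^sub>2) = 0\<close>; (2) if \<open>B\<close> is the coefficientwise maximum of \<open>G\<close> and \<open>H\<close>, then
  multiplication by \<open>w = y\<^sup>s / \<Prod>\<^sub>i (x - \<beta>\<^sub>i)\<close> maps \<open>\<L>(B - D)\<close> into \<open>\<L>(E - R\<^sub>2)\<close>, where \<open>i\<close> runs from \<open>2\<close> to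
  \<open>t\<close> and \<open>\<beta>\<^sub>i\<close> is the value of \<open>x\<close> at \<open>P\<^sub>i\<close>; so \<open>\<L>(B - D) = 0\<close>. If \<open>u \<in> \<L>(G)\<close> and \<open>v \<in> \<L>(H)\<close>
  define the same word, then \<open>u - v \<in> \<L>(B - D)\<close>, so \<open>u = v\<close> lies in \<open>\<L>(G) \<inter> \<L>(H) = \<L>(E - R\<^sub>1)\<close> and
  is \<open>0\<close>. Hence the codes intersect trivially, and evaluation is injective on \<open>\<L>(G)\<close> and on \<open>\<L>(H)\<close>. By
  the definition of the genus the dimensions are at least \<open>deg G + 1 - g = N - m + 1 - s n\<close> and
  \<open>deg H + 1 - g = s n\<close>, with sum \<open>M\<close>; so they have these values and the codes are complementary.

  For (1), let \<open>u\<close> be a nonzero function of \<open>\<L>(E)\<close> that vanishes over the point \<open>\<beta>\<^sub>1\<close>. As \<open>P\<^sub>1\<close> splits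
  completely, \<open>K\<close> contains \<open>m\<close> roots of unity \<open>\<zeta>\<close> with \<open>\<zeta>\<^sup>m = 1\<close>, and the automorphisms \<open>y \<mapsto> \<zeta> y\<close>
  preserve \<open>\<L>(E)\<close>, since they fix the places \<open>Q\<^sub>k\<close>. This space has dimension \<open>1\<close> because \<open>E\<close> is
  non-special of degree \<open>g\<close>. So \<open>u\<close> is a common eigenvector, hence \<open>u = c y\<^sup>j\<close> with \<open>c \<in> K(x)\<close>. Then \<open>c\<close>
  vanishes at \<open>\<beta>\<^sub>1\<close>, and \<open>u / (x - \<beta>\<^sub>1)\<close> belongs to \<open>\<L>(E)\<close> but is not a constant multiple of \<open>u\<close>
  (\<open>no_vanishing_over_split_point\<close>).

  For (2), the divisors of \<open>x - b\<close> and of \<open>y\<close> are needed. All places of \<open>F\<close> are discrete because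
  \<open>F/K(x)\<close> is finite (\<open>prime_element_existence_and_factorization\<close>). The valuations and the uniqueness of
  the places over infinity, over the \<open>a\<^sub>k\<close> and over the \<open>\<beta>\<^sub>i\<close> come from one lemma about rational points of a
  plane model whose local ring has a principal maximal ideal (\<open>nonsingular_point\<close>). Finally \<open>m\<close> is the degree
  of \<open>F/K(x)\<close>, as the valuations of \<open>1, y, \<dots>, y\<^bsup>m-1\<^esup>\<close> at infinity are distinct modulo \<open>m\<close>, and this
  shows that the \<open>R\<^sub>k\<close> are all places over the \<open>P\<^sub>i\<close>.
\<close>


section \<open>Subfields and linear dependence\<close>

lemma subring_closed:
  assumes "is_subring S"
  shows "1 \<in> S" "0 \<in> S"
    and "\<And>u v. u \<in> S \<Longrightarrow> v \<in> S \<Longrightarrow> u - v \<in> S"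
    and "\<And>u v. u \<in> S \<Longrightarrow> v \<in> S \<Longrightarrow> u * v \<in> S"
    and "\<And>u. u \<in> S \<Longrightarrow> - u \<in> S"
    and "\<And>u v. u \<in> S \<Longrightarrow> v \<in> S \<Longrightarrow> u + v \<in> S"
    and "\<And>u k. u \<in> S \<Longrightarrow> u ^ k \<in> S"
proof -
  show one: "1 \<in> S" and diff: "\<And>u v. u \<in> S \<Longrightarrow> v \<in> S \<Longrightarrow> u - v \<in> S"
    and mult: "\<And>u v. u \<in> S \<Longrightarrow> v \<in> S \<Longrightarrow> u * v \<in> S"
    using assms by (auto simp: is_subring_def)
  show zero: "0 \<in> S" using diff[OF one one] by simp
  show minus: "\<And>u. u \<in> S \<Longrightarrow> - u \<in> S" using diff[OF zero] by simp
  show "\<And>u v. u \<in> S \<Longrightarrow> v \<in> S \<Longrightarrow> u + v \<in> S"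
    using diff minus by (metis diff_minus_eq_add)
  show "u ^ k \<in> S" if "u \<in> S" for u k
    by (induction k) (auto simp: one intro: mult that)
qed

lemma subring_sum: "is_subring S \<Longrightarrow> (\<And>i. i \<in> I \<Longrightarrow> u i \<in> S) \<Longrightarrow> sum u I \<in> S"
  by (induction I rule: infinite_finite_induct) (auto intro: subring_closed)

lemma subring_prod: "is_subring S \<Longrightarrow> (\<And>i. i \<in> I \<Longrightarrow> u i \<in> S) \<Longrightarrow> prod u I \<in> S"
  by (induction I rule: infinite_finite_induct) (auto intro: subring_closed)

lemma subfield_subring: "is_subfield S \<Longrightarrow> is_subring S"
  by (simp add: is_subfield_def)

lemma subfield_inverse: "is_subfield S \<Longrightarrow> u \<in> S \<Longrightarrow> inverse u \<in> S"
  by (simp add: is_subfield_def)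

lemma subfield_divide: "is_subfield S \<Longrightarrow> u \<in> S \<Longrightarrow> v \<in> S \<Longrightarrow> u / v \<in> S"
  by (simp add: divide_inverse subfield_inverse subring_closed(4)[OF subfield_subring])

lemma subfield_UNIV: "is_subfield UNIV"
  by (simp add: is_subfield_def is_subring_def)

lemma subfield_adjoin: "is_subfield (adjoin \<iota> X)"
  unfolding adjoin_def is_subfield_def is_subring_def by blast

lemmas adjoin_closed = subring_closed[OF subfield_subring[OF subfield_adjoin]]

lemma adjoin_superset: "X \<subseteq> adjoin \<iota> X" "range \<iota> \<subseteq> adjoin \<iota> X"
  unfolding adjoin_def by auto

lemma adjoin_least: "is_subfield S \<Longrightarrow> range \<iota> \<subseteq> S \<Longrightarrow> X \<subseteq> S \<Longrightarrow> adjoin \<iota> X \<subseteq> S"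
  unfolding adjoin_def by blast

text \<open>Gaussian elimination of one unknown per equation. The scalars form a subset of the field and
  not a type, as for \<open>K(x)\<close> in \<open>F\<close>.\<close>

lemma homogeneous_system_nontrivial_solution:
  assumes C: "is_subfield C" and "finite J" and "finite I" and "card J < card I"
    and "\<And>j i. j \<in> J \<Longrightarrow> i \<in> I \<Longrightarrow> A j i \<in> C"
  shows "\<exists>c. (\<forall>i\<in>I. c i \<in> C) \<and> (\<exists>i\<in>I. c i \<noteq> 0) \<and> (\<forall>j\<in>J. (\<Sum>i\<in>I. A j i * c i) = 0)"
  using assms(2-)
proof (induction J arbitrary: I A rule: finite_induct)
  case empty
  then obtain i where "i \<in> I" by fastforce
  then show ?case
    using subring_closed[OF subfield_subring[OF C]] by (intro exI[of _ "\<lambda>_. 1"]) auto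
next
  case (insert j J)
  note C_closed = subring_closed[OF subfield_subring[OF C]]
  show ?case
  proof (cases "\<forall>i\<in>I. A j i = 0")
    case True
    have "card J < card I" using insert by simp
    from insert.IH[OF \<open>finite I\<close> this, of A] insert.prems True show ?thesis by auto
  next
    case False
    then obtain i0 where i0: "i0 \<in> I" "A j i0 \<noteq> 0" by auto
    define I' where "I' = I - {i0}"
    have fin: "finite I'" and I: "I = insert i0 I'" and ni: "i0 \<notin> I'"
      using insert.prems i0 by (auto simp: I'_def)
    have card: "card J < card I'" using insert.prems insert.hyps I ni fin by simp
    define A' where "A' = (\<lambda>l i. A l i - A l i0 * A j i / A j i0)"
    have A': "A' l i \<in> C" if "l \<in> J" "i \<in> I'" for l i
      unfolding A'_def using that insert.prems I
      by (intro C_closed subfield_divide[OF C]) auto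
    from insert.IH[of I' A', OF fin card A'] obtain c where
      c: "\<forall>i\<in>I'. c i \<in> C" "\<exists>i\<in>I'. c i \<noteq> 0" "\<forall>l\<in>J. (\<Sum>i\<in>I'. A' l i * c i) = 0" by auto
    define e where "e = - (\<Sum>i\<in>I'. A j i * c i) / A j i0"
    define c' where "c' = c(i0 := e)"
    have e: "e \<in> C"
      unfolding e_def
      by (intro subfield_divide[OF C] C_closed subring_sum subfield_subring[OF C])
         (use c insert.prems I in auto)
    have sum_c': "(\<Sum>i\<in>I. A l i * c' i) = A l i0 * e + (\<Sum>i\<in>I'. A l i * c i)" for l
    proof -
      have "(\<Sum>i\<in>I'. A l i * c' i) = (\<Sum>i\<in>I'. A l i * c i)"
        by (rule sum.cong) (use ni in \<open>auto simp: c'_def\<close>)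
      then show ?thesis unfolding I by (simp add: sum.insert[OF fin ni] c'_def)
    qed
    have "(\<Sum>i\<in>I. A l i * c' i) = 0" if "l \<in> insert j J" for l
    proof (cases "l = j")
      case True
      then show ?thesis unfolding sum_c' e_def using i0 by simp
    next
      case False
      have "0 = (\<Sum>i\<in>I'. A' l i * c i)" using c(3) that False by auto
      also have "\<dots> = (\<Sum>i\<in>I'. A l i * c i) - (\<Sum>i\<in>I'. A l i0 / A j i0 * (A j i * c i))"
        unfolding sum_subtractf[symmetric] A'_def by (rule sum.cong) (auto simp: algebra_simps)
      also have "(\<Sum>i\<in>I'. A l i0 / A j i0 * (A j i * c i)) = - (A l i0 * e)"
        unfolding sum_distrib_left[symmetric] e_def by simp
      finally show ?thesis unfolding sum_c' by (simp add: algebra_simps)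
    qed
    moreover have "\<forall>i\<in>I. c' i \<in> C" using c e I by (auto simp: c'_def)
    moreover have "\<exists>i\<in>I. c' i \<noteq> 0" using c I ni by (auto simp: c'_def)
    ultimately show ?thesis by blast
  qed
qed

lemma linear_dependence:
  assumes C: "is_subfield C" and "finite J" and "finite I" and "card J < card I"
    and z: "\<And>i. i \<in> I \<Longrightarrow> \<exists>c. (\<forall>j\<in>J. c j \<in> C) \<and> z i = (\<Sum>j\<in>J. c j * b j)"
  shows "\<exists>c. (\<forall>i\<in>I. c i \<in> C) \<and> (\<exists>i\<in>I. c i \<noteq> 0) \<and> (\<Sum>i\<in>I. c i * z i) = 0"
proof -
  obtain A where A: "\<And>i. i \<in> I \<Longrightarrow> (\<forall>j\<in>J. A i j \<in> C) \<and> z i = (\<Sum>j\<in>J. A i j * b j)"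
    using z by metis
  obtain c where c: "\<forall>i\<in>I. c i \<in> C" "\<exists>i\<in>I. c i \<noteq> 0" "\<forall>j\<in>J. (\<Sum>i\<in>I. A i j * c i) = 0"
    using homogeneous_system_nontrivial_solution[OF C assms(2-4), of "\<lambda>j i. A i j"] A by blast
  have "(\<Sum>i\<in>I. c i * z i) = (\<Sum>i\<in>I. \<Sum>j\<in>J. A i j * c i * b j)"
    by (rule sum.cong) (auto simp: A sum_distrib_left mult_ac)
  also have "\<dots> = (\<Sum>j\<in>J. (\<Sum>i\<in>I. A i j * c i) * b j)"
    by (subst sum.swap) (simp add: sum_distrib_right)
  also have "\<dots> = 0" using c by simp
  finally show ?thesis using c by blast
qed


text \<open>A subring of finite dimension over a field is a field: a linear relation between the powers of an element, divided by its lowest term, gives an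
  inverse.\<close>

lemma subfield_of_finite_span:
  assumes C: "is_subfield C" and J: "finite J"
    and V: "V = {\<Sum>j\<in>J. c j * b j | c. \<forall>j\<in>J. c j \<in> C}"
    and ring: "is_subring V" and CV: "C \<subseteq> V"
  shows "is_subfield V"
  unfolding is_subfield_def
proof (intro conjI ballI ring)
  fix w assume w: "w \<in> V"
  note V_closed = subring_closed[OF ring]
  have "\<exists>c. (\<forall>i\<in>{..card J}. c i \<in> C) \<and> (\<exists>i\<in>{..card J}. c i \<noteq> 0)
      \<and> (\<Sum>i\<in>{..card J}. c i * w ^ i) = 0"
  proof (rule linear_dependence[OF C J])
    fix i
    have "w ^ i \<in> V" using V_closed(7)[OF w] .
    then show "\<exists>c. (\<forall>j\<in>J. c j \<in> C) \<and> w ^ i = (\<Sum>j\<in>J. c j * b j)" unfolding V by blast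
  qed auto
  then obtain c i where c: "\<forall>i\<in>{..card J}. c i \<in> C" "i \<le> card J" "c i \<noteq> 0"
      "(\<Sum>i\<in>{..card J}. c i * w ^ i) = 0" by auto
  define r where "r = (LEAST i. i \<le> card J \<and> c i \<noteq> 0)"
  have r: "r \<le> card J" "c r \<noteq> 0"
    using LeastI[of "\<lambda>i. i \<le> card J \<and> c i \<noteq> 0" i] c by (auto simp: r_def)
  have low: "c i = 0" if "i < r" for i
    using not_less_Least[of i "\<lambda>i. i \<le> card J \<and> c i \<noteq> 0"] that r by (auto simp: r_def)
  show "inverse w \<in> V"
  proof (cases "w = 0")
    case False
    have "0 = (\<Sum>i\<in>{..card J}. c i * w ^ i)" using c by simp
    also have "\<dots> = (\<Sum>i\<in>{r..card J}. c i * w ^ i)"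
      by (rule sum.mono_neutral_right) (auto simp: low)
    also have "\<dots> = c r * w ^ r + (\<Sum>i\<in>{Suc r..card J}. c i * w ^ i)"
      using r by (subst sum.atLeast_Suc_atMost) auto
    also have "(\<Sum>i\<in>{Suc r..card J}. c i * w ^ i)
        = w ^ r * w * (\<Sum>i\<in>{Suc r..card J}. c i * w ^ (i - Suc r))"
      unfolding sum_distrib_left
    proof (rule sum.cong)
      fix i assume i: "i \<in> {Suc r..card J}"
      have "w ^ i = w ^ Suc r * w ^ (i - Suc r)" using i by (subst power_add[symmetric]) auto
      then show "c i * w ^ i = w ^ r * w * (c i * w ^ (i - Suc r))" by simp
    qed simp
    finally have "w ^ r * (c r + w * (\<Sum>i\<in>{Suc r..card J}. c i * w ^ (i - Suc r))) = 0"
      by (simp add: algebra_simps)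
    then have "c r = w * - (\<Sum>i\<in>{Suc r..card J}. c i * w ^ (i - Suc r))"
      using False by (simp add: add_eq_0_iff2)
    then have "inverse w = inverse (c r) * - (\<Sum>i\<in>{Suc r..card J}. c i * w ^ (i - Suc r))"
      using r False by (simp add: field_simps)
    moreover have "inverse (c r) \<in> V" using subfield_inverse[OF C] c r CV by auto
    moreover have "(\<Sum>i\<in>{Suc r..card J}. c i * w ^ (i - Suc r)) \<in> V"
      by (rule subring_sum[OF ring]) (use c CV w in \<open>auto intro!: V_closed\<close>)
    ultimately show ?thesis using V_closed by metis
  qed (use V_closed in auto)
qed


section \<open>Rational functions of one element\<close>

locale constant_field =
  fixes \<iota> :: "'k::field \<Rightarrow> 'f::field"
  assumes emb: "field_embedding \<iota>"
begin

lemma \<iota>_1 [simp]: "\<iota> 1 = 1" and \<iota>_add: "\<iota> (a + b) = \<iota> a + \<iota> b"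
  and \<iota>_mult: "\<iota> (a * b) = \<iota> a * \<iota> b"
  using emb by (auto simp: field_embedding_def)

lemma \<iota>_0 [simp]: "\<iota> 0 = 0"
proof -
  have "\<iota> 0 = \<iota> 0 + \<iota> 0" using \<iota>_add[of 0 0] by simp
  then show ?thesis by (metis add_cancel_right_right)
qed

lemma \<iota>_minus: "\<iota> (- a) = - \<iota> a"
  using \<iota>_add[of a "- a"] by (simp add: eq_neg_iff_add_eq_0 add.commute)

lemma \<iota>_diff: "\<iota> (a - b) = \<iota> a - \<iota> b"
  using \<iota>_add[of a "- b"] by (simp add: \<iota>_minus)

lemma \<iota>_power: "\<iota> (a ^ k) = \<iota> a ^ k"
  by (induction k) (auto simp: \<iota>_mult)

lemma \<iota>_eq_0_iff [simp]: "\<iota> a = 0 \<longleftrightarrow> a = 0"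
proof
  assume "\<iota> a = 0"
  then have "\<iota> (a * inverse a) = 0" by (simp add: \<iota>_mult)
  then show "a = 0" by (cases "a = 0") auto
qed simp

lemma \<iota>_inj: "\<iota> a = \<iota> b \<longleftrightarrow> a = b"
  using \<iota>_diff[of a b] \<iota>_eq_0_iff[of "a - b"] by auto

lemma \<iota>_inverse: "\<iota> (inverse a) = inverse (\<iota> a)"
  by (cases "a = 0") (auto simp: \<iota>_mult[symmetric] intro!: inverse_unique[symmetric])

lemma \<iota>_divide: "\<iota> (a / b) = \<iota> a / \<iota> b"
  by (simp add: divide_inverse \<iota>_mult \<iota>_inverse)

lemma \<iota>_of_nat: "\<iota> (of_nat k) = of_nat k"
  by (induction k) (auto simp: \<iota>_add)

abbreviation ev :: "'k poly \<Rightarrow> 'f \<Rightarrow> 'f" where "ev p z \<equiv> poly (map_poly \<iota> p) z"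

lemma ev_0 [simp]: "ev 0 z = 0"
  by simp

lemma ev_pCons [simp]: "ev (pCons a p) z = \<iota> a + z * ev p z"
  by (simp add: map_poly_pCons)

lemma ev_1 [simp]: "ev 1 z = 1"
  by (simp add: one_pCons)

lemma ev_add: "ev (p + q) z = ev p z + ev q z"
  by (induction p q rule: poly_induct2) (auto simp: \<iota>_add algebra_simps)

lemma ev_smult: "ev (smult a p) z = \<iota> a * ev p z"
  by (induction p) (auto simp: \<iota>_mult algebra_simps)

lemma ev_minus: "ev (- p) z = - ev p z"
  using ev_smult[of "-1" p z] by (simp add: \<iota>_minus)

lemma ev_diff: "ev (p - q) z = ev p z - ev q z"
  using ev_add[of p "- q" z] by (simp add: ev_minus)

lemma ev_mult: "ev (p * q) z = ev p z * ev q z"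
  by (induction p) (auto simp: ev_add ev_smult algebra_simps)

lemma ev_power: "ev (p ^ k) z = ev p z ^ k"
  by (induction k) (auto simp: ev_mult)

lemma ev_prod: "ev (prod p I) z = (\<Prod>i\<in>I. ev (p i) z)"
  by (induction I rule: infinite_finite_induct) (auto simp: ev_mult)

lemma ev_in_subring:
  assumes "is_subring S" "range \<iota> \<subseteq> S" "z \<in> S"
  shows "ev p z \<in> S"
  using assms by (induction p) (auto intro!: subring_closed)

lemma ev_minus_value_dvd:
  obtains q where "ev p z - \<iota> (poly p b) = (z - \<iota> b) * ev q z"
proof -
  have "poly (p - [:poly p b:]) b = 0" by simp
  then obtain q where "p - [:poly p b:] = [:- b, 1:] * q"
    unfolding poly_eq_0_iff_dvd by (elim dvdE)
  then have "ev (p - [:poly p b:]) z = ev ([:- b, 1:] * q) z" by simp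
  then show ?thesis by (intro that[of q]) (simp only: ev_diff ev_mult, simp add: \<iota>_minus)
qed

lemma adjoin_singleton:
  "adjoin \<iota> {x} = {ev p x / ev q x | p q. True}" (is "_ = ?Q")
proof
  have *: "ev p x / ev q x \<in> ?Q" for p q by blast
  have "is_subfield ?Q"
    unfolding is_subfield_def is_subring_def
  proof (intro conjI ballI)
    show "1 \<in> ?Q" using *[of 1 1] by simp
    show "inverse u \<in> ?Q" if "u \<in> ?Q" for u
      using that * by (auto simp: inverse_eq_divide)
    fix u v assume "u \<in> ?Q" "v \<in> ?Q"
    then obtain p q p' q' where uv: "u = ev p x / ev q x" "v = ev p' x / ev q' x" by blast
    show "u * v \<in> ?Q" using *[of "p * p'" "q * q'"] by (simp add: uv ev_mult)
    consider "ev q x = 0" | "ev q' x = 0" | "ev q x \<noteq> 0" "ev q' x \<noteq> 0" by blast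
    then show "u - v \<in> ?Q"
    proof cases
      case 1
      then show ?thesis using *[of "- p'" q'] by (simp add: uv ev_minus)
    next
      case 2
      then show ?thesis using *[of p q] by (simp add: uv)
    next
      case 3
      then show ?thesis using *[of "p * q' - p' * q" "q * q'"]
        by (simp add: uv ev_mult ev_diff diff_frac_eq)
    qed
  qed
  moreover have "range \<iota> \<subseteq> ?Q" using *[of "[:_:]" 1] by auto
  moreover have "{x} \<subseteq> ?Q" using *[of "[:0, 1:]" 1] by auto
  ultimately show "adjoin \<iota> {x} \<subseteq> ?Q" by (rule adjoin_least)
  have "ev p x \<in> adjoin \<iota> {x}" for p
    using ev_in_subring[OF subfield_subring[OF subfield_adjoin]] adjoin_superset[where X = "{x}" and \<iota> = \<iota>] by auto
  then show "?Q \<subseteq> adjoin \<iota> {x}"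
    using subfield_divide[OF subfield_adjoin] by blast
qed

end

section \<open>Places\<close>

text \<open>Both the places of \<open>F\<close> and those of \<open>K(x)\<close> occur, hence the parameter \<open>L\<close>.\<close>

locale place = constant_field \<iota> for \<iota> :: "'k::field \<Rightarrow> 'f::field" +
  fixes L P :: "'f set"
  assumes subfield_L: "is_subfield L" and place: "P \<in> places \<iota> L"
begin

abbreviation \<O> :: "'f set" where "\<O> \<equiv> ring_of_place L P"

lemma valuation_ring_of_place: "valuation_ring \<iota> L \<O>" and nonunits_of_place: "P = nonunits \<O>"
proof -
  obtain A where A: "valuation_ring \<iota> L A" "P = nonunits A"
    using place by (auto simp: places_def)
  have "0 \<in> A" using A(1) subring_closed(2) by (auto simp: valuation_ring_def)
  have "\<O> = A"
  proof (intro equalityI subsetI)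
    fix z assume "z \<in> \<O>"
    then have z: "z \<in> L" "z = 0 \<or> inverse z \<notin> nonunits A"
      by (auto simp: ring_of_place_def A(2))
    show "z \<in> A"
    proof (cases "z = 0 \<or> z \<in> A")
      case False
      then have "inverse z \<in> A" using A(1) z(1) by (auto simp: valuation_ring_def)
      then have "inverse z \<in> nonunits A" using False by (simp add: nonunits_def)
      then show ?thesis using z False by simp
    qed (use \<open>0 \<in> A\<close> in auto)
  next
    fix z assume z: "z \<in> A"
    then show "z \<in> \<O>"
      using A(1) by (auto simp: ring_of_place_def A(2) nonunits_def valuation_ring_def)
  qed
  then show "valuation_ring \<iota> L \<O>" "P = nonunits \<O>" using A by auto
qed

lemma in_P_iff: "z \<in> P \<longleftrightarrow> z \<in> \<O> \<and> (z = 0 \<or> inverse z \<notin> \<O>)"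
  using nonunits_of_place unfolding nonunits_def by blast

lemma subring_\<O>: "is_subring \<O>" and \<iota>_in_\<O> [simp]: "\<iota> c \<in> \<O>"
  using valuation_ring_of_place by (auto simp: valuation_ring_def)

lemmas \<O>_closed = subring_closed[OF subring_\<O>]

lemma P_subset_\<O>: "z \<in> P \<Longrightarrow> z \<in> \<O>"
  by (simp add: in_P_iff)

lemma \<O>_subset_L: "z \<in> \<O> \<Longrightarrow> z \<in> L"
  by (simp add: ring_of_place_def)

lemma in_\<O>_or_inverse_in_P: "z \<in> L \<Longrightarrow> z \<in> \<O> \<or> inverse z \<in> P"
  by (auto simp: ring_of_place_def)

lemma zero_in_P [simp]: "0 \<in> P" and one_notin_P [simp]: "1 \<notin> P"
  using \<O>_closed(1,2) by (simp_all add: in_P_iff)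

lemma unit_inverse: "u \<in> \<O> \<Longrightarrow> u \<notin> P \<Longrightarrow> inverse u \<in> \<O> \<and> inverse u \<notin> P \<and> u \<noteq> 0"
  by (auto simp: in_P_iff)

lemma P_mult:
  assumes "u \<in> \<O>" "v \<in> P" shows "u * v \<in> P"
proof (rule ccontr)
  assume n: "u * v \<notin> P"
  have "u * v \<in> \<O>" using assms P_subset_\<O> \<O>_closed by blast
  with n have "inverse (u * v) \<in> \<O>" "u * v \<noteq> 0" using unit_inverse by blast+
  then have "u * inverse (u * v) \<in> \<O>" using assms \<O>_closed by blast
  moreover have "u * inverse (u * v) = inverse v" using \<open>u * v \<noteq> 0\<close> by (simp add: field_simps)
  ultimately have "inverse v \<in> \<O>" by (simp only:)
  then show False using assms(2) \<open>u * v \<noteq> 0\<close> by (simp add: in_P_iff)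
qed

lemma P_mult2: "u \<in> P \<Longrightarrow> v \<in> \<O> \<Longrightarrow> u * v \<in> P"
  using P_mult[of v u] by (simp add: mult.commute)

lemma P_minus: "u \<in> P \<Longrightarrow> - u \<in> P"
  using P_mult[of "- 1" u] \<O>_closed by simp

lemma P_add:
  assumes "u \<in> P" "v \<in> P" shows "u + v \<in> P"
proof -
  have *: "u + v \<in> P" if uv: "u \<in> P" "v \<in> P" "u \<noteq> 0" "v / u \<in> \<O>" for u v
  proof -
    have "u + v = (1 + v / u) * u" using uv by (simp add: field_simps)
    then show ?thesis using P_mult uv \<O>_closed by metis
  qed
  show ?thesis
  proof (cases "u = 0 \<or> v = 0")
    case False
    have "v / u \<in> L"
      using assms P_subset_\<O> \<O>_subset_L subfield_divide[OF subfield_L] by blast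
    then have "v / u \<in> \<O> \<or> u / v \<in> \<O>"
      using in_\<O>_or_inverse_in_P P_subset_\<O> by (metis inverse_divide)
    then show ?thesis using *[of u v] *[of v u] assms False by (auto simp: add.commute)
  qed (use assms in auto)
qed

lemma P_diff: "u \<in> P \<Longrightarrow> v \<in> P \<Longrightarrow> u - v \<in> P"
  using P_add[of u "- v"] P_minus by simp

lemma P_sum: "(\<And>i. i \<in> I \<Longrightarrow> u i \<in> P) \<Longrightarrow> sum u I \<in> P"
  by (induction I rule: infinite_finite_induct) (auto intro: P_add)

lemma \<iota>_in_P_iff [simp]: "\<iota> c \<in> P \<longleftrightarrow> c = 0"
proof
  assume "\<iota> c \<in> P"
  show "c = 0"
  proof (rule ccontr)
    assume "c \<noteq> 0"
    have "\<iota> (inverse c) * \<iota> c \<in> P" using P_mult \<open>\<iota> c \<in> P\<close> by simp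
    then show False using \<open>c \<noteq> 0\<close> by (simp add: \<iota>_mult[symmetric])
  qed
qed simp

lemma P_prime:
  assumes "u \<in> \<O>" "v \<in> \<O>" "u * v \<in> P" shows "u \<in> P \<or> v \<in> P"
proof (rule ccontr)
  assume not: "\<not> ?thesis"
  then have "inverse u * (u * v) \<in> P" "u \<noteq> 0" using assms unit_inverse P_mult by blast+
  moreover from this have "inverse u * (u * v) = v" by simp
  ultimately show False using not by simp
qed

lemma P_prime_power: "u \<in> \<O> \<Longrightarrow> u ^ k \<in> P \<Longrightarrow> u \<in> P"
proof (induction k)
  case (Suc k)
  then show ?case using P_prime[of u "u ^ k"] \<O>_closed by auto
qed simp

lemma P_prime_prod:
  assumes "finite I" "\<And>i. i \<in> I \<Longrightarrow> u i \<in> \<O>" "prod u I \<in> P"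
  shows "\<exists>i\<in>I. u i \<in> P"
  using assms
proof (induction I rule: finite_induct)
  case (insert i I)
  then show ?case using P_prime[of "u i" "prod u I"] subring_prod[OF subring_\<O>, of I u] by auto
qed simp

lemma unit_mult: "u \<in> \<O> - P \<Longrightarrow> v \<in> \<O> - P \<Longrightarrow> u * v \<in> \<O> - P"
  using P_prime[of u v] \<O>_closed(4)[of u v] by auto

lemma unit_power: "u \<in> \<O> - P \<Longrightarrow> u ^ k \<in> \<O> - P"
  using P_prime_power[of u k] \<O>_closed(7)[of u k] by auto

lemma unit_inverse': "u \<in> \<O> - P \<Longrightarrow> inverse u \<in> \<O> - P"
  using unit_inverse by blast

lemma unit_power_int: "u \<in> \<O> - P \<Longrightarrow> u powi k \<in> \<O> - P"
  unfolding power_int_def using unit_power unit_inverse' by simp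

lemma unit_divide: "u \<in> \<O> - P \<Longrightarrow> v \<in> \<O> - P \<Longrightarrow> u / v \<in> \<O> - P"
  unfolding divide_inverse by (intro unit_mult unit_inverse')

lemma unit_add: "u \<in> \<O> - P \<Longrightarrow> v \<in> P \<Longrightarrow> u + v \<in> \<O> - P"
  using P_diff[of "u + v" v] P_subset_\<O>[of v] \<O>_closed(6)[of u v] by auto

lemma ev_in_\<O>: "z \<in> \<O> \<Longrightarrow> ev p z \<in> \<O>"
  by (rule ev_in_subring[OF subring_\<O>]) auto

lemma \<iota>_diff_in_\<O>: "z - \<iota> b \<in> P \<Longrightarrow> z \<in> \<O>"
  using P_subset_\<O>[of "z - \<iota> b"] \<O>_closed(6)[of "z - \<iota> b" "\<iota> b"] by simp

lemma ev_congruent: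
  assumes "z - \<iota> b \<in> P" shows "ev p z - \<iota> (poly p b) \<in> P"
proof -
  obtain q where "ev p z - \<iota> (poly p b) = (z - \<iota> b) * ev q z"
    by (rule ev_minus_value_dvd)
  then show ?thesis using P_mult2[OF assms] ev_in_\<O> \<iota>_diff_in_\<O>[OF assms] by simp
qed

lemma ev_in_P_iff: "z - \<iota> b \<in> P \<Longrightarrow> ev p z \<in> P \<longleftrightarrow> poly p b = 0"
  using ev_congruent[of z b p] P_diff[of "ev p z" "ev p z - \<iota> (poly p b)"] by auto

lemma residue_unique: "z - \<iota> b \<in> P \<Longrightarrow> z - \<iota> c \<in> P \<Longrightarrow> b = c"
  using P_diff[of "z - \<iota> b" "z - \<iota> c"] by (simp add: \<iota>_diff[symmetric])

text \<open>Among finitely many elements with pairwise different valuations one dominates, so their sum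
  cannot vanish.\<close>

lemma sum_nonzero_of_distinct_orders:
  assumes "finite I" "I \<noteq> {}" "\<And>i. i \<in> I \<Longrightarrow> T i \<noteq> 0"
    and "\<And>i j. i \<in> I \<Longrightarrow> j \<in> I \<Longrightarrow> i \<noteq> j \<Longrightarrow> T i / T j \<in> P \<or> T j / T i \<in> P"
  shows "sum T I \<noteq> 0"
proof -
  have "\<exists>j\<in>I. \<forall>i\<in>I - {j}. T i / T j \<in> P"
    using assms
  proof (induction I rule: finite_ne_induct)
    case (insert k I)
    then obtain j where j: "j \<in> I" "\<forall>i\<in>I - {j}. T i / T j \<in> P" by auto
    then have "j \<noteq> k" using insert.hyps by auto
    then consider "T k / T j \<in> P" | "T j / T k \<in> P" using insert.prems j by blast
    then show ?case
    proof cases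
      case 2
      have "T i / T k \<in> P" if "i \<in> I" for i
      proof (cases "i = j")
        case False
        then have "T i / T j * (T j / T k) \<in> P"
          using j that 2 P_mult2 P_subset_\<O> by blast
        then show ?thesis using insert.prems(1)[of j] j by simp
      qed (use 2 in simp)
      then show ?thesis by blast
    qed (use j in blast)
  qed auto
  then obtain j where j: "j \<in> I" "\<forall>i\<in>I - {j}. T i / T j \<in> P" by auto
  have "sum T I / T j = 1 + (\<Sum>i\<in>I - {j}. T i / T j)"
    unfolding sum_divide_distrib using assms(3)[OF j(1)] j(1) assms(1)
    by (subst sum.remove[of _ j]) auto
  moreover have "(\<Sum>i\<in>I - {j}. T i / T j) \<in> P" using j by (intro P_sum) auto
  ultimately have "sum T I / T j \<notin> P"
    using unit_add[of 1] \<O>_closed(1) by auto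
  then show ?thesis by auto
qed

end

section \<open>Discrete valuations of a function field\<close>

text \<open>The finiteness of \<open>F/K(x)\<close> is expressed by a spanning family, whose size \<open>d\<close> bounds the degree;
  this bound makes the places discrete.\<close>

locale function_field = constant_field \<iota> for \<iota> :: "'k::field \<Rightarrow> 'f::field" +
  fixes x :: 'f and d :: nat and b :: "nat \<Rightarrow> 'f"
  assumes transc: "transcendental_over \<iota> x"
    and spanning: "\<exists>c. (\<forall>j<d. c j \<in> adjoin \<iota> {x}) \<and> z = (\<Sum>j<d. c j * b j)"
begin

lemma ev_x_eq_0_iff: "ev p x = 0 \<longleftrightarrow> p = 0"
  using transc by (auto simp: transcendental_over_def)

lemma rational_function:
  assumes "c \<in> adjoin \<iota> {x}" "c \<noteq> 0"
  obtains p q where "p \<noteq> 0" "q \<noteq> 0" "c = ev p x / ev q x"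
proof -
  obtain p q where "c = ev p x / ev q x" using assms unfolding adjoin_singleton by blast
  then show thesis using assms that by (metis divide_eq_0_iff ev_x_eq_0_iff)
qed

end

locale function_field_place = function_field \<iota> x d b + place \<iota> UNIV P
  for \<iota> :: "'k::field \<Rightarrow> 'f::field" and x d b P
begin

lemma in_\<O>_or_inverse: "z \<in> \<O> \<or> inverse z \<in> P"
  by (rule in_\<O>_or_inverse_in_P) simp

text \<open>An analogue of the bound of the ramification index by the degree: more than \<open>d\<close> elements
  cannot have valuations that differ modulo the valuations of \<open>K(x)\<close>.\<close>

lemma no_separated_family:
  assumes z: "\<And>i. i \<le> d \<Longrightarrow> z i \<noteq> 0"
    and sep: "\<And>i j c. i < j \<Longrightarrow> j \<le> d \<Longrightarrow> c \<in> adjoin \<iota> {x} \<Longrightarrow> c \<noteq> 0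
                \<Longrightarrow> c * z i / z j \<in> P \<or> z j / (c * z i) \<in> P"
  shows False
proof -
  have "\<exists>c. (\<forall>i\<in>{..d}. c i \<in> adjoin \<iota> {x}) \<and> (\<exists>i\<in>{..d}. c i \<noteq> 0)
      \<and> (\<Sum>i\<in>{..d}. c i * z i) = 0"
  proof (rule linear_dependence[OF subfield_adjoin, where J = "{..<d}" and b = b])
    show "\<exists>c. (\<forall>j\<in>{..<d}. c j \<in> adjoin \<iota> {x}) \<and> z i = (\<Sum>j<d. c j * b j)" for i
      using spanning[of "z i"] by auto
  qed auto
  then obtain c where c: "\<And>i. i \<le> d \<Longrightarrow> c i \<in> adjoin \<iota> {x}" "\<exists>i\<le>d. c i \<noteq> 0"
      "(\<Sum>i\<in>{..d}. c i * z i) = 0" by auto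
  define I where "I = {i. i \<le> d \<and> c i \<noteq> 0}"
  have "(\<Sum>i\<in>I. c i * z i) = (\<Sum>i\<in>{..d}. c i * z i)"
    by (rule sum.mono_neutral_left) (auto simp: I_def)
  moreover have "(\<Sum>i\<in>I. c i * z i) \<noteq> 0"
  proof (rule sum_nonzero_of_distinct_orders)
    show "finite I" "I \<noteq> {}" using c(2) by (auto simp: I_def)
    show "c i * z i \<noteq> 0" if "i \<in> I" for i using that z by (auto simp: I_def)
    have *: "c i * z i / (c j * z j) \<in> P \<or> c j * z j / (c i * z i) \<in> P"
      if "i \<in> I" "j \<in> I" "i < j" for i j
    proof -
      have "c i / c j \<in> adjoin \<iota> {x}" "c i / c j \<noteq> 0"
        using that c by (auto simp: I_def intro: subfield_divide[OF subfield_adjoin])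
      then show ?thesis using sep[of i j "c i / c j"] that by (auto simp: I_def mult_ac)
    qed
    show "c i * z i / (c j * z j) \<in> P \<or> c j * z j / (c i * z i) \<in> P"
      if "i \<in> I" "j \<in> I" "i \<noteq> j" for i j
      using *[of i j] *[of j i] that by (metis linorder_neqE_nat)
  qed
  ultimately show False using c by simp
qed

lemma rational_function_order_at_infinity:
  assumes x: "inverse x \<in> P" and c: "c \<in> adjoin \<iota> {x}" "c \<noteq> 0"
  shows "\<exists>k u. u \<in> \<O> - P \<and> c = inverse x powi k * u"
proof -
  have [simp]: "x \<noteq> 0" using ev_x_eq_0_iff[of "[:0, 1:]"] by auto
  have poly: "\<exists>u. u \<in> \<O> - P \<and> ev p x = x ^ degree p * u" if "p \<noteq> 0" for p
    using that
  proof (induction p)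
    case (pCons a p)
    show ?case
    proof (cases "p = 0")
      case False
      then obtain u where u: "u \<in> \<O> - P" "ev p x = x ^ degree p * u" using pCons by auto
      have "u + \<iota> a * inverse x ^ degree (pCons a p) \<in> \<O> - P"
      proof (rule unit_add[OF u(1)])
        have "inverse x ^ degree (pCons a p) = inverse x * inverse x ^ degree p"
          using False by simp
        also have "\<dots> \<in> P"
          by (rule P_mult2[OF x]) (rule \<O>_closed(7)[OF P_subset_\<O>[OF x]])
        finally show "\<iota> a * inverse x ^ degree (pCons a p) \<in> P" by (intro P_mult) simp
      qed
      moreover have "ev (pCons a p) x
          = x ^ degree (pCons a p) * (u + \<iota> a * inverse x ^ degree (pCons a p))"
        using False u by (simp add: field_simps)
      ultimately show ?thesis by blast
    qed (use pCons in auto)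
  qed simp
  obtain p q where pq: "p \<noteq> 0" "q \<noteq> 0" "c = ev p x / ev q x" using c by (rule rational_function)
  obtain u v where uv: "u \<in> \<O> - P" "v \<in> \<O> - P"
    "ev p x = x ^ degree p * u" "ev q x = x ^ degree q * v" using poly pq by metis
  have "c = x powi (int (degree p) - int (degree q)) * (u / v)"
    unfolding pq uv by (simp add: power_int_diff)
  also have "x powi (int (degree p) - int (degree q))
      = inverse x powi (int (degree q) - int (degree p))"
    by (simp add: power_int_diff field_simps)
  finally show ?thesis using unit_divide[OF uv(1,2)] by blast
qed

text \<open>If \<open>x\<close> is integral at \<open>P\<close>, then some polynomial in \<open>x\<close> is a non-unit, because otherwise \<open>K(x)\<close>
  would be contained in \<open>\<O>\<close>, and so would its finite extension \<open>F\<close>.\<close>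

lemma polynomial_in_place:
  assumes "x \<in> \<O>"
  shows "\<exists>p. p \<noteq> 0 \<and> ev p x \<in> P"
proof (rule ccontr)
  assume none: "\<not> ?thesis"
  have unit: "c \<in> \<O> - P" if "c \<in> adjoin \<iota> {x}" "c \<noteq> 0" for c
    using rational_function[OF that] none ev_in_\<O>[OF assms] unit_divide by (metis DiffI)
  have "\<O> \<noteq> UNIV"
    using valuation_ring_of_place by (auto simp: valuation_ring_def)
  then obtain z where z: "z \<notin> \<O>" by auto
  then have z_inv: "inverse z \<in> P" using in_\<O>_or_inverse by auto
  have z0: "z \<noteq> 0" using z \<O>_closed(2) by auto
  show False
  proof (rule no_separated_family)
    show "z ^ i \<noteq> 0" for i using z0 by simp
    fix i j :: nat and c assume ij: "i < j" and c: "c \<in> adjoin \<iota> {x}" "c \<noteq> 0"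
    have "c * z ^ i / z ^ j = c * inverse z ^ (j - Suc i) * inverse z"
      using ij z0 by (simp add: field_simps flip: power_Suc power_add)
    also have "\<dots> \<in> P" using unit[OF c] z_inv P_subset_\<O> by (intro P_mult \<O>_closed) auto
    finally show "c * z ^ i / z ^ j \<in> P \<or> z ^ j / (c * z ^ i) \<in> P" ..
  qed
qed

text \<open>The restriction of the valuation to \<open>K(x)\<close> is discrete: if \<open>x\<close> is not integral at \<open>P\<close>, then \<open>1/x\<close>
  generates its value group; otherwise a polynomial of least degree in \<open>P\<close> does, because a remainder
  modulo it that lies in \<open>P\<close> must vanish.\<close>

lemma rational_function_orders:
  "\<exists>\<pi>. \<pi> \<in> P \<and> \<pi> \<noteq> 0 \<and>
     (\<forall>c. c \<in> adjoin \<iota> {x} \<longrightarrow> c \<noteq> 0 \<longrightarrow> (\<exists>k u. u \<in> \<O> - P \<and> c = \<pi> powi k * u))"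
proof (cases "x \<in> \<O>")
  case False
  then have "inverse x \<in> P" "inverse x \<noteq> 0" using in_\<O>_or_inverse[of x] \<O>_closed(2) by auto
  then show ?thesis using rational_function_order_at_infinity by blast
next
  case True
  define p where "p = (ARG_MIN degree p. p \<noteq> 0 \<and> ev p x \<in> P)"
  have p: "p \<noteq> 0" "ev p x \<in> P"
    using arg_min_natI[of "\<lambda>p. p \<noteq> 0 \<and> ev p x \<in> P"] polynomial_in_place[OF True]
    by (auto simp: p_def)
  have p_min: "degree p \<le> degree q" if "q \<noteq> 0" "ev q x \<in> P" for q
    unfolding p_def by (rule arg_min_nat_le) (use that in auto)
  have p_deg: "degree p > 0"
  proof (rule ccontr)
    assume "\<not> degree p > 0"
    then obtain a where "p = [:a:]" using degree_eq_zeroE by blast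
    then show False using p by auto
  qed
  have poly: "\<exists>k u. u \<in> \<O> - P \<and> ev q x = ev p x ^ k * u" if "q \<noteq> 0" for q
    using that
  proof (induction "degree q" arbitrary: q rule: less_induct)
    case less
    show ?case
    proof (cases "ev q x \<in> P")
      case False
      then show ?thesis using ev_in_\<O>[OF True, of q] by (intro exI[of _ 0] exI[of _ "ev q x"]) auto
    next
      case inP: True
      have "ev (q mod p) x = ev q x - ev p x * ev (q div p) x"
        by (simp flip: ev_mult ev_diff add: minus_mult_div_eq_mod)
      then have "ev (q mod p) x \<in> P"
        using inP p P_mult2 P_diff ev_in_\<O>[OF True] by simp
      then have "q mod p = 0"
        using p_min[of "q mod p"] degree_mod_less[OF p(1), of q] by linarith
      then have q: "q = p * (q div p)" by (metis mult_div_mod_eq add_0_right)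
      then have "q div p \<noteq> 0" using less.prems by auto
      moreover from this have "degree (q div p) < degree q"
        using degree_mult_eq[of p "q div p"] p p_deg q by simp
      ultimately obtain k u where "u \<in> \<O> - P" "ev (q div p) x = ev p x ^ k * u"
        using less.hyps by blast
      then show ?thesis
        by (intro exI[of _ "Suc k"] exI[of _ u]) (subst q, simp add: ev_mult)
    qed
  qed
  show ?thesis
  proof (intro exI[of _ "ev p x"] conjI allI impI)
    fix c assume c: "c \<in> adjoin \<iota> {x}" "c \<noteq> 0"
    obtain q r where qr: "q \<noteq> 0" "r \<noteq> 0" "c = ev q x / ev r x" using c by (rule rational_function)
    obtain k l u v where uv: "u \<in> \<O> - P" "v \<in> \<O> - P"
      "ev q x = ev p x ^ k * u" "ev r x = ev p x ^ l * v" using poly qr by metis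
    have "c = ev p x powi (int k - int l) * (u / v)"
      using p ev_x_eq_0_iff unfolding qr uv by (simp add: power_int_diff)
    then show "\<exists>k u. u \<in> \<O> - P \<and> c = ev p x powi k * u" using unit_divide[OF uv(1,2)] by blast
  qed (use p ev_x_eq_0_iff in auto)
qed

lemma prime_element_iff: "prime_element P t \<longleftrightarrow> t \<in> P \<and> t \<noteq> 0 \<and> (\<forall>z\<in>P. z / t \<in> \<O>)"
proof
  assume t: "prime_element P t"
  then have P: "P = {t * w |w. w \<in> \<O>}" by (simp add: prime_element_def)
  obtain \<pi> where \<pi>: "\<pi> \<in> P" "\<pi> \<noteq> 0" using rational_function_orders by blast
  have "t * 1 \<in> P" using \<O>_closed(1) by (subst P) blast
  moreover have "t \<noteq> 0" using \<pi> P by auto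
  moreover have "z / t \<in> \<O>" if "z \<in> P" for z
  proof -
    obtain w where "w \<in> \<O>" "z = t * w" using \<open>z \<in> P\<close> by (subst (asm) P) blast
    then show ?thesis using \<open>t \<noteq> 0\<close> by simp
  qed
  ultimately show "t \<in> P \<and> t \<noteq> 0 \<and> (\<forall>z\<in>P. z / t \<in> \<O>)" by simp
next
  assume t: "t \<in> P \<and> t \<noteq> 0 \<and> (\<forall>z\<in>P. z / t \<in> \<O>)"
  show "prime_element P t"
    unfolding prime_element_def
  proof (intro equalityI subsetI)
    fix z assume "z \<in> P"
    then have "z = t * (z / t)" "z / t \<in> \<O>" using t by auto
    then show "z \<in> {t * w |w. w \<in> \<O>}" by blast
  qed (use t P_mult2 in auto)
qed

text \<open>If \<open>P\<close> were not principal, there would be an infinite sequence of elements, starting with a given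
  \<open>\<pi>\<close>, whose valuations decrease but stay positive, against the bound
  for families with separated valuations. The same bound shows that \<open>\<pi>\<close> is not divisible by all
  powers of a generator \<open>t\<close>. An element \<open>z\<close> divisible by all powers of \<open>t\<close> is excluded too,
  because the valuations of its powers would differ by more than any valuation of \<open>K(x)\<close>.\<close>

lemma prime_element_existence_and_factorization:
  "\<exists>t. prime_element P t \<and> (\<forall>z. z \<noteq> 0 \<longrightarrow> (\<exists>k u. u \<in> \<O> - P \<and> z = t powi k * u))"
proof -
  obtain \<pi> where \<pi>: "\<pi> \<in> P" "\<pi> \<noteq> 0"
    and orders: "\<And>c. c \<in> adjoin \<iota> {x} \<Longrightarrow> c \<noteq> 0 \<Longrightarrow> \<exists>k u. u \<in> \<O> - P \<and> c = \<pi> powi k * u"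
    using rational_function_orders by blast
  (* The valuations of the z i are positive, at most that of \<pi>, and strictly decreasing; so they
     stay different modulo those of K(x), which are multiples of that of \<pi>. *)
  have no_chain: False
    if z: "\<And>i. i \<le> d \<Longrightarrow> z i \<in> P \<and> z i \<noteq> 0 \<and> \<pi> / z i \<in> \<O>"
      and desc: "\<And>i j. i < j \<Longrightarrow> j \<le> d \<Longrightarrow> z i / z j \<in> P" for z :: "nat \<Rightarrow> 'f"
  proof (rule no_separated_family[of z])
    fix i j :: nat and c assume ij: "i < j" "j \<le> d" and c: "c \<in> adjoin \<iota> {x}" "c \<noteq> 0"
    obtain k u where u: "u \<in> \<O> - P" and cu: "c = \<pi> powi k * u" using orders[OF c] by blast
    have z_ij: "z i \<noteq> 0" "z j \<in> P" "z j \<noteq> 0" "\<pi> / z i \<in> \<O>" "z i / z j \<in> P"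
      using z[of i] z[of j] desc ij by auto
    show "c * z i / z j \<in> P \<or> z j / (c * z i) \<in> P"
    proof (cases "k \<ge> 0")
      case True
      have "c * z i / z j = \<pi> ^ nat k * u * (z i / z j)" using True cu by (simp add: power_int_def)
      also have "\<dots> \<in> P" using u \<pi> z_ij P_subset_\<O> by (intro P_mult \<O>_closed) auto
      finally show ?thesis ..
    next
      case False
      have "z j / (c * z i) = \<pi> powi (- k - 1) * inverse u * (\<pi> / z i) * z j"
        using \<pi> cu u by (simp add: power_int_diff power_int_minus field_simps)
      also have "\<pi> powi (- k - 1) = \<pi> ^ nat (- k - 1)" using False by (simp add: power_int_def)
      also have "\<pi> ^ nat (- k - 1) * inverse u * (\<pi> / z i) * z j \<in> P"
        using u \<pi> z_ij P_subset_\<O> unit_inverse[of u] by (intro P_mult \<O>_closed) auto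
      finally show ?thesis ..
    qed
  qed (use z in auto)
  have "\<exists>t. prime_element P t"
  proof (rule ccontr)
    assume none: "\<not> ?thesis"
    have "\<exists>w. (w \<in> P \<and> w \<noteq> 0) \<and> v / w \<in> P" if "v \<in> P \<and> v \<noteq> 0" for v
    proof -
      obtain w where w: "w \<in> P" "w / v \<notin> \<O>"
        using none \<open>v \<in> P \<and> v \<noteq> 0\<close> prime_element_iff by blast
      then have "v / w \<in> P" using in_\<O>_or_inverse[of "w / v"] by simp
      moreover have "w \<noteq> 0" using w \<O>_closed(2) by auto
      ultimately show ?thesis using w by blast
    qed
    then have "\<exists>z. \<forall>i. (z i \<in> P \<and> z i \<noteq> 0 \<and> (i = 0 \<longrightarrow> z i = \<pi>)) \<and> z i / z (Suc i) \<in> P"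
      using \<pi> by (intro dependent_nat_choice) auto
    then obtain z where z: "\<And>i. z i \<in> P \<and> z i \<noteq> 0" "z 0 = \<pi>" "\<And>i. z i / z (Suc i) \<in> P"
      by blast
    have desc: "z i / z j \<in> P" if "i < j" for i j
      using that
    proof (induction j)
      case (Suc j)
      show ?case
      proof (cases "i = j")
        case False
        then have "z i / z j \<in> P" using Suc by simp
        then have "z i / z j * (z j / z (Suc j)) \<in> P"
          by (rule P_mult2) (rule P_subset_\<O>[OF z(3)])
        then show ?thesis using z(1)[of j] by simp
      qed (use z in simp)
    qed simp
    have "\<pi> / z i \<in> \<O>" for i
      using desc[of 0 i] z(1)[of 0] z(2) P_subset_\<O> \<O>_closed(1) by (cases "i = 0") auto
    then show False using no_chain[of z] z(1) desc by blast
  qed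
  then obtain t where t: "prime_element P t" ..
  then have tP: "t \<in> P" "t \<noteq> 0" and t_div: "\<And>z. z \<in> P \<Longrightarrow> z / t \<in> \<O>"
    by (auto simp: prime_element_iff)
  have t_pow: "t ^ k \<in> \<O>" for k by (rule \<O>_closed(7)[OF P_subset_\<O>[OF tP(1)]])
  have factor: "\<exists>k u. u \<in> \<O> - P \<and> z = t ^ k * u" if z: "z \<in> \<O>" "z / t ^ k \<notin> \<O>" for z k
    using z(2)
  proof (induction k)
    case (Suc k)
    show ?case
    proof (cases "z / t ^ k \<in> \<O>")
      case True
      have "z / t ^ k \<notin> P" using t_div[of "z / t ^ k"] Suc.prems by (auto simp: mult.commute)
      then show ?thesis using True tP by (intro exI[of _ k] exI[of _ "z / t ^ k"]) auto
    qed (use Suc in auto)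
  qed (use z in auto)
  obtain e u\<^sub>\<pi> where e: "u\<^sub>\<pi> \<in> \<O> - P" "\<pi> = t ^ e * u\<^sub>\<pi>"
  proof -
    have "\<exists>k. \<pi> / t ^ k \<notin> \<O>"
    proof (rule ccontr)
      assume "\<not> ?thesis"
      then have \<pi>_div: "\<pi> / t ^ k \<in> \<O>" for k by auto
      define z where "z = (\<lambda>i. if i = 0 then \<pi> else t ^ (Suc d - i))"
      show False
      proof (rule no_chain[of z])
        show "z i \<in> P \<and> z i \<noteq> 0 \<and> \<pi> / z i \<in> \<O>" if "i \<le> d" for i
        proof -
          have "t ^ (Suc d - i) \<in> P"
            using that P_mult2[OF tP(1) t_pow[of "d - i"]] by (simp add: Suc_diff_le)
          then show ?thesis using that \<pi> \<pi>_div tP \<O>_closed(1) by (auto simp: z_def)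
        qed
        show "z i / z j \<in> P" if "i < j" "j \<le> d" for i j
        proof (cases "i = 0")
          case True
          have "z i / z j = t * (\<pi> / t ^ Suc (Suc d - j))"
            using True that tP by (simp add: z_def)
          then show ?thesis using P_mult2[OF tP(1) \<pi>_div] by metis
        next
          case False
          have "Suc d - i = (j - i - 1) + 1 + (Suc d - j)" using that by simp
          then have "t ^ (Suc d - i) = t ^ (j - i - 1) * t * t ^ (Suc d - j)"
            by (simp only: power_add power_one_right)
          then have "z i / z j = t ^ (j - i - 1) * t"
            using False that tP by (simp add: z_def)
          then show ?thesis using P_mult[OF t_pow tP(1)] by metis
        qed
      qed
    qed
    then show thesis using factor[of \<pi>] \<pi> P_subset_\<O> that by blast
  qed
  have factor_\<O>: "\<exists>k u. u \<in> \<O> - P \<and> z = t powi k * u" if z: "z \<in> \<O>" "z \<noteq> 0" for z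
  proof (cases "\<exists>k. z / t ^ k \<notin> \<O>")
    case True
    then obtain k u where "u \<in> \<O> - P" "z = t ^ k * u" using factor z by blast
    then show ?thesis by (intro exI[of _ "int k"] exI[of _ u]) simp
  next
    case False
    then have z_div: "z / t ^ k \<in> \<O>" for k by auto
    have z_P: "z * t powi k \<in> P" for k
    proof (cases "k \<ge> 1")
      case True
      then have "nat k = Suc (nat (k - 1))" by simp
      then have "t powi k = t * t ^ nat (k - 1)" using True by (simp add: power_int_def)
      then show ?thesis using P_mult[OF z(1) P_mult2[OF tP(1) t_pow]] by metis
    next
      case False
      have "z * t powi k = t * (z / t ^ Suc (nat (- k)))"
        using False tP by (simp add: power_int_def field_simps)
      then show ?thesis using P_mult2[OF tP(1) z_div] by metis
    qed
    have False
    proof (rule no_separated_family)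
      show "z ^ i \<noteq> 0" for i using z by simp
      fix i j :: nat and c assume ij: "i < j" and c: "c \<in> adjoin \<iota> {x}" "c \<noteq> 0"
      obtain k u where u: "u \<in> \<O> - P" and cu: "c = \<pi> powi k * u" using orders[OF c] by blast
      have "c = t powi (int e * k) * (u\<^sub>\<pi> powi k * u)"
        unfolding cu e by (simp add: power_int_mult_distrib power_int_mult)
      moreover have "j = i + 1 + (j - i - 1)" using ij by simp
      then have "z ^ j = z ^ i * z * z ^ (j - i - 1)"
        by (metis power_add power_one_right)
      ultimately have "z ^ j / (c * z ^ i)
          = inverse (u\<^sub>\<pi> powi k * u) * z ^ (j - i - 1) * (z * t powi (- (int e * k)))"
        using z(2) by (simp add: field_simps power_int_minus)
      also have "\<dots> \<in> P"
        using unit_inverse'[OF unit_mult[OF unit_power_int[OF e(1)] u]]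
        by (intro P_mult[OF _ z_P] \<O>_closed(4) \<O>_closed(7)[OF z(1)]) blast
      finally show "c * z ^ i / z ^ j \<in> P \<or> z ^ j / (c * z ^ i) \<in> P" ..
    qed
    then show ?thesis ..
  qed
  have "\<exists>k u. u \<in> \<O> - P \<and> z = t powi k * u" if z: "z \<noteq> 0" for z
  proof (cases "z \<in> \<O>")
    case False
    then have "inverse z \<in> \<O>" using in_\<O>_or_inverse P_subset_\<O> by blast
    then obtain k u where u: "u \<in> \<O> - P" "inverse z = t powi k * u" using factor_\<O>[of "inverse z"] z by auto
    have "z = t powi (- k) * inverse u"
      using u(2) by (metis inverse_inverse_eq inverse_mult_distrib power_int_minus)
    then show ?thesis using unit_inverse'[OF u(1)] by blast
  qed (use factor_\<O> z in auto)
  then show ?thesis using t by blast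
qed

end

context function_field_place
begin

lemma power_int_prime_in_\<O>_iff:
  assumes t: "prime_element P t" and u: "u \<in> \<O> - P"
  shows "t powi k * u \<in> \<O> \<longleftrightarrow> k \<ge> 0" and "t powi k * u \<in> P \<longleftrightarrow> k > 0"
proof -
  have tP: "t \<in> P" "t \<noteq> 0" using t by (auto simp: prime_element_iff)
  have pos: "t powi k * u \<in> P" if "k > 0" and u: "u \<in> \<O>" for k u
  proof -
    have "nat k = Suc (nat (k - 1))" using that by simp
    then have "t powi k * u = t * (t ^ nat (k - 1) * u)" using that by (simp add: power_int_def)
    moreover have "t * (t ^ nat (k - 1) * u) \<in> P"
      by (intro P_mult2[OF tP(1)] \<O>_closed(4) \<O>_closed(7)[OF P_subset_\<O>[OF tP(1)]] u)
    ultimately show ?thesis by (simp only:)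
  qed
  have neg: "t powi k * u \<notin> \<O>" if "k < 0"
  proof
    assume "t powi k * u \<in> \<O>"
    then have "t powi (- k) * inverse u * (t powi k * u) \<in> P"
      using that unit_inverse'[OF u] by (intro P_mult2[OF pos]) auto
    moreover have "t powi (- k) * inverse u * (t powi k * u) = 1"
      using tP(2) u unit_inverse[of u] by (simp add: power_int_minus field_simps)
    ultimately show False by simp
  qed
  have zero: "t powi k * u \<in> \<O> - P" if "k = 0" using u that by simp
  show "t powi k * u \<in> \<O> \<longleftrightarrow> k \<ge> 0"
    using pos[of k u] neg zero u P_subset_\<O>[of "t powi k * u"]
    by (cases k "0 :: int" rule: linorder_cases) auto
  show "t powi k * u \<in> P \<longleftrightarrow> k > 0"
    using pos[of k u] neg zero u P_subset_\<O>[of "t powi k * u"]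
    by (cases k "0 :: int" rule: linorder_cases) auto
qed

lemma prime_element_exists: "\<exists>t. prime_element P t"
  using prime_element_existence_and_factorization by blast

lemma prime_element_divide:
  assumes "prime_element P t" "prime_element P t'" shows "t' / t \<in> \<O> - P"
proof -
  have "t' / t \<in> \<O>" "t / t' \<in> \<O>" "t \<noteq> 0" "t' \<noteq> 0"
    using assms by (auto simp: prime_element_iff)
  moreover from this have "t' / t \<notin> P" using P_mult2[of "t' / t" "t / t'"] by auto
  ultimately show ?thesis by blast
qed

lemma factorization:
  assumes t: "prime_element P t" and z: "z \<noteq> 0"
  shows "\<exists>k u. u \<in> \<O> - P \<and> z = t powi k * u"
proof -
  obtain t' k u where t': "prime_element P t'" and u: "u \<in> \<O> - P" "z = t' powi k * u"
    using prime_element_existence_and_factorization z by blast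
  have "t \<noteq> 0" using t by (simp add: prime_element_iff)
  then have "z = t powi k * ((t' / t) powi k * u)"
    unfolding u(2) by (simp add: power_int_divide_distrib)
  then show ?thesis
    using unit_mult[OF unit_power_int[OF prime_element_divide[OF t t']] u(1)] by blast
qed

text \<open>The exponent does not depend on the prime element because two prime elements differ by a unit.\<close>

lemma place_val_eqI:
  assumes t: "prime_element P t" and u: "u \<in> \<O> - P" and z: "z = t powi k * u"
  shows "place_val P z = k"
  unfolding place_val_def
proof (rule the_equality)
  show "\<exists>t u. prime_element P t \<and> u \<in> \<O> - P \<and> z = t powi k * u" using assms by blast
  fix l assume "\<exists>t u. prime_element P t \<and> u \<in> \<O> - P \<and> z = t powi l * u"
  then obtain t' u' where t': "prime_element P t'" and u': "u' \<in> \<O> - P" "z = t' powi l * u'"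
    by blast
  have t0: "t \<noteq> 0" using t by (simp add: prime_element_iff)
  define w where "w = (t' / t) powi l * u' * inverse u"
  have w: "w \<in> \<O> - P"
    unfolding w_def
    by (intro unit_mult unit_power_int prime_element_divide[OF t t'] u' unit_inverse'[OF u])
  have "t' powi l = t powi l * (t' / t) powi l"
    using t0 by (simp add: power_int_divide_distrib)
  then have "t powi (l - k) * w = 1"
    using z u'(2) t0 u unit_inverse[of u] by (simp add: w_def power_int_diff field_simps)
  then have "t powi (l - k) * w \<in> \<O>" "t powi (l - k) * w \<notin> P" using \<O>_closed(1) by simp_all
  then show "l = k" unfolding power_int_prime_in_\<O>_iff[OF t w] by simp
qed

lemma place_val_cases:
  assumes "z \<noteq> 0"
  obtains t u where "prime_element P t" "t \<noteq> 0" "u \<in> \<O> - P" "z = t powi place_val P z * u"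
proof -
  obtain t where t: "prime_element P t" using prime_element_exists by blast
  obtain k u where u: "u \<in> \<O> - P" "z = t powi k * u" using factorization[OF t assms] by blast
  show thesis using that[OF t _ u(1)] t u(2) place_val_eqI[OF t u] by (simp add: prime_element_iff)
qed

lemma place_val_nonneg_iff: "z \<noteq> 0 \<Longrightarrow> place_val P z \<ge> 0 \<longleftrightarrow> z \<in> \<O>"
  and place_val_pos_iff: "z \<noteq> 0 \<Longrightarrow> place_val P z > 0 \<longleftrightarrow> z \<in> P"
proof -
  assume "z \<noteq> 0"
  then obtain t u where "prime_element P t" "u \<in> \<O> - P" and z: "z = t powi place_val P z * u"
    by (rule place_val_cases)
  note * = power_int_prime_in_\<O>_iff[OF this(1,2), of "place_val P z", folded z]
  show "place_val P z \<ge> 0 \<longleftrightarrow> z \<in> \<O>" "place_val P z > 0 \<longleftrightarrow> z \<in> P" using * by simp_all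
qed

lemma place_val_unit: "u \<in> \<O> - P \<Longrightarrow> place_val P u = 0"
  using prime_element_exists place_val_eqI[of _ u u 0] by auto

lemma place_val_prime: "prime_element P t \<Longrightarrow> place_val P t = 1"
  by (rule place_val_eqI[of t 1]) (auto simp: \<O>_closed(1))

lemma place_val_mult:
  assumes "z \<noteq> 0" "w \<noteq> 0" shows "place_val P (z * w) = place_val P z + place_val P w"
proof -
  obtain t where t: "prime_element P t" using prime_element_exists by blast
  then have "t \<noteq> 0" by (simp add: prime_element_iff)
  obtain k u where u: "u \<in> \<O> - P" "z = t powi k * u" using factorization[OF t assms(1)] by blast
  obtain l v where v: "v \<in> \<O> - P" "w = t powi l * v" using factorization[OF t assms(2)] by blast
  have "place_val P (z * w) = k + l"
    by (rule place_val_eqI[OF t unit_mult[OF u(1) v(1)]])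
       (simp add: u(2) v(2) power_int_add \<open>t \<noteq> 0\<close>)
  then show ?thesis using place_val_eqI[OF t u] place_val_eqI[OF t v] by simp
qed

lemma place_val_power_int: "z \<noteq> 0 \<Longrightarrow> place_val P (z powi k) = k * place_val P z"
proof -
  assume z: "z \<noteq> 0"
  obtain t u where t: "prime_element P t" "t \<noteq> 0" and u: "u \<in> \<O> - P"
    and zu: "z = t powi place_val P z * u" by (rule place_val_cases[OF z])
  show ?thesis
  proof (rule place_val_eqI[OF t(1) unit_power_int[OF u, of k]])
    show "z powi k = t powi (k * place_val P z) * u powi k"
      by (subst zu) (simp add: power_int_mult_distrib power_int_mult[symmetric] mult.commute)
  qed
qed

lemma place_val_power: "z \<noteq> 0 \<Longrightarrow> place_val P (z ^ k) = int k * place_val P z"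
  using place_val_power_int[of z "int k"] by simp

lemma place_val_divide:
  "z \<noteq> 0 \<Longrightarrow> w \<noteq> 0 \<Longrightarrow> place_val P (z / w) = place_val P z - place_val P w"
  using place_val_mult[of z "inverse w"] place_val_power_int[of w "- 1"]
  by (simp add: divide_inverse)

lemma place_val_prod:
  assumes "\<And>i. i \<in> I \<Longrightarrow> u i \<noteq> 0"
  shows "place_val P (prod u I) = (\<Sum>i\<in>I. place_val P (u i))"
  using assms
proof (induction I rule: infinite_finite_induct)
  case (insert i I)
  then show ?case by (simp add: place_val_mult)
qed (auto intro!: place_val_unit simp: \<O>_closed(1))

lemma place_val_add:
  assumes "z \<noteq> 0" "w \<noteq> 0" "z + w \<noteq> 0" "place_val P z \<ge> k" "place_val P w \<ge> k"
  shows "place_val P (z + w) \<ge> k"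
proof -
  obtain t where t: "prime_element P t" using prime_element_exists by blast
  then have t0: "t \<noteq> 0" by (simp add: prime_element_iff)
  have ge: "place_val P v \<ge> k \<longleftrightarrow> v * t powi (- k) \<in> \<O>" if "v \<noteq> 0" for v
    using place_val_nonneg_iff[of "v * t powi (- k)"] that t0
    by (simp add: place_val_mult place_val_power_int place_val_prime[OF t])
  show ?thesis using assms ge \<O>_closed(6)[of "z * t powi (- k)" "w * t powi (- k)"]
    by (simp add: distrib_right)
qed

end

section \<open>Rational nonsingular points\<close>

text \<open>The degree is read off from an arbitrarily chosen basis of the residue field, so besides
  exhibiting the basis \<open>{1}\<close> it must be shown that no other basis has a different size.\<close>

lemma (in place) place_degree_eq_1I:
  assumes res: "\<And>z. z \<in> \<O> \<Longrightarrow> \<exists>c. z - \<iota> c \<in> P"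
  shows "place_degree \<iota> L P = 1"
proof -
  define \<rho> where "\<rho> = (\<lambda>z. SOME c. z - \<iota> c \<in> P)"
  have \<rho>: "z - \<iota> (\<rho> z) \<in> P" if "z \<in> \<O>" for z
    unfolding \<rho>_def using someI_ex[OF res[OF that]] .
  have "quotient_basis (range \<iota>) \<O> P {1}"
    unfolding quotient_basis_def
  proof (intro conjI ballI)
    fix z assume z: "z \<in> \<O>"
    show "\<exists>!c. c \<in> {1} \<rightarrow>\<^sub>E range \<iota> \<and> z - (\<Sum>b\<in>{1}. c b * b) \<in> P"
    proof (rule ex1I)
      show "(\<lambda>b\<in>{1}. \<iota> (\<rho> z)) \<in> {1} \<rightarrow>\<^sub>E range \<iota> \<and> z - (\<Sum>b\<in>{1}. (\<lambda>b\<in>{1}. \<iota> (\<rho> z)) b * b) \<in> P"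
        using \<rho>[OF z] by auto
      fix c assume c: "c \<in> {1} \<rightarrow>\<^sub>E range \<iota> \<and> z - (\<Sum>b\<in>{1}. c b * b) \<in> P"
      then obtain e where e: "c 1 = \<iota> e" by (auto simp: PiE_iff)
      then have "e = \<rho> z" using c residue_unique[OF _ \<rho>[OF z], of e] by simp
      then show "c = (\<lambda>b\<in>{1}. \<iota> (\<rho> z))"
        using c e by (auto simp: fun_eq_iff PiE_iff extensional_def)
    qed
  qed (use \<O>_closed(1) in simp_all)
  then have ex: "\<exists>B. quotient_basis (range \<iota>) \<O> P B" ..
  have "card B = 1" if "quotient_basis (range \<iota>) \<O> P B" for B
  proof -
    have B: "finite B" "B \<subseteq> \<O>"
      and uniq: "\<And>z. z \<in> \<O> \<Longrightarrow> \<exists>!c. c \<in> B \<rightarrow>\<^sub>E range \<iota> \<and> z - (\<Sum>b\<in>B. c b * b) \<in> P"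
      using that by (auto simp: quotient_basis_def)
    have indep: "c b = 0" if c: "\<And>b. b \<in> B \<Longrightarrow> c b \<in> range \<iota>" "(\<Sum>b\<in>B. c b * b) \<in> P" "b \<in> B"
      for c b
    proof -
      have 0: "0 \<in> range \<iota>" using \<iota>_0 by (metis rangeI)
      have "(\<Sum>b\<in>B. restrict c B b * b) = (\<Sum>b\<in>B. c b * b)" by (rule sum.cong) auto
      then have "restrict c B \<in> B \<rightarrow>\<^sub>E range \<iota>" "0 - (\<Sum>b\<in>B. restrict c B b * b) \<in> P"
        using c(1) P_minus[OF c(2)] by auto
      moreover have "(\<lambda>b\<in>B. 0) \<in> B \<rightarrow>\<^sub>E range \<iota>" "0 - (\<Sum>b\<in>B. (\<lambda>b\<in>B. 0) b * b) \<in> P"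
        using 0 by auto
      ultimately have "restrict c B = (\<lambda>b\<in>B. 0)" using uniq[OF \<O>_closed(2)] by blast
      then show ?thesis using c(3) by (metis restrict_apply')
    qed
    have "B \<noteq> {}" using uniq[OF \<O>_closed(1)] by auto
    then obtain v where v: "v \<in> B" by blast
    have "w = v" if w: "w \<in> B" for w
    proof (rule ccontr)
      assume "w \<noteq> v"
      define c where "c = (\<lambda>b. if b = v then \<iota> (\<rho> w) else if b = w then - \<iota> (\<rho> v) else 0)"
      have "(\<Sum>b\<in>B. c b * b) = (\<Sum>b\<in>{v, w}. c b * b)"
        by (rule sum.mono_neutral_right) (use B v w in \<open>auto simp: c_def\<close>)
      also have "\<dots> = \<iota> (\<rho> w) * (v - \<iota> (\<rho> v)) - \<iota> (\<rho> v) * (w - \<iota> (\<rho> w))"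
        using \<open>w \<noteq> v\<close> by (simp add: c_def algebra_simps)
      also have "\<dots> \<in> P" using \<rho> v w B by (intro P_diff[OF P_mult P_mult]) auto
      finally have "(\<Sum>b\<in>B. c b * b) \<in> P" .
      moreover have "c b \<in> range \<iota>" for b
        unfolding c_def \<iota>_minus[symmetric] using \<iota>_0 by (metis rangeI)
      ultimately have "c v = 0" using indep[of c v] v by blast
      then have "w \<in> P" using \<rho>[of w] w B by (auto simp: c_def)
      then have sum_P: "(\<Sum>b\<in>B. (if b = w then 1 else 0) * b) \<in> P"
        using B w by (simp add: if_distrib[of "\<lambda>c. c * _"] cong: if_cong)
      have "(if b = w then 1 else 0) \<in> range \<iota>" for b
        using \<iota>_0 \<iota>_1 by (metis rangeI)
      then have "(if w = w then 1 else 0 :: 'f) = 0"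
        by (rule indep[OF _ sum_P w])
      then show False by simp
    qed
    then have "B = {v}" using v by blast
    then show ?thesis by simp
  qed
  then show ?thesis
    unfolding place_degree_def quotient_dim_def if_P[OF ex] using someI_ex[OF ex] by blast
qed

lemma (in place) residue_exists:
  assumes "place_degree \<iota> L P = 1" "z \<in> \<O>"
  obtains c where "z - \<iota> c \<in> P"
proof -
  have ex: "\<exists>B. quotient_basis (range \<iota>) \<O> P B"
    using assms(1) by (auto simp: place_degree_def quotient_dim_def split: if_splits)
  define B where "B = (SOME B. quotient_basis (range \<iota>) \<O> P B)"
  have "quotient_basis (range \<iota>) \<O> P B" unfolding B_def by (rule someI_ex[OF ex])
  moreover have "card B = 1"
    using assms(1) unfolding place_degree_def quotient_dim_def if_P[OF ex] B_def .
  then obtain v where "B = {v}" by (rule card_1_singletonE)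
  ultimately have unique: "\<exists>!c. c \<in> {v} \<rightarrow>\<^sub>E range \<iota> \<and> z - (\<Sum>b\<in>{v}. c b * b) \<in> P"
    if "z \<in> \<O>" for z
    using that unfolding quotient_basis_def by blast
  have rep: "\<exists>c. z - \<iota> c * v \<in> P" if z: "z \<in> \<O>" for z
  proof -
    obtain c where c: "c \<in> {v} \<rightarrow>\<^sub>E range \<iota>" "z - (\<Sum>b\<in>{v}. c b * b) \<in> P"
      using unique[OF z] by (elim ex1E) blast
    then obtain a where "c v = \<iota> a" by (auto simp: PiE_iff)
    then show ?thesis using c(2) by auto
  qed
  obtain e where e: "1 - \<iota> e * v \<in> P" using rep[OF \<O>_closed(1)] by blast
  have "e \<noteq> 0" using e by auto
  obtain c where c: "z - \<iota> c * v \<in> P" using rep[OF assms(2)] by blast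
  have "z - \<iota> (c / e) = (z - \<iota> c * v) - \<iota> (c / e) * (1 - \<iota> e * v)"
    using \<open>e \<noteq> 0\<close> by (simp add: algebra_simps \<iota>_divide)
  also have "\<dots> \<in> P" by (rule P_diff[OF c P_mult[OF \<iota>_in_\<O> e]])
  finally show thesis using that by blast
qed

definition (in constant_field) coordinate_ring :: "'f \<Rightarrow> 'f \<Rightarrow> 'f set" where
  "coordinate_ring X Y = \<Inter>{S. is_subring S \<and> range \<iota> \<subseteq> S \<and> {X, Y} \<subseteq> S}"

context constant_field
begin

lemma coordinate_ring:
  "is_subring (coordinate_ring X Y)" "\<iota> c \<in> coordinate_ring X Y"
  "X \<in> coordinate_ring X Y" "Y \<in> coordinate_ring X Y"
proof -
  show "is_subring (coordinate_ring X Y)"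
    unfolding coordinate_ring_def is_subring_def by blast
qed (auto simp: coordinate_ring_def)

lemma coordinate_ring_least:
  "is_subring S \<Longrightarrow> range \<iota> \<subseteq> S \<Longrightarrow> X \<in> S \<Longrightarrow> Y \<in> S \<Longrightarrow> coordinate_ring X Y \<subseteq> S"
  unfolding coordinate_ring_def by blast

text \<open>The first-order Taylor expansion at the point \<open>(b, c)\<close>.\<close>

lemma coordinate_ring_expansion:
  assumes "u \<in> coordinate_ring X Y"
  shows "\<exists>\<kappa> u1 u2. u1 \<in> coordinate_ring X Y \<and> u2 \<in> coordinate_ring X Y
           \<and> u = \<iota> \<kappa> + (X - \<iota> b) * u1 + (Y - \<iota> c) * u2"
proof -
  let ?A = "coordinate_ring X Y"
  note A = subring_closed[OF coordinate_ring(1)[of X Y]] coordinate_ring(2-4)[where X = X and Y = Y]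
  define S where "S = {\<iota> \<kappa> + (X - \<iota> b) * u1 + (Y - \<iota> c) * u2 | \<kappa> u1 u2. u1 \<in> ?A \<and> u2 \<in> ?A}"
  have SI: "\<iota> \<kappa> + (X - \<iota> b) * u1 + (Y - \<iota> c) * u2 \<in> S" if "u1 \<in> ?A" "u2 \<in> ?A" for \<kappa> u1 u2
    using that by (auto simp: S_def)
  have const: "\<iota> \<kappa> \<in> S" for \<kappa> using SI[OF A(2) A(2), of \<kappa>] by simp
  have "is_subring S"
    unfolding is_subring_def
  proof (intro conjI ballI)
    show "1 \<in> S" using const[of 1] by simp
    fix u v assume "u \<in> S" "v \<in> S"
    then obtain \<kappa> u1 u2 \<mu> v1 v2 where uv: "u = \<iota> \<kappa> + (X - \<iota> b) * u1 + (Y - \<iota> c) * u2"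
      "v = \<iota> \<mu> + (X - \<iota> b) * v1 + (Y - \<iota> c) * v2"
      and mem: "u1 \<in> ?A" "u2 \<in> ?A" "v1 \<in> ?A" "v2 \<in> ?A"
      unfolding S_def by blast
    show "u - v \<in> S"
      using SI[OF A(3)[OF mem(1,3)] A(3)[OF mem(2,4)], of "\<kappa> - \<mu>"]
      by (simp add: uv \<iota>_diff algebra_simps)
    have v: "v \<in> ?A"
      unfolding uv by (intro A(6) A(4) A(3) A(8-10) mem)
    show "u * v \<in> S"
      using SI[OF A(6)[OF A(4)[OF A(8)[of \<kappa>] mem(3)] A(4)[OF mem(1) v]]
                  A(6)[OF A(4)[OF A(8)[of \<kappa>] mem(4)] A(4)[OF mem(2) v]], of "\<kappa> * \<mu>"]
      by (simp add: uv(1) \<iota>_mult algebra_simps) (simp add: uv(2) algebra_simps)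
  qed
  moreover have "X \<in> S" using SI[OF A(1) A(2), of b] by simp
  moreover have "Y \<in> S" using SI[OF A(2) A(1), of c] by simp
  ultimately have "?A \<subseteq> S" using const by (intro coordinate_ring_least) auto
  then show ?thesis using assms unfolding S_def by blast
qed

lemma coordinate_ring_fractions:
  assumes "adjoin \<iota> {X, Y} = UNIV"
  shows "\<exists>u\<in>coordinate_ring X Y. \<exists>w\<in>coordinate_ring X Y. z = u / w"
proof -
  let ?A = "coordinate_ring X Y"
  note A = subring_closed[OF coordinate_ring(1)[of X Y]] coordinate_ring(2-4)[where X = X and Y = Y]
  define S where "S = {u / w | u w. u \<in> ?A \<and> w \<in> ?A}"
  have SI: "u / w \<in> S" if "u \<in> ?A" "w \<in> ?A" for u w using that by (auto simp: S_def)
  have sub: "u \<in> S" if "u \<in> ?A" for u using SI[OF that A(1)] by simp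
  have "is_subfield S"
    unfolding is_subfield_def is_subring_def
  proof (intro conjI ballI)
    show "1 \<in> S" by (rule sub[OF A(1)])
    show "inverse u \<in> S" if u: "u \<in> S" for u
    proof -
      obtain p q where "u = p / q" "p \<in> ?A" "q \<in> ?A" using u unfolding S_def by blast
      then show ?thesis using SI[of q p] by simp
    qed
    fix u v assume "u \<in> S" "v \<in> S"
    then obtain p q p' q' where uv: "u = p / q" "v = p' / q'"
      and mem: "p \<in> ?A" "q \<in> ?A" "p' \<in> ?A" "q' \<in> ?A" unfolding S_def by blast
    show "u * v \<in> S" using SI[OF A(4)[OF mem(1,3)] A(4)[OF mem(2,4)]] by (simp add: uv)
    consider "q = 0" | "q' = 0" | "q \<noteq> 0" "q' \<noteq> 0" by blast
    then show "u - v \<in> S"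
    proof cases
      case 1
      then show ?thesis using SI[OF A(5)[OF mem(3)] mem(4)] by (simp add: uv)
    next
      case 2
      then show ?thesis using SI[OF mem(1,2)] by (simp add: uv)
    next
      case 3
      then show ?thesis
        using SI[OF A(3)[OF A(4)[OF mem(1,4)] A(4)[OF mem(3,2)]] A(4)[OF mem(2,4)]]
        by (simp add: uv diff_frac_eq)
    qed
  qed
  then have "adjoin \<iota> {X, Y} \<subseteq> S" using sub A(8-10) by (intro adjoin_least) auto
  then show ?thesis using assms unfolding S_def by blast
qed

end

text \<open>The constant term of that expansion is the value at every place over \<open>(b, c)\<close>; thus membership in
  such a place, restricted to the coordinate ring, depends on the point only.\<close>

lemma (in place) residue_of_coordinate_ring:
  assumes "X - \<iota> b \<in> P" "Y - \<iota> c \<in> P" "u1 \<in> \<O>" "u2 \<in> \<O>"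
  shows "\<iota> \<kappa> + (X - \<iota> b) * u1 + (Y - \<iota> c) * u2 - \<iota> \<kappa> \<in> P"
  using P_add[OF P_mult2[OF assms(1,3)] P_mult2[OF assms(2,4)]] by simp

text \<open>The hypotheses say that the ideal of the point \<open>(b, c)\<close> in the local ring of \<open>K[X, Y]\<close> is
  generated by \<open>T\<close>. Dividing by \<open>T\<close> as long as possible writes every function as a power of \<open>T\<close>
  times a unit of this local ring, which determines the place.\<close>

lemma (in function_field) nonsingular_point:
  fixes X Y T W G1 G2 :: 'f and b' c' :: 'k
  defines "A \<equiv> coordinate_ring X Y"
  assumes adj: "adjoin \<iota> {X, Y} = UNIV"
    and P: "P \<in> places \<iota> UNIV" "X - \<iota> b' \<in> P" "Y - \<iota> c' \<in> P"
    and T: "T \<in> A" "T \<in> P" "T \<noteq> 0" and W: "W \<in> A" "W \<notin> P"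
    and G: "G1 \<in> A" "G2 \<in> A" "W * (X - \<iota> b') = T * G1" "W * (Y - \<iota> c') = T * G2"
  shows "place_val P T = 1" and "place_degree \<iota> UNIV P = 1"
    and "P' \<in> places \<iota> UNIV \<Longrightarrow> X - \<iota> b' \<in> P' \<Longrightarrow> Y - \<iota> c' \<in> P' \<Longrightarrow> P' = P"
proof -
  interpret P: function_field_place \<iota> x d b P
    by unfold_locales (simp_all add: subfield_UNIV P)
  note A = subring_closed[OF coordinate_ring(1)[of X Y], folded A_def]
    and A_mem = coordinate_ring(2-4)[where X = X and Y = Y, folded A_def]
  have A_\<O>: "u \<in> P.\<O>" if "u \<in> A" for u
  proof -
    have "A \<subseteq> P.\<O>"
      unfolding A_def
      by (intro coordinate_ring_least P.subring_\<O> P.\<iota>_diff_in_\<O>[OF P(2)] P.\<iota>_diff_in_\<O>[OF P(3)])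
         auto
    then show ?thesis using that by blast
  qed
  (* The expansion of u at the point has no constant term, and W maps its linear terms into T A. *)
  have div_T: "\<exists>v\<in>A. W * u = T * v" if u: "u \<in> A" "u \<in> P" for u
  proof -
    obtain \<kappa> u1 u2 where mem: "u1 \<in> A" "u2 \<in> A"
      and eq: "u = \<iota> \<kappa> + (X - \<iota> b') * u1 + (Y - \<iota> c') * u2"
      using coordinate_ring_expansion[of u X Y b' c'] u(1) unfolding A_def by blast
    have "u - \<iota> \<kappa> \<in> P"
      unfolding eq by (rule P.residue_of_coordinate_ring[OF P(2,3) A_\<O>[OF mem(1)] A_\<O>[OF mem(2)]])
    then have "\<kappa> = 0" using P.residue_unique[of u \<kappa> 0] u(2) by simp
    then have "W * u = (W * (X - \<iota> b')) * u1 + (W * (Y - \<iota> c')) * u2"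
      by (simp add: eq algebra_simps)
    also have "\<dots> = T * (G1 * u1 + G2 * u2)" unfolding G by (simp add: algebra_simps)
    finally show ?thesis using A(6)[OF A(4)[OF G(1) mem(1)] A(4)[OF G(2) mem(2)]] by blast
  qed
  have W0: "W \<noteq> 0" using W(2) by auto
  have factor_A: "\<exists>k w v. w \<in> A \<and> w \<notin> P \<and> v \<in> A \<and> v \<notin> P \<and> w * u = T ^ k * v"
    if "u \<in> A" "u \<noteq> 0" for u
    using that
  proof (induction "nat (place_val P u)" arbitrary: u rule: less_induct)
    case less
    show ?case
    proof (cases "u \<in> P")
      case False
      then show ?thesis using less.prems A(1) by (intro exI[of _ 0] exI[of _ 1] exI[of _ u]) simp
    next
      case True
      then obtain v where v: "v \<in> A" "W * u = T * v" using div_T less.prems(1) by blast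
      have v0: "v \<noteq> 0" using v less.prems(2) W0 by auto
      have "place_val P W + place_val P u = place_val P T + place_val P v"
        using v(2) P.place_val_mult[OF W0 less.prems(2)] P.place_val_mult[OF T(3) v0] by simp
      moreover have "place_val P W = 0" using W A_\<O> by (intro P.place_val_unit) auto
      moreover have "place_val P T > 0" using T P.place_val_pos_iff by simp
      moreover have "place_val P u > 0" using True less.prems(2) P.place_val_pos_iff by simp
      ultimately have "nat (place_val P v) < nat (place_val P u)" by simp
      then obtain k w v' where IH: "w \<in> A" "w \<notin> P" "v' \<in> A" "v' \<notin> P" "w * v = T ^ k * v'"
        using less.hyps v(1) v0 by blast
      have "w * W * u = T * (w * v)" using v(2) by (metis mult.assoc mult.left_commute)
      then have "w * W * u = T ^ Suc k * v'" using IH(5) by (simp add: mult.assoc)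
      moreover have "w * W \<in> A" "w * W \<notin> P"
        using A(4)[OF IH(1) W(1)] P.P_prime[of w W] A_\<O> IH W by auto
      ultimately show ?thesis using IH by blast
    qed
  qed
  have factor: "\<exists>k w v. w \<in> A \<and> w \<notin> P \<and> v \<in> A \<and> v \<notin> P \<and> z = T powi k * (v / w)"
    if z: "z \<noteq> 0" for z
  proof -
    obtain u u' where u: "u \<in> A" "u' \<in> A" "z = u / u'"
      using coordinate_ring_fractions[OF adj] unfolding A_def by blast
    then have u0: "u \<noteq> 0" "u' \<noteq> 0" using z by auto
    obtain k w v where wv: "w \<in> A" "w \<notin> P" "v \<in> A" "v \<notin> P" "w * u = T ^ k * v"
      using factor_A[OF u(1) u0(1)] by blast
    obtain k' w' v' where wv': "w' \<in> A" "w' \<notin> P" "v' \<in> A" "v' \<notin> P" "w' * u' = T ^ k' * v'"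
      using factor_A[OF u(2) u0(2)] by blast
    have nz: "w \<noteq> 0" "w' \<noteq> 0" "v' \<noteq> 0" using wv wv' by auto
    have "z = (w * u) * w' / (w * (w' * u'))" using nz u(3) by simp
    also have "\<dots> = T powi (int k - int k') * ((v * w') / (w * v'))"
      unfolding wv(5) wv'(5) using T(3) by (simp add: power_int_diff field_simps)
    finally have "z = T powi (int k - int k') * ((v * w') / (w * v'))" .
    moreover have "v * w' \<in> A" "w * v' \<in> A" using A(4) wv wv' by auto
    moreover have "v * w' \<notin> P" "w * v' \<notin> P" using P.P_prime A_\<O> wv wv' by blast+
    ultimately show ?thesis by blast
  qed
  have val: "place_val P (T powi k * (v / w)) = k * place_val P T"
    if "w \<in> A" "w \<notin> P" "v \<in> A" "v \<notin> P" for k v w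
  proof -
    have u: "v / w \<in> P.\<O> - P" using that A_\<O> by (intro P.unit_divide) auto
    then have "v / w \<noteq> 0" using P.zero_in_P by force
    then show ?thesis
      using T(3) P.place_val_unit[OF u] P.place_val_mult[of "T powi k" "v / w"]
        P.place_val_power_int[OF T(3), of k] by simp
  qed
  have T_pos: "place_val P T > 0" using T P.place_val_pos_iff by simp
  show T_1: "place_val P T = 1"
  proof -
    obtain t where t: "prime_element P t" using P.prime_element_exists by blast
    then have "t \<noteq> 0" by (simp add: P.prime_element_iff)
    then obtain k w v where "w \<in> A" "w \<notin> P" "v \<in> A" "v \<notin> P" "t = T powi k * (v / w)"
      using factor by blast
    then have "k * place_val P T = 1" using val P.place_val_prime[OF t] by metis
    then show ?thesis using T_pos by (simp add: zmult_eq_1_iff)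
  qed
  have residue: "\<exists>\<kappa>. u - \<iota> \<kappa> \<in> P" if "u \<in> A" for u
  proof -
    obtain \<kappa> u1 u2 where mem: "u1 \<in> A" "u2 \<in> A"
      and eq: "u = \<iota> \<kappa> + (X - \<iota> b') * u1 + (Y - \<iota> c') * u2"
      using coordinate_ring_expansion[of u X Y b' c'] \<open>u \<in> A\<close> unfolding A_def by blast
    show ?thesis
      unfolding eq using P.residue_of_coordinate_ring[OF P(2,3) A_\<O>[OF mem(1)] A_\<O>[OF mem(2)]]
      by blast
  qed
  show "place_degree \<iota> UNIV P = 1"
  proof (rule P.place_degree_eq_1I)
    fix z assume z: "z \<in> P.\<O>"
    show "\<exists>c. z - \<iota> c \<in> P"
    proof (cases "z \<in> P")
      case True
      then show ?thesis by (intro exI[of _ 0]) simp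
    next
      case False
      then have "z \<noteq> 0" by auto
      then obtain k w v where wv: "w \<in> A" "w \<notin> P" "v \<in> A" "v \<notin> P" "z = T powi k * (v / w)"
        using factor by blast
      have "k = 0" using P.place_val_unit[of z] z False val[OF wv(1-4), of k] wv(5) T_1 by simp
      obtain \<kappa> \<mu> where \<kappa>: "v - \<iota> \<kappa> \<in> P" "w - \<iota> \<mu> \<in> P" using residue wv by blast
      have "\<mu> \<noteq> 0" using \<kappa>(2) wv(2) by auto
      have w0: "w \<noteq> 0" using wv(2) by auto
      have "z - \<iota> (\<kappa> / \<mu>) = inverse w * ((v - \<iota> \<kappa>) - \<iota> (\<kappa> / \<mu>) * (w - \<iota> \<mu>))"
        using \<open>\<mu> \<noteq> 0\<close> w0 \<open>k = 0\<close> by (simp add: wv(5) \<iota>_divide field_simps)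
      moreover have "inverse w \<in> P.\<O>" using P.unit_inverse A_\<O> wv by blast
      moreover have "(v - \<iota> \<kappa>) - \<iota> (\<kappa> / \<mu>) * (w - \<iota> \<mu>) \<in> P"
        by (rule P.P_diff[OF \<kappa>(1) P.P_mult[OF P.\<iota>_in_\<O> \<kappa>(2)]])
      ultimately show ?thesis using P.P_mult by metis
    qed
  qed
  assume P': "P' \<in> places \<iota> UNIV" "X - \<iota> b' \<in> P'" "Y - \<iota> c' \<in> P'"
  interpret P': function_field_place \<iota> x d b P'
    by unfold_locales (simp_all add: subfield_UNIV P')
  have A_\<O>': "u \<in> P'.\<O>" if "u \<in> A" for u
  proof -
    have "A \<subseteq> P'.\<O>"
      unfolding A_def
      by (intro coordinate_ring_least P'.subring_\<O> P'.\<iota>_diff_in_\<O>[OF P'(2)]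
            P'.\<iota>_diff_in_\<O>[OF P'(3)]) auto
    then show ?thesis using that by blast
  qed
  have same: "u \<in> P \<longleftrightarrow> u \<in> P'" if "u \<in> A" for u
  proof -
    obtain \<kappa> u1 u2 where mem: "u1 \<in> A" "u2 \<in> A"
      and eq: "u = \<iota> \<kappa> + (X - \<iota> b') * u1 + (Y - \<iota> c') * u2"
      using coordinate_ring_expansion[of u X Y b' c'] \<open>u \<in> A\<close> unfolding A_def by blast
    have "u - \<iota> \<kappa> \<in> P"
      unfolding eq by (rule P.residue_of_coordinate_ring[OF P(2,3) A_\<O>[OF mem(1)] A_\<O>[OF mem(2)]])
    moreover have "u - \<iota> \<kappa> \<in> P'"
      unfolding eq
      by (rule P'.residue_of_coordinate_ring[OF P'(2,3) A_\<O>'[OF mem(1)] A_\<O>'[OF mem(2)]])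
    ultimately have "u \<in> P \<longleftrightarrow> \<kappa> = 0" "u \<in> P' \<longleftrightarrow> \<kappa> = 0"
      using P.residue_unique[of u \<kappa> 0] P'.residue_unique[of u \<kappa> 0] by auto
    then show ?thesis by simp
  qed
  have "z \<in> P' \<longleftrightarrow> z \<in> P" for z
  proof (cases "z = 0")
    case False
    then obtain k w v where wv: "w \<in> A" "w \<notin> P" "v \<in> A" "v \<notin> P" "z = T powi k * (v / w)"
      using factor by blast
    have u': "v / w \<in> P'.\<O> - P'" using wv A_\<O>' same by (intro P'.unit_divide) auto
    then have "v / w \<noteq> 0" using P'.zero_in_P by force
    then have "place_val P' z = k * place_val P' T"
      unfolding wv(5) using T(3) P'.place_val_unit[OF u'] P'.place_val_mult[of "T powi k" "v / w"]
        P'.place_val_power_int[OF T(3), of k] by simp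
    moreover have "place_val P' T > 0" using T same P'.place_val_pos_iff by simp
    moreover have "place_val P z = k" using val[OF wv(1-4)] wv(5) T_1 by simp
    ultimately show ?thesis
      using P.place_val_pos_iff[OF False] P'.place_val_pos_iff[OF False]
      by (simp add: zero_less_mult_iff)
  qed simp
  then show "P' = P" by blast
qed

lemma (in place) unit_prod: "(\<And>i. i \<in> I \<Longrightarrow> u i \<in> \<O> - P) \<Longrightarrow> prod u I \<in> \<O> - P"
proof (induction I rule: infinite_finite_induct)
  case (insert i I)
  then show ?case using unit_mult[of "u i" "prod u I"] by simp
qed (simp_all add: \<O>_closed(1))

context function_field_place
begin

lemma power_in_\<O>_imp: "z ^ k \<in> \<O> \<Longrightarrow> k > 0 \<Longrightarrow> z \<in> \<O>"
  and power_in_P_imp: "z ^ k \<in> P \<Longrightarrow> z \<in> P"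
proof -
  show *: "z \<in> \<O>" if z: "z ^ k \<in> \<O>" "k > 0"
  proof (rule ccontr)
    assume not: "z \<notin> \<O>"
    then have "inverse z \<in> P" using in_\<O>_or_inverse by blast
    then have "inverse z * inverse z ^ (k - 1) \<in> P"
      by (intro P_mult2 \<O>_closed(7) P_subset_\<O>)
    then have "inverse z ^ k \<in> P" using z(2) by (cases k) auto
    then have "z ^ k * inverse z ^ k \<in> P" by (rule P_mult[OF z(1)])
    moreover have "z \<noteq> 0" using not \<O>_closed(2) by auto
    ultimately show False by (simp add: power_mult_distrib[symmetric])
  qed
  show "z \<in> P" if z: "z ^ k \<in> P"
  proof (cases k)
    case (Suc l)
    then have "z \<in> \<O>" using *[OF P_subset_\<O>[OF z]] by simp
    then show ?thesis using P_prime_power z by blast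
  qed (use z in auto)
qed

end

section \<open>The Kummer curve and its ramified places\<close>

text \<open>Because \<open>y\<^sup>m \<in> K(x)\<close>, the \<open>K(x)\<close>-span of the powers of \<open>y\<close> below \<open>m\<close> is a ring, hence a
  field, hence everything.\<close>

lemma (in constant_field) powers_span:
  assumes "y ^ m \<in> adjoin \<iota> {x}" "m > 0" "adjoin \<iota> {x, y} = UNIV"
  shows "\<exists>c. (\<forall>j<m. c j \<in> adjoin \<iota> {x}) \<and> z = (\<Sum>j<m. c j * y ^ j)"
proof -
  let ?C = "adjoin \<iota> {x}"
  note C = adjoin_closed[where \<iota> = \<iota> and X = "{x}"]
  define V where "V = {\<Sum>j\<in>{..<m}. c j * y ^ j | c. \<forall>j\<in>{..<m}. c j \<in> ?C}"
  have VI: "(\<Sum>j<m. c j * y ^ j) \<in> V" if "\<And>j. j < m \<Longrightarrow> c j \<in> ?C" for c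
    using that by (auto simp: V_def)
  have zero: "0 \<in> V" using VI[of "\<lambda>_. 0"] C(2) by simp
  have diff: "u - v \<in> V" if "u \<in> V" "v \<in> V" for u v
  proof -
    obtain c e where ce: "u = (\<Sum>j<m. c j * y ^ j)" "v = (\<Sum>j<m. e j * y ^ j)"
      "\<And>j. j < m \<Longrightarrow> c j \<in> ?C" "\<And>j. j < m \<Longrightarrow> e j \<in> ?C"
      using \<open>u \<in> V\<close> \<open>v \<in> V\<close> unfolding V_def by auto
    have "u - v = (\<Sum>j<m. (c j - e j) * y ^ j)"
      by (simp add: ce sum_subtractf left_diff_distrib)
    then show ?thesis using VI[of "\<lambda>j. c j - e j"] C(3) ce by simp
  qed
  have add: "u + v \<in> V" if "u \<in> V" "v \<in> V" for u v
    using diff[OF that(1) diff[OF zero that(2)]] by simp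
  have sum: "sum u I \<in> V" if "\<And>i. i \<in> I \<Longrightarrow> u i \<in> V" for u and I :: "nat set"
    using that by (induction I rule: infinite_finite_induct) (auto simp: zero add)
  have monomial: "c * y ^ k \<in> V" if c: "c \<in> ?C" for c k
  proof -
    define e where "e = (\<lambda>j. if j = k mod m then c * (y ^ m) ^ (k div m) else 0)"
    have "e j \<in> ?C" for j using C(2) C(4)[OF c C(7)[OF assms(1)]] by (simp add: e_def)
    moreover have "(\<Sum>j<m. e j * y ^ j) = c * y ^ k"
    proof -
      have "(\<Sum>j<m. e j * y ^ j) = (\<Sum>j\<in>{k mod m}. e j * y ^ j)"
        using assms(2) by (intro sum.mono_neutral_right) (auto simp: e_def)
      also have "\<dots> = c * (y ^ (m * (k div m)) * y ^ (k mod m))"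
        by (simp add: e_def power_mult)
      also have "y ^ (m * (k div m)) * y ^ (k mod m) = y ^ k"
        by (simp only: power_add[symmetric] mult_div_mod_eq)
      finally show ?thesis .
    qed
    ultimately show ?thesis using VI[of e] by simp
  qed
  have CV: "?C \<subseteq> V" using monomial[of _ 0] by auto
  have ring: "is_subring V"
    unfolding is_subring_def
  proof (intro conjI ballI diff)
    show "1 \<in> V" using CV C(1) by blast
    fix u v assume "u \<in> V" "v \<in> V"
    then obtain c e where ce: "u = (\<Sum>j<m. c j * y ^ j)" "v = (\<Sum>j<m. e j * y ^ j)"
      "\<And>j. j < m \<Longrightarrow> c j \<in> ?C" "\<And>j. j < m \<Longrightarrow> e j \<in> ?C"
      unfolding V_def by auto
    have "u * v = (\<Sum>i<m. \<Sum>j<m. (c i * e j) * y ^ (i + j))"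
      unfolding ce(1,2) sum_product by (intro sum.cong) (auto simp: power_add)
    also have "\<dots> \<in> V" using ce C(4) by (intro sum monomial) auto
    finally show "u * v \<in> V" .
  qed
  have "is_subfield V"
    by (rule subfield_of_finite_span[OF subfield_adjoin _ V_def ring CV]) simp
  moreover have "{x, y} \<subseteq> V" "range \<iota> \<subseteq> V"
    using CV adjoin_superset[where X = "{x}" and \<iota> = \<iota>] monomial[OF C(1), of 1] by auto
  ultimately have "adjoin \<iota> {x, y} \<subseteq> V" by (intro adjoin_least)
  then have "z \<in> V" using assms(3) by blast
  then show ?thesis unfolding V_def by auto
qed

text \<open>\<open>Q\<close> is a choice of places over infinity and over the \<open>a\<^sub>k\<close>; the lemmas below show that there is
  only one choice.\<close>

locale kummer_curve = constant_field \<iota> for \<iota> :: "'k::field \<Rightarrow> 'f::field" +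
  fixes m n :: nat and a :: "nat \<Rightarrow> 'k" and x y :: 'f and Q :: "nat \<Rightarrow> 'f set"
  assumes m: "m \<ge> 2" and coprime: "coprime m n" and inj_a: "inj_on a {1..n}"
    and kummer: "kummer_function_field \<iota> m n a x y"
    and Q_infinite: "Q 0 \<in> places_over \<iota> (infinite_place \<iota> x)"
    and Q_finite: "\<And>k. k \<in> {1..n} \<Longrightarrow> Q k \<in> places_over \<iota> (finite_place \<iota> x (a k))"
begin

definition f :: "'k poly" where "f = (\<Prod>k=1..n. [:- a k, 1:])"

lemma y_power_m: "y ^ m = ev f x" and transcendental_x: "transcendental_over \<iota> x"
  and adjoin_x_y: "adjoin \<iota> {x, y} = UNIV"
  using kummer by (auto simp: kummer_function_field_def f_def)

lemma ev_f: "ev f x = (\<Prod>k=1..n. x - \<iota> (a k))"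
  by (simp add: f_def ev_prod \<iota>_minus)

lemma ev_in_adjoin: "ev p x \<in> adjoin \<iota> {x}"
  using ev_in_subring[OF subfield_subring[OF subfield_adjoin]]
    adjoin_superset[where X = "{x}" and \<iota> = \<iota>] by auto

sublocale function_field \<iota> x m "\<lambda>j. y ^ j"
  using transcendental_x powers_span[of y m x, OF _ _ adjoin_x_y] ev_in_adjoin y_power_m m
  by unfold_locales auto

lemma x_minus_nonzero: "x - \<iota> b \<noteq> 0"
  using ev_x_eq_0_iff[of "[:- b, 1:]"] by (simp add: \<iota>_minus)

lemma x_nonzero: "x \<noteq> 0"
  using x_minus_nonzero[of 0] by simp

lemma y_nonzero: "y \<noteq> 0"
  using y_power_m x_minus_nonzero m by (auto simp: ev_f power_0_left)

lemma places_function_field_place: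
  "P \<in> places \<iota> UNIV \<Longrightarrow> function_field_place \<iota> x m (\<lambda>j. y ^ j) P"
  by unfold_locales (simp_all add: subfield_UNIV)

lemma Q_place: "k \<le> n \<Longrightarrow> Q k \<in> places \<iota> UNIV"
  using Q_infinite Q_finite[of k] by (cases "k = 0") (auto simp: places_over_def)

lemma inverse_x_in_Q_0: "inverse x \<in> Q 0"
proof -
  have "ev 1 x / ev [:0, 1:] x \<in> infinite_place \<iota> x"
    unfolding infinite_place_def
    by (intro CollectI exI[of _ 1] exI[of _ "[:0, 1:]"] conjI refl) simp
  then show ?thesis using Q_infinite by (auto simp: places_over_def inverse_eq_divide)
qed

lemma x_minus_a_in_Q:
  assumes "k \<in> {1..n}" shows "x - \<iota> (a k) \<in> Q k"
proof -
  have "ev [:- a k, 1:] x / ev 1 x \<in> finite_place \<iota> x (a k)"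
    unfolding finite_place_def
    by (intro CollectI exI[of _ "[:- a k, 1:]"] exI[of _ 1] conjI refl) simp_all
  then show ?thesis using Q_finite[OF assms] by (auto simp: places_over_def \<iota>_minus)
qed

text \<open>Near infinity the curve is \<open>z\<^sup>m = \<tau>\<^sup>j w\<close> with \<open>w = 1/x\<close>, \<open>z = y\<^sup>j / x\<^sup>k\<close> and a unit \<open>\<tau>\<close>, for
  natural numbers with \<open>n j + 1 = m k\<close>: the coordinates \<open>w\<close>, \<open>z\<close> make the point at infinity
  nonsingular, with local parameter \<open>z\<close>.\<close>

lemma place_at_infinity:
  assumes P: "P \<in> places \<iota> UNIV" "inverse x \<in> P"
  shows "place_val P x = - int m" "place_val P y = - int n" "place_degree \<iota> UNIV P = 1"
    and "P' \<in> places \<iota> UNIV \<Longrightarrow> inverse x \<in> P' \<Longrightarrow> P' = P"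
proof -
  interpret P: function_field_place \<iota> x m "\<lambda>j. y ^ j" P
    by (rule places_function_field_place[OF P(1)])
  obtain k j where "m * k = n * j + gcd m n" using bezout_nat[of m n] m by auto
  then have jk: "m * k = n * j + 1" using coprime by simp
  define w where "w = inverse x"
  define \<tau> where "\<tau> = (\<Prod>i=1..n. 1 - \<iota> (a i) * w)"
  define z where "z = y ^ j / x ^ k"
  have wP: "w \<in> P" using P(2) by (simp add: w_def)
  have y_m: "y ^ m = x ^ n * \<tau>"
  proof -
    have "(\<Prod>i=1..n. x - \<iota> (a i)) = (\<Prod>i=1..n. x * (1 - \<iota> (a i) * w))"
      using x_nonzero by (intro prod.cong) (auto simp: w_def field_simps)
    then show ?thesis by (simp add: y_power_m ev_f \<tau>_def prod.distrib)
  qed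
  have \<tau>_unit: "\<tau> \<in> P.\<O> - P"
  proof -
    have "1 - \<iota> (a i) * w \<in> P.\<O> - P" for i
      using P.unit_add[of 1 "- (\<iota> (a i) * w)"] P.\<O>_closed(1)
        P.P_minus[OF P.P_mult[OF P.\<iota>_in_\<O> wP]] by simp
    then show ?thesis unfolding \<tau>_def by (rule P.unit_prod)
  qed
  have \<tau>0: "\<tau> \<noteq> 0" using \<tau>_unit P.zero_in_P by blast
  have z0: "z \<noteq> 0" using x_nonzero y_nonzero by (simp add: z_def)
  have z_m: "z ^ m = \<tau> ^ j * w"
  proof -
    have "z ^ m = (y ^ m) ^ j / x ^ (m * k)"
      by (simp add: z_def power_divide flip: power_mult) (simp add: mult.commute)
    also have "\<dots> = x ^ (n * j) * \<tau> ^ j / (x ^ (n * j) * x)"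
      by (simp only: y_m jk power_mult_distrib power_mult[symmetric] power_add power_one_right)
    also have "\<dots> = \<tau> ^ j * w"
      using x_nonzero by (simp add: w_def field_simps)
    finally show ?thesis .
  qed
  have y_z: "y * z ^ n = \<tau> ^ k"
  proof -
    have "y * z ^ n = y ^ (n * j + 1) / x ^ (n * k)"
      by (simp add: z_def power_divide flip: power_mult) (simp add: mult.commute)
    also have "\<dots> = (y ^ m) ^ k / x ^ (n * k)" by (simp only: power_mult[symmetric] jk)
    also have "\<dots> = x ^ (n * k) * \<tau> ^ k / x ^ (n * k)"
      by (simp only: y_m power_mult_distrib power_mult)
    also have "\<dots> = \<tau> ^ k" using x_nonzero by simp
    finally show ?thesis .
  qed
  let ?A = "coordinate_ring w z"
  note A = subring_closed[OF coordinate_ring(1)[of w z]]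
    coordinate_ring(2-4)[where X = w and Y = z]
  have \<tau>_poly: "\<tau> \<in> S" if "is_subring S" "range \<iota> \<subseteq> S" "w \<in> S" for S
    unfolding \<tau>_def
  proof (rule subring_prod[OF that(1)])
    fix i
    have "\<iota> (a i) \<in> S" using that(2) by blast
    then show "1 - \<iota> (a i) * w \<in> S"
      by (rule subring_closed(3)[OF that(1) subring_closed(1)[OF that(1)]
            subring_closed(4)[OF that(1) _ that(3)]])
  qed
  have \<tau>_A: "\<tau> \<in> ?A" using A(8,9) by (intro \<tau>_poly coordinate_ring(1)) auto
  have adj: "adjoin \<iota> {w, z} = UNIV"
  proof -
    let ?S = "adjoin \<iota> {w, z}"
    have S: "is_subfield ?S" "w \<in> ?S" "z \<in> ?S" "range \<iota> \<subseteq> ?S"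
      using subfield_adjoin adjoin_superset[where X = "{w, z}" and \<iota> = \<iota>] by auto
    have "x \<in> ?S" using subfield_inverse[OF S(1,2)] by (simp add: w_def)
    moreover have "\<tau> ^ k / z ^ n \<in> ?S"
      by (intro subfield_divide[OF S(1)] subring_closed(7)[OF subfield_subring[OF S(1)]] S(3)
            \<tau>_poly[OF subfield_subring[OF S(1)] S(4,2)])
    moreover have "y = \<tau> ^ k / z ^ n" using y_z z0 by (simp add: eq_divide_eq)
    ultimately have "adjoin \<iota> {x, y} \<subseteq> ?S" using S by (intro adjoin_least) auto
    then show ?thesis using adjoin_x_y by blast
  qed
  have zP: "z \<in> P"
  proof (rule P.power_in_P_imp)
    show "z ^ m \<in> P" unfolding z_m using P.unit_power[OF \<tau>_unit] wP by (intro P.P_mult) auto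
  qed
  have W: "\<tau> ^ j \<in> ?A" "\<tau> ^ j \<notin> P" using A(7)[OF \<tau>_A] P.unit_power[OF \<tau>_unit] by auto
  have G: "z ^ (m - 1) \<in> ?A" "\<tau> ^ j * (w - \<iota> 0) = z * z ^ (m - 1)"
    using A(7)[OF A(10)] z_m m by (auto simp flip: power_Suc)
  have wP0: "w - \<iota> 0 \<in> P" and zP0: "z - \<iota> 0 \<in> P" using wP zP by simp_all
  have G2: "\<tau> ^ j * (z - \<iota> 0) = z * \<tau> ^ j" by simp
  note point = nonsingular_point[OF adj P(1) wP0 zP0 A(10) zP z0 W G(1) W(1) G(2) G2]
  have v_z: "place_val P z = 1" by (rule point(1))
  have w0: "w \<noteq> 0" using x_nonzero by (simp add: w_def)
  have "int m * place_val P z = int j * place_val P \<tau> + place_val P w"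
    using arg_cong[OF z_m, of "place_val P"] \<tau>0 z0 w0
    by (simp add: P.place_val_mult P.place_val_power)
  then have v_w: "place_val P w = int m"
    using v_z P.place_val_unit[OF \<tau>_unit] by simp
  then show "place_val P x = - int m"
    using P.place_val_power_int[OF w0, of "- 1"] by (simp add: w_def)
  have "place_val P y + int n * place_val P z = int k * place_val P \<tau>"
    using arg_cong[OF y_z, of "place_val P"] \<tau>0 z0 y_nonzero
    by (simp add: P.place_val_mult P.place_val_power)
  then show "place_val P y = - int n"
    using v_z P.place_val_unit[OF \<tau>_unit] by simp
  show "place_degree \<iota> UNIV P = 1" by (rule point(2))
  assume P': "P' \<in> places \<iota> UNIV" "inverse x \<in> P'"
  interpret P': function_field_place \<iota> x m "\<lambda>j. y ^ j" P'
    by (rule places_function_field_place[OF P'(1)])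
  have wP': "w \<in> P'" using P'(2) by (simp add: w_def)
  have "\<tau> \<in> P'.\<O>" using P'.P_subset_\<O>[OF wP'] by (intro \<tau>_poly P'.subring_\<O>) auto
  then have "\<tau> ^ j * w \<in> P'" by (intro P'.P_mult P'.\<O>_closed(7) wP')
  then have "z \<in> P'" using P'.power_in_P_imp[of z m] z_m by simp
  then show "P' = P" using wP' by (intro point(3) P'(1)) simp_all
qed

text \<open>Near \<open>(a\<^sub>k, 0)\<close> the equation is \<open>y\<^sup>m = W (x - a\<^sub>k)\<close> with a unit \<open>W\<close>, so \<open>y\<close> is a local
  parameter.\<close>

lemma place_at_root:
  assumes k: "k \<in> {1..n}" and P: "P \<in> places \<iota> UNIV" "x - \<iota> (a k) \<in> P"
  shows "place_val P y = 1" "place_degree \<iota> UNIV P = 1"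
    and "P' \<in> places \<iota> UNIV \<Longrightarrow> x - \<iota> (a k) \<in> P' \<Longrightarrow> P' = P"
proof -
  define W where "W = (\<Prod>i\<in>{1..n} - {k}. x - \<iota> (a i))"
  have y_m: "y ^ m = W * (x - \<iota> (a k))"
    unfolding y_power_m ev_f W_def using k by (subst prod.remove[of _ k]) (auto simp: mult.commute)
  let ?A = "coordinate_ring x y"
  note A = subring_closed[OF coordinate_ring(1)[of x y]]
    coordinate_ring(2-4)[where X = x and Y = y]
  have W_poly: "W \<in> S" if "is_subring S" "range \<iota> \<subseteq> S" "x \<in> S" for S
    unfolding W_def
  proof (rule subring_prod[OF that(1)])
    fix i
    have "\<iota> (a i) \<in> S" using that(2) by blast
    then show "x - \<iota> (a i) \<in> S" by (rule subring_closed(3)[OF that(1,3)])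
  qed
  have yP: "y \<in> P'" if P': "P' \<in> places \<iota> UNIV" "x - \<iota> (a k) \<in> P'" for P'
  proof -
    interpret P': function_field_place \<iota> x m "\<lambda>j. y ^ j" P'
      by (rule places_function_field_place[OF P'(1)])
    have "W \<in> P'.\<O>"
      using P'.\<iota>_diff_in_\<O>[OF P'(2)] by (intro W_poly P'.subring_\<O>) auto
    then have "y ^ m \<in> P'" unfolding y_m by (rule P'.P_mult[OF _ P'(2)])
    then show ?thesis by (rule P'.power_in_P_imp)
  qed
  interpret P: function_field_place \<iota> x m "\<lambda>j. y ^ j" P
    by (rule places_function_field_place[OF P(1)])
  have "W \<notin> P"
  proof
    assume "W \<in> P"
    then have "\<exists>i\<in>{1..n} - {k}. x - \<iota> (a i) \<in> P"
      unfolding W_def using P.\<iota>_diff_in_\<O>[OF P(2)]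
      by (intro P.P_prime_prod) (auto intro: P.\<O>_closed(3))
    then obtain i where i: "i \<in> {1..n} - {k}" "x - \<iota> (a i) \<in> P" by blast
    then have "a i = a k" using P.residue_unique P(2) by blast
    then show False using i k inj_a by (auto dest: inj_onD)
  qed
  moreover have "W \<in> ?A" using A(8,9) by (intro W_poly coordinate_ring(1)) auto
  moreover have "W * (x - \<iota> (a k)) = y * y ^ (m - 1)" "y ^ (m - 1) \<in> ?A"
    using y_m A(7)[OF A(10)] m by (auto simp flip: power_Suc)
  moreover have "W * (y - \<iota> 0) = y * W" by simp
  moreover have "y - \<iota> 0 \<in> P" using yP[OF P] by simp
  ultimately have "place_val P y = 1 \<and> place_degree \<iota> UNIV P = 1 \<and>
      (\<forall>P'. P' \<in> places \<iota> UNIV \<longrightarrow> x - \<iota> (a k) \<in> P' \<longrightarrow> y - \<iota> 0 \<in> P' \<longrightarrow> P' = P)"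
    using nonsingular_point[OF adjoin_x_y P _ A(10) yP[OF P] y_nonzero, of 0 W "y ^ (m - 1)" W]
    by blast
  then show "place_val P y = 1" "place_degree \<iota> UNIV P = 1"
    and "P' \<in> places \<iota> UNIV \<Longrightarrow> x - \<iota> (a k) \<in> P' \<Longrightarrow> P' = P"
    using yP by simp_all
qed

lemma eq_Q_0_iff: "P \<in> places \<iota> UNIV \<Longrightarrow> P = Q 0 \<longleftrightarrow> inverse x \<in> P"
  using place_at_infinity(4)[OF Q_place inverse_x_in_Q_0] inverse_x_in_Q_0 by blast

lemma eq_Q_iff:
  "k \<in> {1..n} \<Longrightarrow> P \<in> places \<iota> UNIV \<Longrightarrow> P = Q k \<longleftrightarrow> x - \<iota> (a k) \<in> P"
  using place_at_root(3)[OF _ Q_place x_minus_a_in_Q, of k P] x_minus_a_in_Q by auto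

lemma place_degree_Q: "k \<le> n \<Longrightarrow> place_degree \<iota> UNIV (Q k) = 1"
  using place_at_infinity(3)[OF Q_place inverse_x_in_Q_0]
    place_at_root(2)[OF _ Q_place x_minus_a_in_Q, of k] by (cases "k = 0") auto

lemma place_val_y_Q: "place_val (Q 0) y = - int n" "k \<in> {1..n} \<Longrightarrow> place_val (Q k) y = 1"
  using place_at_infinity(2)[OF Q_place inverse_x_in_Q_0]
    place_at_root(1)[OF _ Q_place x_minus_a_in_Q, of k] by auto

lemma inj_Q: "inj_on Q {0..n}"
proof (rule inj_onI)
  have 0: "inverse x \<notin> Q k" if "k \<in> {1..n}" for k
  proof -
    interpret P: function_field_place \<iota> x m "\<lambda>j. y ^ j" "Q k"
      using places_function_field_place Q_place that by simp
    show ?thesis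
      using P.in_P_iff[of "inverse x"] P.\<iota>_diff_in_\<O>[OF x_minus_a_in_Q[OF that]] x_nonzero by auto
  qed
  fix i j assume ij: "i \<in> {0..n}" "j \<in> {0..n}" "Q i = Q j"
  consider "i = 0" | "j = 0" | "i \<in> {1..n}" "j \<in> {1..n}" using ij by force
  then show "i = j"
  proof cases
    case 1
    then show ?thesis using 0[of j] ij inverse_x_in_Q_0 by (cases "j = 0") auto
  next
    case 2
    then show ?thesis using 0[of i] ij inverse_x_in_Q_0 by (cases "i = 0") auto
  next
    case 3
    interpret P: function_field_place \<iota> x m "\<lambda>j. y ^ j" "Q i"
      using places_function_field_place Q_place ij by simp
    have "a i = a j"
      using P.residue_unique[OF x_minus_a_in_Q[OF 3(1)]] x_minus_a_in_Q[OF 3(2)] ij(3) by simp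
    then show ?thesis using inj_a 3 by (auto dest: inj_onD)
  qed
qed

lemma unramified_place:
  assumes P: "P \<in> places \<iota> UNIV" "P \<notin> Q ` {0..n}"
  shows "x \<in> ring_of_place UNIV P" "y \<in> ring_of_place UNIV P - P" "place_val P y = 0"
proof -
  interpret P: function_field_place \<iota> x m "\<lambda>j. y ^ j" P
    by (rule places_function_field_place[OF P(1)])
  have "P \<noteq> Q k" if "k \<le> n" for k using P(2) that by auto
  then have no: "inverse x \<notin> P" "\<And>k. k \<in> {1..n} \<Longrightarrow> x - \<iota> (a k) \<notin> P"
    using eq_Q_0_iff[OF P(1)] eq_Q_iff[OF _ P(1)] by auto
  show x: "x \<in> P.\<O>" using no(1) P.in_\<O>_or_inverse by blast
  have "y ^ m \<in> P.\<O>" unfolding y_power_m using P.ev_in_\<O>[OF x] .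
  then have "y \<in> P.\<O>" using P.power_in_\<O>_imp[of y m] m by simp
  moreover have "y \<notin> P"
  proof
    assume "y \<in> P"
    then have "y ^ m \<in> P"
      using P.P_mult2[of y "y ^ (m - 1)"] P.\<O>_closed(7) P.P_subset_\<O> m
      by (metis One_nat_def Suc_pred less_le_trans pos2 power_Suc)
    then show False
      unfolding y_power_m ev_f
      using P.P_prime_prod[of "{1..n}" "\<lambda>i. x - \<iota> (a i)"] P.\<O>_closed(3)[OF x] no(2) by auto
  qed
  ultimately show "y \<in> P.\<O> - P" by blast
  then show "place_val P y = 0" by (rule P.place_val_unit)
qed

text \<open>Off the branch points, \<open>Y\<^sup>m - f(b)\<close> has simple roots, so \<open>x - b\<close> is a local parameter at a
  rational point over \<open>b\<close>, and the \<open>y\<close>-coordinate determines the place.\<close>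

lemma place_at_unramified_point:
  assumes m0: "of_nat m \<noteq> (0 :: 'k)" and c: "c \<noteq> 0"
    and P: "P \<in> places \<iota> UNIV" "x - \<iota> b \<in> P" "y - \<iota> c \<in> P"
  shows "place_val P (x - \<iota> b) = 1" and "poly f b = c ^ m"
    and "P' \<in> places \<iota> UNIV \<Longrightarrow> x - \<iota> b \<in> P' \<Longrightarrow> y - \<iota> c \<in> P' \<Longrightarrow> P' = P"
proof -
  interpret P: function_field_place \<iota> x m "\<lambda>j. y ^ j" P
    by (rule places_function_field_place[OF P(1)])
  have y_pow: "y ^ i - \<iota> (c ^ i) \<in> P" for i
    using P.ev_congruent[OF P(3), of "monom 1 i"] by (simp add: map_poly_monom poly_monom)
  show f_b: "poly f b = c ^ m"
    using P.residue_unique[OF y_pow[of m]] P.ev_congruent[OF P(2), of f] by (simp add: y_power_m)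
  obtain q where q: "ev f x - \<iota> (poly f b) = (x - \<iota> b) * ev q x" by (rule ev_minus_value_dvd)
  define W where "W = (\<Sum>i<m. \<iota> (c ^ (m - Suc i)) * y ^ i)"
  have W_diff: "W * (y - \<iota> c) = (x - \<iota> b) * ev q x"
  proof -
    have "y ^ m - \<iota> c ^ m = (y - \<iota> c) * W"
      unfolding W_def power_diff_sumr2[of y m "\<iota> c"] by (simp add: \<iota>_power)
    then show ?thesis using q f_b by (simp add: y_power_m \<iota>_power mult.commute)
  qed
  have "W \<notin> P"
  proof
    have "W - \<iota> (of_nat m * c ^ (m - 1)) = (\<Sum>i<m. \<iota> (c ^ (m - Suc i)) * (y ^ i - \<iota> (c ^ i)))"
    proof -
      have "(\<Sum>i<m. \<iota> (c ^ (m - Suc i)) * \<iota> (c ^ i)) = (\<Sum>i<m. \<iota> (c ^ (m - 1)))"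
        by (intro sum.cong) (auto simp flip: \<iota>_mult power_add)
      then show ?thesis by (simp add: W_def right_diff_distrib sum_subtractf \<iota>_mult \<iota>_of_nat)
    qed
    also have "\<dots> \<in> P" by (intro P.P_sum P.P_mult P.\<iota>_in_\<O> y_pow)
    finally have "W - \<iota> (of_nat m * c ^ (m - 1)) \<in> P" .
    moreover assume "W \<in> P"
    ultimately have "of_nat m * c ^ (m - 1) = 0"
      using P.residue_unique[of W "of_nat m * c ^ (m - 1)" 0] by simp
    then show False using m0 c by simp
  qed
  moreover have "W \<in> coordinate_ring x y" "ev q x \<in> coordinate_ring x y"
      "x - \<iota> b \<in> coordinate_ring x y"
  proof -
    note A = subring_closed[OF coordinate_ring(1)[of x y]]
      coordinate_ring(2-4)[where X = x and Y = y]
    show "W \<in> coordinate_ring x y"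
      unfolding W_def
      by (intro subring_sum coordinate_ring(1) A(4) A(8) A(7)[OF A(10)])
    show "ev q x \<in> coordinate_ring x y"
      using A(8,9) by (intro ev_in_subring coordinate_ring(1)) auto
    show "x - \<iota> b \<in> coordinate_ring x y" by (intro A(3) A(8,9))
  qed
  moreover have "W * (x - \<iota> b) = (x - \<iota> b) * W" by simp
  ultimately have "place_val P (x - \<iota> b) = 1 \<and> (P' \<in> places \<iota> UNIV \<longrightarrow> x - \<iota> b \<in> P' \<longrightarrow>
      y - \<iota> c \<in> P' \<longrightarrow> P' = P)"
    using nonsingular_point(1,3)[OF adjoin_x_y P _ P(2) x_minus_nonzero, of W W "ev q x"] W_diff
    by blast
  then show "place_val P (x - \<iota> b) = 1"
    and "P' \<in> places \<iota> UNIV \<Longrightarrow> x - \<iota> b \<in> P' \<Longrightarrow> y - \<iota> c \<in> P' \<Longrightarrow> P' = P" by blast+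
qed

end

section \<open>The Kummer automorphisms\<close>

context kummer_curve
begin

text \<open>The valuations of \<open>c \<cdot> y\<^sup>j\<close> at infinity, with \<open>c \<in> K(x)\<close> and \<open>j < m\<close>, are pairwise incongruent
  modulo \<open>m\<close>, as \<open>v(c)\<close> is a multiple of \<open>m\<close> and \<open>v(y) = - n\<close> is prime to \<open>m\<close>.\<close>

lemma powers_independent:
  assumes c: "\<And>j. j < m \<Longrightarrow> c j \<in> adjoin \<iota> {x}" and sum: "(\<Sum>j<m. c j * y ^ j) = 0" and "j < m"
  shows "c j = 0"
proof (rule ccontr)
  assume "c j \<noteq> 0"
  interpret P: function_field_place \<iota> x m "\<lambda>j. y ^ j" "Q 0"
    using places_function_field_place Q_place by simp
  define I where "I = {j. j < m \<and> c j \<noteq> 0}"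
  have val: "\<exists>k. place_val (Q 0) (c i * y ^ i) = int m * k - int n * int i" if "i \<in> I" for i
  proof -
    have i: "i < m" "c i \<noteq> 0" using that by (auto simp: I_def)
    obtain k u where u: "u \<in> P.\<O> - Q 0" "c i = inverse x powi k * u"
      using P.rational_function_order_at_infinity[OF inverse_x_in_Q_0 c[OF i(1)] i(2)] by blast
    have u0: "u \<noteq> 0" using u(1) P.zero_in_P by blast
    have "place_val (Q 0) (inverse x) = int m"
      using P.place_val_power_int[OF x_nonzero, of "- 1"]
        place_at_infinity(1)[OF Q_place inverse_x_in_Q_0] by simp
    then have "place_val (Q 0) (c i) = k * int m"
      unfolding u(2) using P.place_val_unit[OF u(1)] u0 x_nonzero
      by (simp add: P.place_val_mult P.place_val_power_int)
    then have "place_val (Q 0) (c i * y ^ i) = int m * k - int n * int i"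
      using i(2) y_nonzero place_val_y_Q(1)
      by (simp add: P.place_val_mult P.place_val_power mult.commute)
    then show ?thesis ..
  qed
  have "(\<Sum>i\<in>I. c i * y ^ i) \<noteq> 0"
  proof (rule P.sum_nonzero_of_distinct_orders)
    show "finite I" "I \<noteq> {}" using \<open>j < m\<close> \<open>c j \<noteq> 0\<close> by (auto simp: I_def)
    show nz: "c i * y ^ i \<noteq> 0" if "i \<in> I" for i using that y_nonzero by (simp add: I_def)
    fix i l assume il: "i \<in> I" "l \<in> I" "i \<noteq> l"
    obtain k k' where k: "place_val (Q 0) (c i * y ^ i) = int m * k - int n * int i"
      "place_val (Q 0) (c l * y ^ l) = int m * k' - int n * int l"
      using val il by blast
    have "place_val (Q 0) (c i * y ^ i) \<noteq> place_val (Q 0) (c l * y ^ l)"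
    proof
      assume "place_val (Q 0) (c i * y ^ i) = place_val (Q 0) (c l * y ^ l)"
      then have "int n * (int i - int l) = int m * (k - k')"
        unfolding k by (simp add: algebra_simps)
      then have "int m dvd int n * (int i - int l)" by simp
      moreover have "coprime (int m) (int n)" using coprime by simp
      ultimately have "int m dvd int i - int l" by (simp add: coprime_dvd_mult_right_iff)
      moreover have "\<bar>int i - int l\<bar> < int m" using il by (auto simp: I_def)
      ultimately show False using dvd_imp_le_int[of "int i - int l" "int m"] il(3) by simp
    qed
    then have "place_val (Q 0) (c i * y ^ i / (c l * y ^ l)) > 0
        \<or> place_val (Q 0) (c l * y ^ l / (c i * y ^ i)) > 0"
      using P.place_val_divide[OF nz[OF il(1)] nz[OF il(2)]]
        P.place_val_divide[OF nz[OF il(2)] nz[OF il(1)]] by linarith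
    then show "c i * y ^ i / (c l * y ^ l) \<in> Q 0 \<or> c l * y ^ l / (c i * y ^ i) \<in> Q 0"
      using nz[OF il(1)] nz[OF il(2)] P.place_val_pos_iff by (metis divide_eq_0_iff)
  qed
  moreover have "(\<Sum>i\<in>I. c i * y ^ i) = (\<Sum>j<m. c j * y ^ j)"
    by (rule sum.mono_neutral_left) (auto simp: I_def)
  ultimately show False using sum by simp
qed

definition coordinates :: "'f \<Rightarrow> nat \<Rightarrow> 'f" where
  "coordinates z = (SOME c. (\<forall>j<m. c j \<in> adjoin \<iota> {x}) \<and> z = (\<Sum>j<m. c j * y ^ j))"

lemma coordinates:
  "j < m \<Longrightarrow> coordinates z j \<in> adjoin \<iota> {x}" "(\<Sum>j<m. coordinates z j * y ^ j) = z"
  using someI_ex[OF spanning[of z]] by (auto simp: coordinates_def)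

lemma coordinates_eqI:
  assumes "\<And>j. j < m \<Longrightarrow> c j \<in> adjoin \<iota> {x}" "(\<Sum>j<m. c j * y ^ j) = z" "j < m"
  shows "coordinates z j = c j"
proof -
  have "(\<Sum>j<m. (coordinates z j - c j) * y ^ j) = 0"
    using coordinates(2) assms(2) by (simp add: left_diff_distrib sum_subtractf)
  then have "coordinates z j - c j = 0"
    by (intro powers_independent[of "\<lambda>j. coordinates z j - c j", OF _ _ assms(3)]
          adjoin_closed(3) coordinates(1) assms(1))
  then show ?thesis by simp
qed

text \<open>For \<open>\<zeta>\<^sup>m = 1\<close> this is the automorphism of \<open>F/K(x)\<close> that sends \<open>y\<close> to \<open>\<zeta> y\<close>.\<close>

definition twist :: "'k \<Rightarrow> 'f \<Rightarrow> 'f" where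
  "twist \<zeta> z = (\<Sum>j<m. coordinates z j * (\<iota> \<zeta> * y) ^ j)"

lemma twist_powers_sum:
  "(\<And>j. j < m \<Longrightarrow> c j \<in> adjoin \<iota> {x}) \<Longrightarrow>
     twist \<zeta> (\<Sum>j<m. c j * y ^ j) = (\<Sum>j<m. c j * (\<iota> \<zeta> * y) ^ j)"
  unfolding twist_def by (intro sum.cong) (simp_all add: coordinates_eqI)

lemma twist_add: "twist \<zeta> (u + v) = twist \<zeta> u + twist \<zeta> v"
proof -
  have "u + v = (\<Sum>j<m. (coordinates u j + coordinates v j) * y ^ j)"
    by (simp add: distrib_right sum.distrib coordinates(2))
  moreover have "twist \<zeta> (\<Sum>j<m. (coordinates u j + coordinates v j) * y ^ j)
      = (\<Sum>j<m. (coordinates u j + coordinates v j) * (\<iota> \<zeta> * y) ^ j)"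
    by (intro twist_powers_sum adjoin_closed(6) coordinates(1))
  ultimately have "twist \<zeta> (u + v)
      = (\<Sum>j<m. (coordinates u j + coordinates v j) * (\<iota> \<zeta> * y) ^ j)" by simp
  then show ?thesis by (simp add: distrib_right sum.distrib twist_def)
qed

lemma twist_finite_sum: "twist \<zeta> (sum u I) = (\<Sum>i\<in>I. twist \<zeta> (u i))"
proof -
  have "twist \<zeta> 0 = 0" using twist_add[of \<zeta> 0 0] by (metis add_cancel_right_right add_0)
  then show ?thesis by (induction I rule: infinite_finite_induct) (auto simp: twist_add)
qed

lemma twist_monomial:
  assumes \<zeta>: "\<zeta> ^ m = 1" and c: "c \<in> adjoin \<iota> {x}"
  shows "twist \<zeta> (c * y ^ k) = c * (\<iota> \<zeta> * y) ^ k"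
proof -
  define e where "e = (\<lambda>j. if j = k mod m then c * (y ^ m) ^ (k div m) else 0)"
  note C = adjoin_closed[where \<iota> = \<iota> and X = "{x}"]
  have e: "e j \<in> adjoin \<iota> {x}" for j
    using C(2) C(4)[OF c C(7)[of "y ^ m"]] ev_in_adjoin by (simp add: e_def y_power_m)
  have pow: "w ^ k = (w ^ m) ^ (k div m) * w ^ (k mod m)" for w :: 'f
    by (simp only: power_mult[symmetric] power_add[symmetric] mult_div_mod_eq)
  have sum: "(\<Sum>j<m. e j * w ^ j) = c * (y ^ m) ^ (k div m) * w ^ (k mod m)" for w :: 'f
  proof -
    have "(\<Sum>j<m. e j * w ^ j) = (\<Sum>j\<in>{k mod m}. e j * w ^ j)"
      using m by (intro sum.mono_neutral_right) (auto simp: e_def)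
    then show ?thesis by (simp add: e_def)
  qed
  have "c * y ^ k = (\<Sum>j<m. e j * y ^ j)" unfolding sum pow[of y] by (simp add: mult.assoc)
  then have "twist \<zeta> (c * y ^ k) = (\<Sum>j<m. e j * (\<iota> \<zeta> * y) ^ j)" using twist_powers_sum[of e, OF e] by simp
  also have "\<dots> = c * (\<iota> \<zeta> * y) ^ k"
  proof -
    have "(\<iota> \<zeta> * y) ^ m = y ^ m" using \<zeta> by (simp add: power_mult_distrib flip: \<iota>_power)
    then show ?thesis unfolding sum pow[of "\<iota> \<zeta> * y"] by (simp add: mult.assoc)
  qed
  finally show ?thesis .
qed

lemma twist_mult:
  assumes \<zeta>: "\<zeta> ^ m = 1" shows "twist \<zeta> (u * v) = twist \<zeta> u * twist \<zeta> v"
proof -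
  note C = adjoin_closed[where \<iota> = \<iota> and X = "{x}"]
  have "u * v = (\<Sum>i<m. coordinates u i * y ^ i) * (\<Sum>j<m. coordinates v j * y ^ j)"
    by (simp only: coordinates(2))
  also have "\<dots> = (\<Sum>i<m. \<Sum>j<m. (coordinates u i * coordinates v j) * y ^ (i + j))"
    unfolding sum_product by (intro sum.cong refl) (simp add: power_add)
  finally have "twist \<zeta> (u * v)
      = twist \<zeta> (\<Sum>i<m. \<Sum>j<m. (coordinates u i * coordinates v j) * y ^ (i + j))"
    by (rule arg_cong)
  also have "\<dots> = (\<Sum>i<m. \<Sum>j<m. (coordinates u i * coordinates v j) * (\<iota> \<zeta> * y) ^ (i + j))"
    unfolding twist_finite_sum
  proof (intro sum.cong refl)
    fix i j assume "i \<in> {..<m}" "j \<in> {..<m}"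
    then have "coordinates u i * coordinates v j \<in> adjoin \<iota> {x}"
      by (intro C(4) coordinates(1)) simp_all
    then show "twist \<zeta> (coordinates u i * coordinates v j * y ^ (i + j))
        = coordinates u i * coordinates v j * (\<iota> \<zeta> * y) ^ (i + j)"
      by (rule twist_monomial[OF \<zeta>])
  qed
  also have "\<dots> = twist \<zeta> u * twist \<zeta> v"
    unfolding twist_def sum_product by (intro sum.cong refl) (simp add: power_add)
  finally show ?thesis .
qed

lemma twist_rational: "\<zeta> ^ m = 1 \<Longrightarrow> c \<in> adjoin \<iota> {x} \<Longrightarrow> twist \<zeta> c = c"
  using twist_monomial[of \<zeta> c 0] by simp

lemma surj_twist:
  assumes "\<zeta> ^ m = 1" shows "surj (twist \<zeta>)"
proof (rule surjI)
  have \<zeta>0: "\<zeta> \<noteq> 0" using assms m by (auto simp: power_0_left)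
  fix z
  let ?c = "\<lambda>j. coordinates z j * inverse (\<iota> \<zeta>) ^ j"
  have "inverse (\<iota> \<zeta>) \<in> adjoin \<iota> {x}"
    using adjoin_superset(2)[of \<iota>] by (auto simp flip: \<iota>_inverse)
  then have "twist \<zeta> (\<Sum>j<m. ?c j * y ^ j) = (\<Sum>j<m. ?c j * (\<iota> \<zeta> * y) ^ j)"
    by (intro twist_powers_sum adjoin_closed(4,7) coordinates(1))
  also have "\<dots> = (\<Sum>j<m. coordinates z j * y ^ j)"
    using \<zeta>0 by (intro sum.cong) (simp_all add: power_mult_distrib field_simps)
  finally show "twist \<zeta> (\<Sum>j<m. ?c j * y ^ j) = z" unfolding coordinates(2) .
qed

end

text \<open>Places, prime elements and units are defined by the field structure of \<open>F\<close> over \<open>K\<close> alone, so an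
  automorphism \<open>\<sigma>\<close> of \<open>F/K\<close> transports them.\<close>

lemma (in function_field) pullback_place:
  fixes \<sigma> :: "'f \<Rightarrow> 'f"
  assumes add: "\<And>u v. \<sigma> (u + v) = \<sigma> u + \<sigma> v" and mult: "\<And>u v. \<sigma> (u * v) = \<sigma> u * \<sigma> v"
    and const: "\<And>c. \<sigma> (\<iota> c) = \<iota> c" and surj: "surj \<sigma>"
    and P: "P \<in> places \<iota> UNIV"
  shows "\<sigma> -` P \<in> places \<iota> UNIV" and "z \<noteq> 0 \<Longrightarrow> place_val (\<sigma> -` P) z = place_val P (\<sigma> z)"
proof -
  interpret P: function_field_place \<iota> x d b P
    by unfold_locales (simp_all add: subfield_UNIV P)
  have \<sigma>_0 [simp]: "\<sigma> 0 = 0" and \<sigma>_1 [simp]: "\<sigma> 1 = 1" using const[of 0] const[of 1] by simp_all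
  have diff: "\<sigma> (u - v) = \<sigma> u - \<sigma> v" for u v using add[of "u - v" v] by (simp add: algebra_simps)
  have \<sigma>_nz: "\<sigma> z \<noteq> 0" if "z \<noteq> 0" for z
    using mult[of z "inverse z"] that by auto
  have inverse: "\<sigma> (inverse z) = inverse (\<sigma> z)" for z
    by (cases "z = 0") (auto intro!: inverse_unique[symmetric] simp flip: mult)
  have power: "\<sigma> (z ^ k) = \<sigma> z ^ k" for z k by (induction k) (simp_all add: mult)
  have power_int: "\<sigma> (z powi k) = \<sigma> z powi k" for z k
    by (cases "k \<ge> 0") (simp_all only: power_int_def power inverse if_True if_False)
  have zero_iff: "\<sigma> z = 0 \<longleftrightarrow> z = 0" for z using \<sigma>_nz[of z] by auto
  have val_ring: "valuation_ring \<iota> UNIV (\<sigma> -` P.\<O>)"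
    unfolding valuation_ring_def
  proof (intro conjI ballI)
    show "is_subring (\<sigma> -` P.\<O>)"
      unfolding is_subring_def vimage_def mem_Collect_eq diff mult \<sigma>_1
      using P.subring_\<O> unfolding is_subring_def by blast
    show "z \<in> \<sigma> -` P.\<O> \<or> inverse z \<in> \<sigma> -` P.\<O>" for z
      using P.in_\<O>_or_inverse[of "\<sigma> z"] P.P_subset_\<O>[of "inverse (\<sigma> z)"]
      unfolding vimage_def mem_Collect_eq inverse by blast
    have strict: "range \<iota> \<subset> P.\<O>" "P.\<O> \<subset> UNIV"
      using P.valuation_ring_of_place by (auto simp: valuation_ring_def)
    obtain z where z: "z \<notin> P.\<O>" using strict(2) by blast
    obtain z' where "z = \<sigma> z'" using surjD[OF surj] by blast
    then show "\<sigma> -` P.\<O> \<subset> UNIV" using z by blast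
    obtain w where w: "w \<in> P.\<O>" "w \<notin> range \<iota>" using strict(1) by blast
    obtain w' where w': "w = \<sigma> w'" using surjD[OF surj] by blast
    have "w' \<notin> range \<iota>"
    proof
      assume "w' \<in> range \<iota>"
      then obtain c where "w' = \<iota> c" by blast
      then show False using w(2) w' const[of c] by simp
    qed
    moreover have "w' \<in> \<sigma> -` P.\<O>" using w(1) w' by simp
    moreover have "\<iota> c \<in> \<sigma> -` P.\<O>" for c using const[of c] by simp
    ultimately show "range \<iota> \<subset> \<sigma> -` P.\<O>" by blast
  qed
  have "\<sigma> -` P = nonunits (\<sigma> -` P.\<O>)"
    unfolding nonunits_def vimage_def mem_Collect_eq inverse P.in_P_iff zero_iff by blast
  then show place: "\<sigma> -` P \<in> places \<iota> UNIV" using val_ring by (auto simp: places_def)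
  interpret P': function_field_place \<iota> x d b "\<sigma> -` P"
    by unfold_locales (simp_all add: subfield_UNIV place)
  have \<O>': "z \<in> P'.\<O> \<longleftrightarrow> \<sigma> z \<in> P.\<O>" for z
    using zero_iff[of z] by (simp add: ring_of_place_def inverse)
  assume "z \<noteq> 0"
  then obtain t u where t: "prime_element (\<sigma> -` P) t" "u \<in> P'.\<O> - \<sigma> -` P"
    and z: "z = t powi place_val (\<sigma> -` P) z * u" by (rule P'.place_val_cases)
  have "prime_element P (\<sigma> t)"
    unfolding P.prime_element_iff
  proof (intro conjI ballI)
    show "\<sigma> t \<in> P" "\<sigma> t \<noteq> 0" using t(1) zero_iff by (simp_all add: P'.prime_element_iff)
    fix w assume "w \<in> P"
    obtain w' where w': "w = \<sigma> w'" using surjD[OF surj] by blast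
    then have "w' \<in> \<sigma> -` P" using \<open>w \<in> P\<close> by simp
    then have "\<sigma> (w' / t) \<in> P.\<O>"
      using t(1) unfolding P'.prime_element_iff \<O>'[symmetric] by blast
    then show "w / \<sigma> t \<in> P.\<O>" by (simp add: w' divide_inverse mult inverse)
  qed
  moreover have "\<sigma> u \<in> P.\<O> - P" using t(2) \<O>' by simp
  moreover have "\<sigma> z = \<sigma> t powi place_val (\<sigma> -` P) z * \<sigma> u"
    by (subst z) (simp only: mult power_int)
  ultimately show "place_val (\<sigma> -` P) z = place_val P (\<sigma> z)"
    using P.place_val_eqI by simp
qed

text \<open>The sign of the exponent \<open>k\<close> below decides whether \<open>c\<close> belongs to a place over \<open>b'\<close>, whichever
  field the place belongs to.\<close>

lemma (in function_field) rational_function_order_at_point: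
  assumes "c \<in> adjoin \<iota> {x}" "c \<noteq> 0"
  obtains k p q where "poly p b' \<noteq> 0" "poly q b' \<noteq> 0" "c = (x - \<iota> b') powi k * (ev p x / ev q x)"
proof -
  obtain p q where pq: "p \<noteq> 0" "q \<noteq> 0" "c = ev p x / ev q x" using assms by (rule rational_function)
  obtain p' where p': "p = [:- b', 1:] ^ order b' p * p'" "\<not> [:- b', 1:] dvd p'"
    using order_decomp[OF pq(1)] by blast
  obtain q' where q': "q = [:- b', 1:] ^ order b' q * q'" "\<not> [:- b', 1:] dvd q'"
    using order_decomp[OF pq(2)] by blast
  have x0: "x - \<iota> b' \<noteq> 0" using ev_x_eq_0_iff[of "[:- b', 1:]"] by (simp add: \<iota>_minus)
  have lin: "ev [:- b', 1:] x = x - \<iota> b'" by (simp add: \<iota>_minus)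
  have "c = (x - \<iota> b') ^ order b' p * ev p' x / ((x - \<iota> b') ^ order b' q * ev q' x)"
    unfolding pq(3) by (subst p'(1), subst q'(1)) (simp only: ev_mult ev_power lin)
  also have "\<dots> = (x - \<iota> b') powi (int (order b' p) - int (order b' q)) * (ev p' x / ev q' x)"
    using x0 by (simp add: power_int_diff)
  finally have "c = (x - \<iota> b') powi (int (order b' p) - int (order b' q)) * (ev p' x / ev q' x)" .
  then show thesis
    by (rule that[rotated 2]) (use p'(2) q'(2) in \<open>simp_all add: poly_eq_0_iff_dvd\<close>)
qed

lemma (in place) power_int_unit_in_P_iff:
  assumes T: "T \<in> P" "T \<noteq> 0" and u: "u \<in> \<O> - P"
  shows "T powi k * u \<in> P \<longleftrightarrow> k > 0"
proof
  have pow: "T ^ l \<in> \<O>" for l by (rule \<O>_closed(7)[OF P_subset_\<O>[OF T(1)]])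
  show "T powi k * u \<in> P" if "k > 0"
  proof -
    have "nat k = Suc (nat k - 1)" using that by simp
    then have "T powi k * u = T * (T ^ (nat k - 1) * u)"
      using that by (metis mult.assoc power_Suc power_int_def less_imp_le)
    moreover have "T * (T ^ (nat k - 1) * u) \<in> P"
      using u by (intro P_mult2[OF T(1)] \<O>_closed(4) pow) blast
    ultimately show ?thesis by (simp only:)
  qed
  show "k > 0" if inP: "T powi k * u \<in> P"
  proof (rule ccontr)
    assume "\<not> k > 0"
    then have "T ^ nat (- k) * T powi k = 1"
      using T(2) by (cases "k = 0") (auto simp: power_int_def power_inverse)
    then have "inverse u * T ^ nat (- k) * (T powi k * u) = 1"
      using u by (metis DiffE mult.assoc mult.commute mult_1 right_inverse unit_inverse)
    moreover have "inverse u * T ^ nat (- k) * (T powi k * u) \<in> P"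
      using unit_inverse'[OF u] by (intro P_mult[OF _ inP] \<O>_closed(4) pow) blast
    ultimately show False by simp
  qed
qed

lemma (in function_field) rational_function_in_place_iff:
  assumes P: "place \<iota> L P" "x - \<iota> b' \<in> P" and P': "place \<iota> L' P'" "x - \<iota> b' \<in> P'"
    and c: "c \<in> adjoin \<iota> {x}"
  shows "c \<in> P \<longleftrightarrow> c \<in> P'"
proof (cases "c = 0")
  case True
  then show ?thesis using place.zero_in_P[OF P(1)] place.zero_in_P[OF P'(1)] by simp
next
  case False
  obtain k p q where pq: "poly p b' \<noteq> 0" "poly q b' \<noteq> 0"
    "c = (x - \<iota> b') powi k * (ev p x / ev q x)"
    using c False by (rule rational_function_order_at_point)
  have "c \<in> R \<longleftrightarrow> k > 0" if R: "place \<iota> L'' R" "x - \<iota> b' \<in> R" for L'' R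
  proof -
    interpret R: place \<iota> L'' R by (rule R(1))
    have "ev r x \<in> R.\<O> - R" if "poly r b' \<noteq> 0" for r
      using R.ev_in_P_iff[OF R(2), of r] R.ev_in_\<O>[OF R.\<iota>_diff_in_\<O>[OF R(2)]] that by blast
    then have "ev p x / ev q x \<in> R.\<O> - R" using pq by (intro R.unit_divide)
    moreover have "x - \<iota> b' \<noteq> 0" using ev_x_eq_0_iff[of "[:- b', 1:]"] by (simp add: \<iota>_minus)
    ultimately show ?thesis unfolding pq(3) using R(2) by (intro R.power_int_unit_in_P_iff)
  qed
  then show ?thesis using P P' by blast
qed

section \<open>Riemann-Roch spaces\<close>

lemma (in constant_field) vector_space_\<iota>: "vector_space (\<lambda>c z. \<iota> c * z)"
  by unfold_locales (simp_all add: \<iota>_add \<iota>_mult algebra_simps)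

text \<open>\<open>v\<^sub>P(z) \<ge> k\<close>, with \<open>v\<^sub>P(0) = \<infinity>\<close>.\<close>

definition order_ge :: "'f::field set \<Rightarrow> 'f \<Rightarrow> int \<Rightarrow> bool" where
  "order_ge P z k \<longleftrightarrow> z = 0 \<or> place_val P z \<ge> k"

lemma riemann_roch_space_iff:
  "z \<in> riemann_roch_space \<iota> A \<longleftrightarrow> (\<forall>P\<in>places \<iota> UNIV. order_ge P z (- Poly_Mapping.lookup A P))"
  by (auto simp: riemann_roch_space_def order_ge_def)

lemma order_ge_mono: "order_ge P z k \<Longrightarrow> l \<le> k \<Longrightarrow> order_ge P z l"
  by (auto simp: order_ge_def)

context function_field_place
begin

lemma order_ge_0_iff: "order_ge P z 0 \<longleftrightarrow> z \<in> \<O>"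
  using place_val_nonneg_iff[of z] \<O>_closed(2) by (cases "z = 0") (auto simp: order_ge_def)

lemma order_ge_1_iff: "order_ge P z 1 \<longleftrightarrow> z \<in> P"
  using place_val_pos_iff[of z] by (cases "z = 0") (auto simp: order_ge_def)

lemma order_ge_add: "order_ge P z k \<Longrightarrow> order_ge P w k \<Longrightarrow> order_ge P (z + w) k"
  using place_val_add[of z w k] by (cases "z = 0 \<or> w = 0 \<or> z + w = 0") (auto simp: order_ge_def)

lemma order_ge_mult: "order_ge P z k \<Longrightarrow> order_ge P w l \<Longrightarrow> order_ge P (z * w) (k + l)"
  using place_val_mult[of z w] by (cases "z = 0 \<or> w = 0") (auto simp: order_ge_def)

lemma order_ge_\<iota>_mult: "order_ge P z k \<Longrightarrow> order_ge P (\<iota> c * z) k"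
  using order_ge_mult[of "\<iota> c" 0 z k] by (simp add: order_ge_0_iff)

lemma order_ge_divide: "order_ge P z k \<Longrightarrow> w \<noteq> 0 \<Longrightarrow> order_ge P (z / w) (k - place_val P w)"
  using place_val_divide[of z w] by (cases "z = 0") (auto simp: order_ge_def)

end

lemma (in function_field) subspace_riemann_roch_space:
  "module.subspace (\<lambda>c z. \<iota> c * z) (riemann_roch_space \<iota> A)"
proof -
  interpret K: vector_space "\<lambda>c z. \<iota> c * z" by (rule vector_space_\<iota>)
  have P: "function_field_place \<iota> x d b P" if "P \<in> places \<iota> UNIV" for P
    using that by unfold_locales (simp_all add: subfield_UNIV)
  show ?thesis
    unfolding K.subspace_def
  proof (intro conjI ballI allI)
    show "0 \<in> riemann_roch_space \<iota> A" by (simp add: riemann_roch_space_def)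
  qed (simp_all add: riemann_roch_space_iff function_field_place.order_ge_add[OF P]
        function_field_place.order_ge_\<iota>_mult[OF P])
qed

lemma (in constant_field) dimension_one:
  assumes "ell \<iota> A = 1"
  obtains z0 where "\<And>u. u \<in> riemann_roch_space \<iota> A \<Longrightarrow> \<exists>c. u = \<iota> c * z0"
proof -
  interpret K: vector_space "\<lambda>c z. \<iota> c * z" by (rule vector_space_\<iota>)
  obtain B where B: "riemann_roch_space \<iota> A \<subseteq> K.span B" "card B = K.dim (riemann_roch_space \<iota> A)"
    using K.basis_exists by blast
  then have "card B = 1" using assms by (simp add: ell_def)
  then obtain z0 where "B = {z0}" by (rule card_1_singletonE)
  then have "riemann_roch_space \<iota> A \<subseteq> range (\<lambda>c. \<iota> c * z0)"
    using B(1) by (simp add: K.span_singleton)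
  then show thesis by (intro that) blast
qed

context kummer_curve
begin

lemma not_Q_of_unramified:
  assumes "P \<in> places \<iota> UNIV" "x - \<iota> b \<in> P" "b \<notin> a ` {1..n}"
  shows "P \<notin> Q ` {0..n}"
proof
  assume "P \<in> Q ` {0..n}"
  interpret P: function_field_place \<iota> x m "\<lambda>j. y ^ j" P
    by (rule places_function_field_place[OF assms(1)])
  obtain k where k: "k \<le> n" "P = Q k" using \<open>P \<in> Q ` {0..n}\<close> by auto
  show False
  proof (cases "k = 0")
    case True
    then have "inverse x \<in> P" using k inverse_x_in_Q_0 by simp
    then show False
      using P.in_P_iff[of "inverse x"] P.\<iota>_diff_in_\<O>[OF assms(2)] x_nonzero by simp
  next
    case False
    then have "x - \<iota> (a k) \<in> P" using k x_minus_a_in_Q[of k] by simp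
    then have "a k = b" using P.residue_unique assms(2) by blast
    then show False using assms(3) False k by auto
  qed
qed

text \<open>The automorphism fixes \<open>x\<close>, hence each of the places \<open>Q\<^sub>k\<close>, which are determined by the value of
  \<open>x\<close>; so it preserves every divisor supported on them.\<close>

lemma twist_riemann_roch_space:
  assumes \<zeta>: "\<zeta> ^ m = 1" and keys: "Poly_Mapping.keys E \<subseteq> Q ` {0..n}"
    and u: "u \<in> riemann_roch_space \<iota> E"
  shows "twist \<zeta> u \<in> riemann_roch_space \<iota> E"
  unfolding riemann_roch_space_iff
proof
  fix P assume P: "P \<in> places \<iota> UNIV"
  have const: "twist \<zeta> (\<iota> c) = \<iota> c" for c
    using twist_rational[OF \<zeta>, of "\<iota> c"] adjoin_superset(2)[of \<iota>] by auto
  define P' where "P' = twist \<zeta> -` P"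
  have P': "P' \<in> places \<iota> UNIV"
    and val: "\<And>z. z \<noteq> 0 \<Longrightarrow> place_val P' z = place_val P (twist \<zeta> z)"
    using pullback_place[OF twist_add twist_mult[OF \<zeta>] const surj_twist[OF \<zeta>] P]
    unfolding P'_def by blast+
  have "inverse x \<in> adjoin \<iota> {x}"
    using subfield_inverse[OF subfield_adjoin] adjoin_superset(1)[of "{x}" \<iota>] by auto
  then have "P' = Q 0 \<longleftrightarrow> P = Q 0"
    using twist_rational[OF \<zeta>] by (simp add: eq_Q_0_iff P P') (simp add: P'_def)
  moreover have "P' = Q k \<longleftrightarrow> P = Q k" if "k \<in> {1..n}" for k
    using twist_rational[OF \<zeta> ev_in_adjoin[of "[:- a k, 1:]"]] that
    by (simp add: eq_Q_iff P P') (simp add: P'_def \<iota>_minus)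
  ultimately have eq: "P' = Q k \<longleftrightarrow> P = Q k" if "k \<le> n" for k
    using that by (cases "k = 0") auto
  have "Poly_Mapping.lookup E P' = Poly_Mapping.lookup E P"
  proof (cases "P \<in> Q ` {0..n}")
    case True
    then obtain k where "k \<le> n" "P = Q k" by auto
    then show ?thesis using eq[of k] by simp
  next
    case False
    moreover have "P' \<notin> Q ` {0..n}"
    proof
      assume "P' \<in> Q ` {0..n}"
      then obtain k where "k \<le> n" "P' = Q k" by auto
      then show False using eq[of k] False by auto
    qed
    ultimately have "P \<notin> Poly_Mapping.keys E" "P' \<notin> Poly_Mapping.keys E" using keys by blast+
    then show ?thesis by (simp add: in_keys_iff)
  qed
  moreover have "order_ge P' u (- Poly_Mapping.lookup E P')"
    using u P' by (simp add: riemann_roch_space_iff)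
  moreover have "twist \<zeta> 0 = 0" using const[of 0] by simp
  ultimately show "order_ge P (twist \<zeta> u) (- Poly_Mapping.lookup E P)"
    using val[of u] by (cases "u = 0") (auto simp: order_ge_def)
qed

text \<open>Let \<open>u\<close> span \<open>\<L>(E)\<close> and vanish at a place over \<open>b\<close>. As \<open>E\<close> is invariant under the Kummer
  automorphisms, \<open>u\<close> is a common eigenvector of them, so \<open>u = c y\<^sup>j\<close> with \<open>c \<in> K(x)\<close>. Hence \<open>c\<close>
  vanishes at \<open>b\<close>, and \<open>u / (x - b)\<close> is an element of \<open>\<L>(E)\<close> that is not a multiple of \<open>u\<close>.\<close>

lemma no_vanishing_over_split_point:
  fixes Z :: "'k set"
  assumes keys: "Poly_Mapping.keys E \<subseteq> Q ` {0..n}" and ell: "ell \<iota> E = 1"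
    and Z: "card Z = m" "\<And>\<zeta>. \<zeta> \<in> Z \<Longrightarrow> \<zeta> ^ m = 1"
    and b: "b \<notin> a ` {1..n}"
      "\<And>P. P \<in> places \<iota> UNIV \<Longrightarrow> x - \<iota> b \<in> P \<Longrightarrow> place_val P (x - \<iota> b) = 1"
    and R: "R \<in> places \<iota> UNIV" "x - \<iota> b \<in> R"
    and u: "u \<in> riemann_roch_space \<iota> E" "u \<in> R"
  shows "u = 0"
proof (rule ccontr)
  assume u0: "u \<noteq> 0"
  have multiple: "\<exists>\<mu>. v = \<iota> \<mu> * u" if v: "v \<in> riemann_roch_space \<iota> E" for v
  proof -
    obtain z0 where z0: "\<And>u. u \<in> riemann_roch_space \<iota> E \<Longrightarrow> \<exists>c. u = \<iota> c * z0"
      using dimension_one[OF ell] by blast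
    obtain c e where ce: "u = \<iota> c * z0" "v = \<iota> e * z0" using z0 u(1) v by blast
    then have "v = \<iota> (e / c) * u" using u0 by (auto simp: \<iota>_divide)
    then show ?thesis ..
  qed
  let ?c = "coordinates u"
  have eigen: "\<exists>\<mu>. \<forall>j<m. ?c j \<noteq> 0 \<longrightarrow> \<zeta> ^ j = \<mu>" if \<zeta>: "\<zeta> \<in> Z" for \<zeta>
  proof -
    obtain \<mu> where \<mu>: "twist \<zeta> u = \<iota> \<mu> * u"
      using multiple[OF twist_riemann_roch_space[OF Z(2)[OF \<zeta>] keys u(1)]] by blast
    have "\<zeta> ^ j = \<mu>" if j: "j < m" "?c j \<noteq> 0" for j
    proof -
      have K: "\<iota> e \<in> adjoin \<iota> {x}" for e using adjoin_superset(2)[of \<iota>] by auto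
      note mult = adjoin_closed(4)
      have "coordinates (twist \<zeta> u) j = ?c j * \<iota> (\<zeta> ^ j)"
      proof (rule coordinates_eqI[of "\<lambda>j. ?c j * \<iota> (\<zeta> ^ j)", OF _ _ j(1)])
        show "(\<Sum>j<m. ?c j * \<iota> (\<zeta> ^ j) * y ^ j) = twist \<zeta> u"
          by (simp add: twist_def \<iota>_power power_mult_distrib mult.assoc)
      qed (intro mult coordinates(1) K)
      moreover have "coordinates (twist \<zeta> u) j = \<iota> \<mu> * ?c j"
      proof (rule coordinates_eqI[of "\<lambda>j. \<iota> \<mu> * ?c j", OF _ _ j(1)])
        show "(\<Sum>j<m. \<iota> \<mu> * ?c j * y ^ j) = twist \<zeta> u"
          by (simp add: \<mu> mult.assoc coordinates(2) flip: sum_distrib_left)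
      qed (intro mult coordinates(1) K)
      ultimately have "?c j * \<iota> (\<zeta> ^ j) = ?c j * \<iota> \<mu>" by (metis mult.commute)
      then have "\<iota> (\<zeta> ^ j) = \<iota> \<mu>" using j(2) by (metis mult_left_cancel)
      then show ?thesis unfolding \<iota>_inj .
    qed
    then show ?thesis by blast
  qed
  have unique: "\<not> (i < j \<and> j < m \<and> ?c i \<noteq> 0 \<and> ?c j \<noteq> 0)" for i j
  proof
    assume ij: "i < j \<and> j < m \<and> ?c i \<noteq> 0 \<and> ?c j \<noteq> 0"
    define p :: "'k poly" where "p = monom 1 (j - i) - 1"
    have deg: "degree p \<le> j - i"
      unfolding p_def by (intro degree_diff_le) (simp_all add: degree_monom_le)
    have "coeff p (j - i) = 1" using ij by (simp add: p_def)
    then have p0: "p \<noteq> 0" by auto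
    have "poly p \<zeta> = 0" if \<zeta>: "\<zeta> \<in> Z" for \<zeta>
    proof -
      have "\<zeta> ^ i = \<zeta> ^ j" using eigen[OF \<zeta>] ij by (metis less_trans)
      also have "\<dots> = \<zeta> ^ i * \<zeta> ^ (j - i)" using ij by (simp flip: power_add)
      finally have "\<zeta> ^ i * (\<zeta> ^ (j - i) - 1) = 0" by (simp add: right_diff_distrib)
      moreover have "\<zeta> \<noteq> 0" using Z(2)[OF \<zeta>] m by (auto simp: power_0_left)
      ultimately show ?thesis by (simp add: p_def poly_monom)
    qed
    then have "card Z \<le> card {\<zeta>. poly p \<zeta> = 0}"
      by (intro card_mono poly_roots_finite p0) blast
    also have "\<dots> \<le> degree p" by (rule card_poly_roots_bound[OF p0])
    also have "\<dots> \<le> j - i" by (rule deg)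
    also have "\<dots> < m" using ij by (simp add: less_imp_diff_less)
    finally show False using Z(1) by simp
  qed
  obtain j where j: "j < m" "?c j \<noteq> 0"
    using coordinates(2)[of u] u0 by (metis (no_types, lifting) lessThan_iff mult_zero_left sum.neutral)
  have other: "?c i = 0" if "i < m" "i \<noteq> j" for i
    using that j unique[of i j] unique[of j i] by (cases i j rule: linorder_cases) auto
  have "(\<Sum>i<m. ?c i * y ^ i) = (\<Sum>i\<in>{j}. ?c i * y ^ i)"
    using j(1) by (intro sum.mono_neutral_right) (auto dest: other)
  then have u_eq: "u = ?c j * y ^ j" using coordinates(2)[of u] by simp
  note c_rational = coordinates(1)[OF j(1), of u]
  note not_Q = not_Q_of_unramified[OF _ _ b(1)]
  have c_R: "?c j \<in> R"
  proof -
    interpret R: function_field_place \<iota> x m "\<lambda>j. y ^ j" R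
      by (rule places_function_field_place[OF R(1)])
    have "y \<in> R.\<O> - R" using unramified_place(2)[OF R(1) not_Q[OF R]] .
    then have "inverse (y ^ j) \<in> R.\<O>" using R.unit_inverse'[OF R.unit_power] by blast
    then have "inverse (y ^ j) * u \<in> R" using u(2) by (rule R.P_mult)
    moreover have "inverse (y ^ j) * u = ?c j" using y_nonzero by (subst u_eq) simp
    ultimately show ?thesis by (simp only:)
  qed
  have "u / (x - \<iota> b) \<in> riemann_roch_space \<iota> E"
    unfolding riemann_roch_space_iff
  proof
    fix P assume P: "P \<in> places \<iota> UNIV"
    interpret P: function_field_place \<iota> x m "\<lambda>j. y ^ j" P
      by (rule places_function_field_place[OF P])
    show "order_ge P (u / (x - \<iota> b)) (- Poly_Mapping.lookup E P)"
    proof (cases "x - \<iota> b \<in> P")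
      case True
      have "place \<iota> UNIV R" "place \<iota> UNIV P"
        using R(1) P by (unfold_locales; simp add: subfield_UNIV)+
      then have "?c j \<in> P"
        using rational_function_in_place_iff[OF _ True _ R(2) c_rational] c_R by blast
      moreover have "y \<in> P.\<O>" using unramified_place(2)[OF P not_Q[OF P True]] by blast
      ultimately have "u \<in> P"
        by (subst u_eq) (intro P.P_mult2 P.\<O>_closed(7))
      then have "order_ge P (u / (x - \<iota> b)) 0"
        using P.order_ge_divide[of u 1 "x - \<iota> b"] x_minus_nonzero b(2)[OF P True]
        by (simp add: P.order_ge_1_iff)
      moreover have "Poly_Mapping.lookup E P = 0"
        using keys not_Q[OF P True] by (meson in_keys_iff subsetD)
      ultimately show ?thesis by simp
    next
      case False
      then have "place_val P (x - \<iota> b) \<le> 0"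
        using P.place_val_pos_iff[OF x_minus_nonzero, of b] by simp
      moreover have "order_ge P u (- Poly_Mapping.lookup E P)"
        using u(1) P by (simp add: riemann_roch_space_iff)
      ultimately show ?thesis
        by (elim order_ge_mono[OF P.order_ge_divide[OF _ x_minus_nonzero]]) linarith
    qed
  qed
  then obtain \<mu> where "u / (x - \<iota> b) = \<iota> \<mu> * u" using multiple by blast
  then have "u * 1 = u * (\<iota> \<mu> * (x - \<iota> b))" using x_minus_nonzero by (simp add: field_simps)
  then have "1 = \<iota> \<mu> * (x - \<iota> b)" using u0 by (metis mult_left_cancel)
  moreover interpret R: function_field_place \<iota> x m "\<lambda>j. y ^ j" R
    by (rule places_function_field_place[OF R(1)])
  have "\<iota> \<mu> * (x - \<iota> b) \<in> R" by (rule R.P_mult[OF R.\<iota>_in_\<O> R(2)])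
  ultimately show False by (metis R.one_notin_P)
qed


section \<open>Completely split places\<close>

text \<open>As with the degree of a place, all bases have to be compared, since the definition picks one.\<close>

lemma extension_degree: "extension_degree (adjoin \<iota> {x}) = m"
proof -
  let ?L = "adjoin \<iota> {x}"
  have zero: "0 \<in> ?L" by (rule adjoin_closed(2))
  have inj: "inj_on (\<lambda>j. y ^ j) {..<m}"
  proof (rule inj_onI)
    fix i j assume ij: "i \<in> {..<m}" "j \<in> {..<m}" "y ^ i = y ^ j"
    have delta: "coordinates (y ^ k) l = (if l = k then 1 else 0)" if "k < m" "l < m" for k l
    proof (rule coordinates_eqI[OF _ _ that(2)])
      show "(\<Sum>l<m. (if l = k then 1 else 0) * y ^ l) = y ^ k"
        using that by (simp add: if_distrib[of "\<lambda>c. c * _"] cong: if_cong)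
    qed (use zero adjoin_closed(1) in auto)
    show "i = j" using delta[of i i] delta[of j i] ij by (auto split: if_splits)
  qed
  define B0 where "B0 = (\<lambda>j. y ^ j) ` {..<m}"
  have sum_B0: "(\<Sum>v\<in>B0. c v * v) = (\<Sum>j<m. c (y ^ j) * y ^ j)" for c
    unfolding B0_def by (subst sum.reindex[OF inj]) simp
  have "quotient_basis ?L UNIV {0} B0"
    unfolding quotient_basis_def
  proof (intro conjI ballI)
    fix v :: 'f
    define e where "e = (\<lambda>w\<in>B0. coordinates v (inv_into {..<m} (\<lambda>j. y ^ j) w))"
    have e: "e (y ^ j) = coordinates v j" if "j < m" for j
      using that inv_into_f_f[OF inj, of j] by (simp add: e_def B0_def)
    show "\<exists>!c. c \<in> B0 \<rightarrow>\<^sub>E ?L \<and> v - (\<Sum>w\<in>B0. c w * w) \<in> {0}"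
    proof (rule ex1I)
      have "e \<in> B0 \<rightarrow>\<^sub>E ?L"
        using e coordinates(1)[of _ v] by (auto simp: B0_def PiE_iff) (simp add: e_def B0_def)
      moreover have "(\<Sum>w\<in>B0. e w * w) = v"
        unfolding sum_B0 using coordinates(2)[of v] e by simp
      ultimately show "e \<in> B0 \<rightarrow>\<^sub>E ?L \<and> v - (\<Sum>w\<in>B0. e w * w) \<in> {0}" by simp
      fix c assume c: "c \<in> B0 \<rightarrow>\<^sub>E ?L \<and> v - (\<Sum>w\<in>B0. c w * w) \<in> {0}"
      have "coordinates v j = c (y ^ j)" if "j < m" for j
        using c that by (intro coordinates_eqI) (auto simp: sum_B0[symmetric] B0_def PiE_iff)
      then show "c = e"
        using c e by (intro extensionalityI[of _ B0]) (auto simp: PiE_iff e_def B0_def inj)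
    qed
  qed (simp_all add: B0_def)
  then have ex: "\<exists>B. quotient_basis ?L UNIV {0} B" ..
  have "card B = m" if B: "quotient_basis ?L UNIV {0} B" for B
  proof -
    have fin: "finite B" and uniq: "\<And>v. \<exists>!c. c \<in> B \<rightarrow>\<^sub>E ?L \<and> v - (\<Sum>w\<in>B. c w * w) \<in> {0}"
      using B by (auto simp: quotient_basis_def)
    have "\<not> m < card B"
    proof
      assume "m < card B"
      moreover have "\<exists>c. (\<forall>j\<in>{..<m}. c j \<in> ?L) \<and> v = (\<Sum>j<m. c j * y ^ j)" for v
        using spanning[of v] by auto
      ultimately have "\<exists>c. (\<forall>w\<in>B. c w \<in> ?L) \<and> (\<exists>w\<in>B. c w \<noteq> 0) \<and> (\<Sum>w\<in>B. c w * w) = 0"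
        using fin
        by (intro linear_dependence[OF subfield_adjoin, where J = "{..<m}" and b = "\<lambda>j. y ^ j"])
           auto
      then obtain c w where c: "\<And>w. w \<in> B \<Longrightarrow> c w \<in> ?L" "w \<in> B" "c w \<noteq> 0"
        "(\<Sum>w\<in>B. c w * w) = 0" by auto
      have "restrict c B \<in> B \<rightarrow>\<^sub>E ?L \<and> 0 - (\<Sum>w\<in>B. restrict c B w * w) \<in> {0}"
        using c(1,4) by (auto cong: sum.cong)
      moreover have "(\<lambda>w\<in>B. 0) \<in> B \<rightarrow>\<^sub>E ?L \<and> 0 - (\<Sum>w\<in>B. (\<lambda>w\<in>B. 0) w * w) \<in> {0}"
        using zero by (auto cong: sum.cong)
      ultimately have "restrict c B = (\<lambda>w\<in>B. 0)" using uniq[of 0] by blast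
      then have "restrict c B w = (\<lambda>w\<in>B. 0) w" by (rule fun_cong)
      then show False using c(2,3) by simp
    qed
    moreover have "\<not> card B < m"
    proof
      assume "card B < m"
      moreover have "\<exists>c. (\<forall>w\<in>B. c w \<in> ?L) \<and> v = (\<Sum>w\<in>B. c w * w)" for v
      proof -
        obtain c where c: "c \<in> B \<rightarrow>\<^sub>E ?L" "v - (\<Sum>w\<in>B. c w * w) \<in> {0}"
          using uniq[of v] by (elim ex1E) blast
        then show ?thesis by (intro exI[of _ c]) (auto simp: PiE_iff)
      qed
      ultimately have "\<exists>c. (\<forall>j\<in>{..<m}. c j \<in> ?L) \<and> (\<exists>j\<in>{..<m}. c j \<noteq> 0)
          \<and> (\<Sum>j<m. c j * y ^ j) = 0"
        using fin
        by (intro linear_dependence[OF subfield_adjoin, where J = B and b = "\<lambda>w. w"]) auto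
      then show False using powers_independent by (metis lessThan_iff)
    qed
    ultimately show ?thesis by simp
  qed
  then show ?thesis
    unfolding extension_degree_def quotient_dim_def if_P[OF ex] using someI_ex[OF ex] by blast
qed

text \<open>A rational place of \<open>K(x)\<close> is the one at infinity or a point \<open>b\<close>; at infinity and at the branch
  points there is only one place of \<open>F\<close> above it.\<close>

lemma split_place:
  assumes rat: "P0 \<in> rational_places \<iota> (adjoin \<iota> {x})"
    and split: "splits_completely \<iota> (adjoin \<iota> {x}) P0"
  obtains b where "x - \<iota> b \<in> P0" "b \<notin> a ` {1..n}"
    "places_over \<iota> P0 = {P \<in> places \<iota> UNIV. x - \<iota> b \<in> P}" "card (places_over \<iota> P0) = m"
proof -
  let ?L = "adjoin \<iota> {x}"
  have P0: "P0 \<in> places \<iota> ?L" "place_degree \<iota> ?L P0 = 1"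
    using rat by (auto simp: rational_places_def)
  interpret P0: place \<iota> ?L P0 by unfold_locales (simp_all add: subfield_adjoin P0)
  have card: "card (places_over \<iota> P0) = m"
    using split by (simp add: splits_completely_def extension_degree)
  have few: False if "places_over \<iota> P0 \<subseteq> {P}" for P
    using card_mono[OF _ that] card m by simp
  have "x \<in> ?L" using adjoin_superset(1)[of "{x}" \<iota>] by simp
  moreover have "inverse x \<notin> P0"
  proof
    assume "inverse x \<in> P0"
    then have "places_over \<iota> P0 \<subseteq> {Q 0}" using eq_Q_0_iff by (auto simp: places_over_def)
    then show False by (rule few)
  qed
  ultimately have "x \<in> P0.\<O>" using P0.in_\<O>_or_inverse_in_P by blast
  then obtain b where b: "x - \<iota> b \<in> P0" using P0.residue_exists[OF P0(2)] by blast
  have over: "places_over \<iota> P0 = {P \<in> places \<iota> UNIV. x - \<iota> b \<in> P}"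
  proof (intro equalityI subsetI)
    fix P assume "P \<in> {P \<in> places \<iota> UNIV. x - \<iota> b \<in> P}"
    then have P: "P \<in> places \<iota> UNIV" "x - \<iota> b \<in> P" by auto
    have places: "place \<iota> ?L P0" "place \<iota> UNIV P"
      by (unfold_locales, unfold_locales) (simp_all add: P subfield_UNIV)
    have "z \<in> P" if "z \<in> P0" for z
      using rational_function_in_place_iff[OF places(1) b places(2) P(2)]
        P0.\<O>_subset_L[OF P0.P_subset_\<O>[OF that]] that by blast
    then show "P \<in> places_over \<iota> P0" using P by (auto simp: places_over_def)
  qed (use b in \<open>auto simp: places_over_def\<close>)
  moreover have "b \<notin> a ` {1..n}"
  proof
    assume "b \<in> a ` {1..n}"
    then obtain k where "k \<in> {1..n}" "b = a k" by blast
    then have "places_over \<iota> P0 \<subseteq> {Q k}" using over eq_Q_iff by blast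
    then show False by (rule few)
  qed
  ultimately show thesis using that b card by blast
qed

text \<open>The values of \<open>y\<close> at the \<open>m\<close> places over \<open>b\<close> are distinct \<open>m\<close>-th roots of \<open>f(b)\<close>; their quotients
  are the \<open>m\<close>-th roots of unity.\<close>

lemma roots_of_unity_of_split_point:
  assumes m0: "of_nat m \<noteq> (0 :: 'k)" and b: "b \<notin> a ` {1..n}"
    and card: "card {P \<in> places \<iota> UNIV. x - \<iota> b \<in> P} = m"
    and rational: "\<And>P. P \<in> places \<iota> UNIV \<Longrightarrow> x - \<iota> b \<in> P \<Longrightarrow> place_degree \<iota> UNIV P = 1"
  shows "P \<in> places \<iota> UNIV \<Longrightarrow> x - \<iota> b \<in> P \<Longrightarrow> place_val P (x - \<iota> b) = 1"
    and "\<exists>Z :: 'k set. card Z = m \<and> (\<forall>\<zeta>\<in>Z. \<zeta> ^ m = 1)"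
proof -
  let ?S = "{P \<in> places \<iota> UNIV. x - \<iota> b \<in> P}"
  have "\<exists>c. c \<noteq> 0 \<and> y - \<iota> c \<in> P" if "P \<in> ?S" for P
  proof -
    have P: "P \<in> places \<iota> UNIV" "x - \<iota> b \<in> P" using \<open>P \<in> ?S\<close> by auto
    interpret P: function_field_place \<iota> x m "\<lambda>j. y ^ j" P
      by (rule places_function_field_place[OF P(1)])
    have y: "y \<in> P.\<O>" "y \<notin> P"
      using unramified_place(2)[OF P(1) not_Q_of_unramified[OF P b]] by auto
    obtain c where c: "y - \<iota> c \<in> P" using P.residue_exists[OF rational[OF P] y(1)] by blast
    then have "c \<noteq> 0" using y(2) by auto
    then show ?thesis using c by blast
  qed
  then obtain c where c: "\<And>P. P \<in> ?S \<Longrightarrow> c P \<noteq> 0 \<and> y - \<iota> (c P) \<in> P" by metis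
  show "place_val P (x - \<iota> b) = 1" if "P \<in> places \<iota> UNIV" "x - \<iota> b \<in> P" for P
    using place_at_unramified_point(1)[OF m0, of "c P" P b] c[of P] that by blast
  have inj: "inj_on c ?S"
  proof (rule inj_onI)
    fix P P' assume PP': "P \<in> ?S" "P' \<in> ?S" "c P = c P'"
    then show "P = P'"
      using place_at_unramified_point(3)[OF m0, of "c P'" P' b P] c[of P] c[of P'] by auto
  qed
  have "?S \<noteq> {}" using card m by (metis card.empty not_numeral_le_zero)
  then obtain P1 where P1: "P1 \<in> ?S" by blast
  have pow: "c P ^ m = poly f b" if "P \<in> ?S" for P
    using place_at_unramified_point(2)[OF m0, of "c P" P b] c[OF that] that by simp
  define Z where "Z = (\<lambda>P. c P / c P1) ` ?S"
  have "inj_on (\<lambda>P. c P / c P1) ?S"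
    using inj c[OF P1] by (auto simp: inj_on_def)
  then have "card Z = m" unfolding Z_def by (simp add: card_image card)
  moreover have "\<zeta> ^ m = 1" if "\<zeta> \<in> Z" for \<zeta>
    using that pow pow[OF P1] c[OF P1] by (auto simp: Z_def power_divide)
  ultimately show "\<exists>Z :: 'k set. card Z = m \<and> (\<forall>\<zeta>\<in>Z. \<zeta> ^ m = 1)" by blast
qed

end

section \<open>Linear codes\<close>

lemma dim_le_dim_image:
  fixes s1 :: "'k::field \<Rightarrow> 'a::ab_group_add \<Rightarrow> 'a" and s2 :: "'k \<Rightarrow> 'b::ab_group_add \<Rightarrow> 'b"
  assumes s1: "vector_space s1" and s2: "vector_space s2" and V: "module.subspace s1 V"
    and add: "\<And>u v. u \<in> V \<Longrightarrow> v \<in> V \<Longrightarrow> \<phi> (u + v) = \<phi> u + \<phi> v"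
    and scale: "\<And>c u. u \<in> V \<Longrightarrow> \<phi> (s1 c u) = s2 c (\<phi> u)"
    and inj: "inj_on \<phi> V" and T: "finite T" "\<phi> ` V \<subseteq> module.span s2 T"
    and pos: "vector_space.dim s1 V > 0"
  shows "vector_space.dim s1 V \<le> vector_space.dim s2 (\<phi> ` V)"
proof -
  interpret A: vector_space s1 by (rule s1)
  interpret B: vector_space s2 by (rule s2)
  note V_closed = A.subspace_0[OF V] A.subspace_add[OF V] A.subspace_scale[OF V]
  have zero: "\<phi> 0 = 0" using scale[OF V_closed(1), of 0] by simp
  have sum: "\<phi> (\<Sum>v\<in>I. s1 (c v) v) = (\<Sum>v\<in>I. s2 (c v) (\<phi> v))" if "finite I" "I \<subseteq> V" for I c
    using that
  proof (induction I rule: finite_induct)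
    case (insert v I)
    then have "(\<Sum>v\<in>I. s1 (c v) v) \<in> V" by (intro A.subspace_sum[OF V] V_closed(3)) blast
    then show ?case using insert by (simp add: add V_closed(3) scale)
  qed (simp add: zero)
  obtain X where X: "X \<subseteq> V" "A.independent X" "V \<subseteq> A.span X" "card X = A.dim V"
    by (rule A.basis_exists)
  have fin: "finite X" using X(4) pos by (metis card.infinite less_irrefl)
  have inj_X: "inj_on \<phi> X" using inj X(1) by (rule inj_on_subset)
  have "B.independent (\<phi> ` X)"
  proof (rule B.independent_if_scalars_zero)
    fix c w assume c: "(\<Sum>w\<in>\<phi> ` X. s2 (c w) w) = 0" and w: "w \<in> \<phi> ` X"
    obtain v where v: "v \<in> X" "w = \<phi> v" using w by blast
    have "\<phi> (\<Sum>v\<in>X. s1 (c (\<phi> v)) v) = \<phi> 0"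
      using c by (simp add: sum[OF fin X(1)] sum.reindex[OF inj_X] zero)
    moreover have "(\<Sum>v\<in>X. s1 (c (\<phi> v)) v) \<in> V"
      using X(1) by (intro A.subspace_sum[OF V] V_closed(3)) blast
    ultimately have "(\<Sum>v\<in>X. s1 (c (\<phi> v)) v) = 0"
      using inj V_closed(1) by (meson inj_onD)
    then show "c w = 0" using A.independentD[OF X(2) fin subset_refl, where u = "\<lambda>v. c (\<phi> v)"] v by blast
  qed (simp add: fin)
  moreover obtain Y where Y: "Y \<subseteq> \<phi> ` V" "B.independent Y" "\<phi> ` V \<subseteq> B.span Y"
    "card Y = B.dim (\<phi> ` V)" by (rule B.basis_exists)
  moreover have "finite Y" using B.independent_span_bound[OF T(1) Y(2)] Y(1) T(2) by blast
  moreover have "\<phi> ` X \<subseteq> B.span Y" using X(1) Y(3) by blast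
  ultimately have "card (\<phi> ` X) \<le> B.dim (\<phi> ` V)" using B.independent_span_bound by metis
  then show ?thesis using card_image[OF inj_X] X(4) by simp
qed

definition unit_word :: "nat \<Rightarrow> nat \<Rightarrow> 'k::field" where
  "unit_word i = (\<lambda>j. if j = i then 1 else 0)"

interpretation word: vector_space word_scale
  by (rule vector_space_word_scale)

lemma words_subset_span: "words M \<subseteq> word.span (unit_word ` {1..M})"
proof
  fix v :: "nat \<Rightarrow> 'k::field" assume v: "v \<in> words M"
  have "v = (\<Sum>i=1..M. word_scale (v i) (unit_word i))"
  proof
    fix j
    have "(\<Sum>i\<in>I. word_scale (v i) (unit_word i)) j = (\<Sum>i\<in>I. if i = j then v i else 0)" for I
      by (induction I rule: infinite_finite_induct) (simp_all add: word_scale_def unit_word_def)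
    then show "v j = (\<Sum>i=1..M. word_scale (v i) (unit_word i)) j"
      using v by (simp add: words_def)
  qed
  also have "\<dots> \<in> word.span (unit_word ` {1..M})"
    by (intro word.span_sum word.span_scale word.span_base) auto
  finally show "v \<in> word.span (unit_word ` {1..M})" .
qed

lemma card_independent_words:
  assumes "word.independent B" "B \<subseteq> words M" shows "finite B \<and> card B \<le> M"
proof -
  have "finite B \<and> card B \<le> card (unit_word ` {1..M} :: (nat \<Rightarrow> 'a) set)"
    using assms words_subset_span by (intro word.independent_span_bound) auto
  moreover have "card (unit_word ` {1..M} :: (nat \<Rightarrow> 'a) set) \<le> M"
    using card_image_le[of "{1..M}" unit_word] by simp
  ultimately show ?thesis by linarith
qed

lemma independent_union_of_trivial_intersection:
  assumes B: "finite B1" "finite B2" "word.independent B1" "word.independent B2"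
    and trivial: "word.span B1 \<inter> word.span B2 = {0}"
  shows "word.independent (B1 \<union> B2)" and "B1 \<inter> B2 = {}"
proof -
  show disj: "B1 \<inter> B2 = {}"
  proof (rule ccontr)
    assume "B1 \<inter> B2 \<noteq> {}"
    then obtain v where v: "v \<in> B1" "v \<in> B2" by blast
    then have "v = 0" using trivial word.span_base by blast
    then show False using v(1) B(3) word.dependent_zero by blast
  qed
  show "word.independent (B1 \<union> B2)"
  proof (rule word.independent_if_scalars_zero)
    fix c v assume sum: "(\<Sum>v\<in>B1 \<union> B2. word_scale (c v) v) = 0" and v: "v \<in> B1 \<union> B2"
    let ?u1 = "\<Sum>v\<in>B1. word_scale (c v) v" and ?u2 = "\<Sum>v\<in>B2. word_scale (c v) v"
    have "?u1 + ?u2 = 0" using sum B disj by (simp add: sum.union_disjoint)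
    then have "?u1 = - ?u2" unfolding eq_neg_iff_add_eq_0 .
    moreover have "?u1 \<in> word.span B1"
      by (intro word.span_sum word.span_scale word.span_base)
    moreover have u2: "?u2 \<in> word.span B2"
      by (intro word.span_sum word.span_scale word.span_base)
    ultimately have "?u1 \<in> word.span B1 \<inter> word.span B2" using word.span_neg[OF u2] by simp
    then have "?u1 = 0" unfolding trivial by blast
    moreover from this have "?u2 = 0" using \<open>?u1 + ?u2 = 0\<close> by simp
    ultimately have "?u1 = 0" "?u2 = 0" by blast+
    then show "c v = 0"
      using v word.independentD[OF B(3,1) subset_refl, where u = c]
        word.independentD[OF B(4,2) subset_refl, where u = c] by blast
  qed (simp add: B)
qed

text \<open>Bases of the two codes form together an independent set of words, which has at most \<open>M\<close> elements
  and, if it has \<open>M\<close> elements, spans.\<close>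

lemma LCP_of_trivial_intersection:
  fixes C1 C2 :: "(nat \<Rightarrow> 'k::field) set"
  assumes C1: "linear_code M C1" and C2: "linear_code M C2" and trivial: "C1 \<inter> C2 = {0}"
    and dim: "M \<le> word.dim C1 + word.dim C2"
  shows "LCP M C1 C2" and "word.dim C1 + word.dim C2 = M"
proof -
  have sub: "word.subspace C1" "word.subspace C2" "C1 \<subseteq> words M" "C2 \<subseteq> words M"
    using C1 C2 by (auto simp: linear_code_def)
  obtain B1 where B1: "B1 \<subseteq> C1" "word.independent B1" "C1 \<subseteq> word.span B1" "card B1 = word.dim C1"
    by (rule word.basis_exists)
  obtain B2 where B2: "B2 \<subseteq> C2" "word.independent B2" "C2 \<subseteq> word.span B2" "card B2 = word.dim C2"
    by (rule word.basis_exists)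
  have fin: "finite B1" "finite B2"
    using card_independent_words[OF B1(2), of M] card_independent_words[OF B2(2), of M]
      B1(1) B2(1) sub by blast+
  have span: "word.span B1 = C1" "word.span B2 = C2"
    using word.span_minimal[OF B1(1) sub(1)] word.span_minimal[OF B2(1) sub(2)] B1(3) B2(3) by auto
  note indep = independent_union_of_trivial_intersection[OF fin B1(2) B2(2), unfolded span, OF trivial]
  have card: "card (B1 \<union> B2) = word.dim C1 + word.dim C2"
    using indep(2) fin B1(4) B2(4) by (simp add: card_Un_disjoint)
  have words: "B1 \<union> B2 \<subseteq> words M" using B1(1) B2(1) sub by blast
  show dim_eq: "word.dim C1 + word.dim C2 = M"
    using card_independent_words[OF indep(1) words] card dim by simp
  have "words M \<subseteq> word.span (B1 \<union> B2)"
  proof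
    fix v :: "nat \<Rightarrow> 'k" assume v: "v \<in> words M"
    show "v \<in> word.span (B1 \<union> B2)"
    proof (rule ccontr)
      assume no: "v \<notin> word.span (B1 \<union> B2)"
      then have "v \<notin> B1 \<union> B2" using word.span_base by blast
      moreover have "card (insert v (B1 \<union> B2)) \<le> M"
        using card_independent_words[OF word.independent_insertI[OF no indep(1)]] v words by blast
      ultimately show False using card dim_eq fin by simp
    qed
  qed
  moreover have "word.subspace (words M :: (nat \<Rightarrow> 'k) set)"
    by (auto simp: word.subspace_def words_def word_scale_def)
  then have "word.span (B1 \<union> B2) \<subseteq> words M" by (rule word.span_minimal[OF words])
  ultimately have "word.span (B1 \<union> B2) = words M" by blast
  then have "{u + v | u v. u \<in> C1 \<and> v \<in> C2} = words M"
    by (simp add: word.span_Un span)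
  then show "LCP M C1 C2" using C1 C2 trivial by (simp add: LCP_def)
qed


section \<open>Algebraic geometry codes\<close>

definition eval_word :: "('k::field \<Rightarrow> 'f::field) \<Rightarrow> nat \<Rightarrow> (nat \<Rightarrow> 'f set) \<Rightarrow> 'f \<Rightarrow> nat \<Rightarrow> 'k" where
  "eval_word \<iota> M S z = (\<lambda>i. if i \<in> {1..M} then eval_at \<iota> (S i) z else 0)"

lemma ag_code_eq: "ag_code \<iota> M S A = eval_word \<iota> M S ` riemann_roch_space \<iota> A"
  unfolding ag_code_def eval_word_def by blast

lemma (in place) eval_at_eqI: "z - \<iota> c \<in> P \<Longrightarrow> eval_at \<iota> P z = c"
  unfolding eval_at_def by (rule the_equality) (use residue_unique in blast)+

lemma (in place) eval_at:
  assumes "place_degree \<iota> L P = 1" "z \<in> \<O>" shows "z - \<iota> (eval_at \<iota> P z) \<in> P"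
  using residue_exists[OF assms] eval_at_eqI by metis

context function_field
begin

lemma eval_at_linear:
  assumes P: "P \<in> places \<iota> UNIV" "place_degree \<iota> UNIV P = 1"
    and u: "order_ge P u 0" and v: "order_ge P v 0"
  shows "eval_at \<iota> P (u + v) = eval_at \<iota> P u + eval_at \<iota> P v"
    and "eval_at \<iota> P (\<iota> c * u) = c * eval_at \<iota> P u"
    and "eval_at \<iota> P u = eval_at \<iota> P v \<Longrightarrow> u - v \<in> P"
proof -
  interpret P: function_field_place \<iota> x d b P
    by unfold_locales (simp_all add: subfield_UNIV P)
  have uv: "u - \<iota> (eval_at \<iota> P u) \<in> P" "v - \<iota> (eval_at \<iota> P v) \<in> P"
    using u v P.eval_at[OF P(2)] by (simp_all add: P.order_ge_0_iff)
  have "u + v - \<iota> (eval_at \<iota> P u + eval_at \<iota> P v)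
      = (u - \<iota> (eval_at \<iota> P u)) + (v - \<iota> (eval_at \<iota> P v))" by (simp add: \<iota>_add)
  then show "eval_at \<iota> P (u + v) = eval_at \<iota> P u + eval_at \<iota> P v"
    using P.P_add[OF uv] by (intro P.eval_at_eqI) (simp only:)
  have "\<iota> c * u - \<iota> (c * eval_at \<iota> P u) = \<iota> c * (u - \<iota> (eval_at \<iota> P u))"
    by (simp add: \<iota>_mult right_diff_distrib)
  then show "eval_at \<iota> P (\<iota> c * u) = c * eval_at \<iota> P u"
    using P.P_mult[OF P.\<iota>_in_\<O> uv(1), of c] by (intro P.eval_at_eqI) (simp only:)
  assume "eval_at \<iota> P u = eval_at \<iota> P v"
  then show "u - v \<in> P" using P.P_diff[OF uv] by simp
qed

lemma eval_word_eq_imp: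
  assumes S: "\<And>i. i \<in> {1..M} \<Longrightarrow> S i \<in> places \<iota> UNIV \<and> place_degree \<iota> UNIV (S i) = 1"
    and u: "\<And>i. i \<in> {1..M} \<Longrightarrow> order_ge (S i) u 0" and v: "\<And>i. i \<in> {1..M} \<Longrightarrow> order_ge (S i) v 0"
    and eq: "eval_word \<iota> M S u = eval_word \<iota> M S v" and i: "i \<in> {1..M}"
  shows "u - v \<in> S i"
  using eval_at_linear(3)[of "S i" u v] S[OF i] u[OF i] v[OF i] fun_cong[OF eq, of i] i
  by (simp add: eval_word_def)

text \<open>The dimension is bounded from below only; equality will come from a complementary code.\<close>

lemma ag_code_linear:
  fixes A :: "'f divisor"
  assumes S: "\<And>i. i \<in> {1..M} \<Longrightarrow> S i \<in> places \<iota> UNIV \<and> place_degree \<iota> UNIV (S i) = 1"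
    and A: "\<And>i. i \<in> {1..M} \<Longrightarrow> Poly_Mapping.lookup A (S i) \<le> 0"
  shows "linear_code M (ag_code \<iota> M S A)"
    and "z \<in> riemann_roch_space \<iota> A \<Longrightarrow> i \<in> {1..M} \<Longrightarrow> order_ge (S i) z 0"
    and "inj_on (eval_word \<iota> M S) (riemann_roch_space \<iota> A) \<Longrightarrow> ell \<iota> A > 0
           \<Longrightarrow> ell \<iota> A \<le> word.dim (ag_code \<iota> M S A)"
proof -
  let ?V = "riemann_roch_space \<iota> A" and ?\<phi> = "eval_word \<iota> M S"
  interpret K: vector_space "\<lambda>c z. \<iota> c * z" by (rule vector_space_\<iota>)
  note V = subspace_riemann_roch_space[of A]
  show ord: "order_ge (S i) z 0" if "z \<in> ?V" "i \<in> {1..M}" for z i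
    using that S[OF that(2)] A[OF that(2)] order_ge_mono[of "S i" z _ 0]
    by (auto simp: riemann_roch_space_iff)
  have add: "?\<phi> (u + v) = ?\<phi> u + ?\<phi> v" if "u \<in> ?V" "v \<in> ?V" for u v
    using eval_at_linear(1)[of "S _" u v] S ord that by (auto simp: eval_word_def fun_eq_iff)
  have scale: "?\<phi> (\<iota> c * u) = word_scale c (?\<phi> u)" if "u \<in> ?V" for u c
    using eval_at_linear(2)[of "S _" u u c] S ord that
    by (auto simp: eval_word_def word_scale_def fun_eq_iff)
  have words: "?\<phi> ` ?V \<subseteq> words M" by (auto simp: eval_word_def words_def)
  have "word.subspace (?\<phi> ` ?V)"
    unfolding word.subspace_def
  proof (intro conjI ballI allI)
    have "?\<phi> (\<iota> 0 * 0) = word_scale 0 (?\<phi> 0)" by (rule scale[OF K.subspace_0[OF V]])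
    then have "?\<phi> 0 = 0" by simp
    then show "0 \<in> ?\<phi> ` ?V" using K.subspace_0[OF V] by (metis imageI)
    fix v c assume "v \<in> ?\<phi> ` ?V"
    then obtain v' where v': "v' \<in> ?V" "v = ?\<phi> v'" by blast
    then show "word_scale c v \<in> ?\<phi> ` ?V"
      using scale[OF v'(1), of c] K.subspace_scale[OF V v'(1), of c] by (metis imageI)
    fix u assume "u \<in> ?\<phi> ` ?V"
    then obtain u' where u': "u' \<in> ?V" "u = ?\<phi> u'" by blast
    show "v + u \<in> ?\<phi> ` ?V"
      using add[OF v'(1) u'(1)] K.subspace_add[OF V v'(1) u'(1)] u'(2) v'(2) by (metis imageI)
  qed
  then show "linear_code M (ag_code \<iota> M S A)"
    using words by (simp add: linear_code_def ag_code_eq)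
  assume "inj_on ?\<phi> ?V" "ell \<iota> A > 0"
  then show "ell \<iota> A \<le> word.dim (ag_code \<iota> M S A)"
    unfolding ag_code_eq ell_def
    using words words_subset_span
    by (intro dim_le_dim_image[where T = "unit_word ` {1..M}", OF vector_space_\<iota>
          vector_space_word_scale V add scale]) auto
qed

end

section \<open>The divisors and the complementary pair\<close>

lemma lookup_sum_single:
  fixes c :: "nat \<Rightarrow> int"
  assumes "inj_on Q I" "finite I"
  shows "k \<in> I \<Longrightarrow> Poly_Mapping.lookup (\<Sum>k\<in>I. Poly_Mapping.single (Q k) (c k)) (Q k) = c k"
    and "P \<notin> Q ` I \<Longrightarrow> Poly_Mapping.lookup (\<Sum>k\<in>I. Poly_Mapping.single (Q k) (c k)) P = 0"
proof -
  have eq: "Poly_Mapping.lookup (\<Sum>k\<in>I. Poly_Mapping.single (Q k) (c k)) P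
      = (\<Sum>k\<in>I. if Q k = P then c k else 0)" for P
    by (simp add: lookup_sum lookup_single when_def)
  show "k \<in> I \<Longrightarrow> Poly_Mapping.lookup (\<Sum>k\<in>I. Poly_Mapping.single (Q k) (c k)) (Q k) = c k"
  proof -
    assume k: "k \<in> I"
    have "(\<Sum>l\<in>I. if Q l = Q k then c l else 0) = (\<Sum>l\<in>I. if l = k then c l else 0)"
      using k assms(1) by (intro sum.cong) (auto dest: inj_onD)
    then show ?thesis unfolding eq using k assms(2) by simp
  qed
  show "P \<notin> Q ` I \<Longrightarrow> Poly_Mapping.lookup (\<Sum>k\<in>I. Poly_Mapping.single (Q k) (c k)) P = 0"
    unfolding eq by (intro sum.neutral) auto
qed

lemma divisor_degree_superset:
  assumes "finite X" "Poly_Mapping.keys A \<subseteq> X"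
  shows "divisor_degree \<iota> A = (\<Sum>P\<in>X. Poly_Mapping.lookup A P * int (place_degree \<iota> UNIV P))"
  unfolding divisor_degree_def using assms
  by (intro sum.mono_neutral_left) (auto simp: in_keys_iff)

context kummer_curve
begin

lemma place_val_x_minus_Q_0: "place_val (Q 0) (x - \<iota> b) = - int m"
proof -
  interpret P: function_field_place \<iota> x m "\<lambda>j. y ^ j" "Q 0"
    using places_function_field_place Q_place by simp
  have "1 + - (\<iota> b * inverse x) \<in> P.\<O> - Q 0"
    by (rule P.unit_add) (simp_all add: P.\<O>_closed(1) P.P_minus P.P_mult inverse_x_in_Q_0)
  moreover from this have "1 + - (\<iota> b * inverse x) \<noteq> 0" using P.zero_in_P by force
  moreover have "x - \<iota> b = x * (1 + - (\<iota> b * inverse x))"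
    using x_nonzero by (simp add: field_simps)
  ultimately show ?thesis
    using P.place_val_mult[OF x_nonzero] P.place_val_unit
      place_at_infinity(1)[OF Q_place inverse_x_in_Q_0] by simp
qed

text \<open>The divisor of \<open>w = y\<^sup>s / \<Prod>\<^sub>i (x - \<beta>\<^sub>i)\<close> is \<open>s (Q\<^sub>1 + \<dots> + Q\<^sub>n) + (m |I| - s n) Q\<^sub>0\<close> minus the sum
  of all places over the points \<open>\<beta>\<^sub>i\<close>.\<close>

lemma multiplication_into_riemann_roch_space:
  fixes \<beta> :: "nat \<Rightarrow> 'k" and I :: "nat set" and s :: int and B E :: "'f divisor"
  defines "w \<equiv> y powi s / (\<Prod>i\<in>I. x - \<iota> (\<beta> i))"
  assumes E: "Poly_Mapping.keys E \<subseteq> Q ` {0..n}"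
    and I: "finite I" "inj_on \<beta> I" "\<And>i. i \<in> I \<Longrightarrow> \<beta> i \<notin> a ` {1..n}"
    and val: "\<And>i P. i \<in> I \<Longrightarrow> P \<in> places \<iota> UNIV \<Longrightarrow> x - \<iota> (\<beta> i) \<in> P
                \<Longrightarrow> place_val P (x - \<iota> (\<beta> i)) = 1"
    and B_finite: "\<And>k. k \<in> {1..n} \<Longrightarrow>
                     Poly_Mapping.lookup B (Q k) \<le> s + Poly_Mapping.lookup E (Q k)"
    and B_infinite: "Poly_Mapping.lookup B (Q 0)
                       \<le> int m * int (card I) + Poly_Mapping.lookup E (Q 0) - s * int n"
    and B_other: "\<And>P. P \<notin> Q ` {0..n} \<Longrightarrow> Poly_Mapping.lookup B P \<le> 0"
    and u: "u \<in> riemann_roch_space \<iota> B"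
    and vanish: "\<And>i P. i \<in> I \<Longrightarrow> P \<in> places \<iota> UNIV \<Longrightarrow> x - \<iota> (\<beta> i) \<in> P \<Longrightarrow> u \<in> P"
  shows "u * w \<in> riemann_roch_space \<iota> E" and "w \<noteq> 0"
    and "R \<in> places \<iota> UNIV \<Longrightarrow> R \<notin> Q ` {0..n} \<Longrightarrow> (\<And>i. i \<in> I \<Longrightarrow> x - \<iota> (\<beta> i) \<notin> R) \<Longrightarrow> u \<in> R
           \<Longrightarrow> u * w \<in> R"
proof -
  have prod0: "(\<Prod>i\<in>I. x - \<iota> (\<beta> i)) \<noteq> 0" using x_minus_nonzero I(1) by simp
  have y0: "y powi s \<noteq> 0" using y_nonzero by simp
  show w0: "w \<noteq> 0" using prod0 y0 by (simp add: w_def)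
  have val_w: "place_val P w = s * place_val P y - (\<Sum>i\<in>I. place_val P (x - \<iota> (\<beta> i)))"
    if P: "P \<in> places \<iota> UNIV" for P
  proof -
    interpret P: function_field_place \<iota> x m "\<lambda>j. y ^ j" P
      by (rule places_function_field_place[OF P])
    have "place_val P (\<Prod>i\<in>I. x - \<iota> (\<beta> i)) = (\<Sum>i\<in>I. place_val P (x - \<iota> (\<beta> i)))"
      by (rule P.place_val_prod) (rule x_minus_nonzero)
    then show ?thesis
      unfolding w_def P.place_val_divide[OF y0 prod0] P.place_val_power_int[OF y_nonzero] by simp
  qed
  have val_le_0: "place_val P (x - \<iota> b) \<le> 0" if P: "P \<in> places \<iota> UNIV" "x - \<iota> b \<notin> P" for P b
  proof -
    interpret P: function_field_place \<iota> x m "\<lambda>j. y ^ j" P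
      by (rule places_function_field_place[OF P(1)])
    show ?thesis using P.place_val_pos_iff[OF x_minus_nonzero, of b] P(2) by simp
  qed
  have sum_le_0: "(\<Sum>i\<in>I. place_val P (x - \<iota> (\<beta> i))) \<le> 0"
    if P: "P \<in> places \<iota> UNIV" "\<And>i. i \<in> I \<Longrightarrow> x - \<iota> (\<beta> i) \<notin> P" for P
    by (intro sum_nonpos val_le_0 P)
  have order_uw: "order_ge P (u * w) l" if "P \<in> places \<iota> UNIV" "order_ge P u k" "l \<le> k + place_val P w"
    for P k l
  proof -
    interpret P: function_field_place \<iota> x m "\<lambda>j. y ^ j" P
      by (rule places_function_field_place[OF that(1)])
    have "order_ge P w (place_val P w)" by (simp add: order_ge_def)
    then show ?thesis using P.order_ge_mult[OF that(2)] order_ge_mono that(3) by blast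
  qed
  show "u * w \<in> R" if R: "R \<in> places \<iota> UNIV" "R \<notin> Q ` {0..n}"
    "\<And>i. i \<in> I \<Longrightarrow> x - \<iota> (\<beta> i) \<notin> R" "u \<in> R"
  proof -
    interpret R: function_field_place \<iota> x m "\<lambda>j. y ^ j" R
      by (rule places_function_field_place[OF R(1)])
    have "order_ge R u 1" using R(4) by (simp add: R.order_ge_1_iff)
    moreover have "place_val R w \<ge> 0"
      using val_w[OF R(1)] unramified_place(3)[OF R(1,2)] sum_le_0[OF R(1,3)] by simp
    ultimately have "order_ge R (u * w) 1" by (intro order_uw[OF R(1), of 1]) simp_all
    then show ?thesis by (simp add: R.order_ge_1_iff)
  qed
  show "u * w \<in> riemann_roch_space \<iota> E"
    unfolding riemann_roch_space_iff
  proof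
    fix P assume P: "P \<in> places \<iota> UNIV"
    interpret P: function_field_place \<iota> x m "\<lambda>j. y ^ j" P
      by (rule places_function_field_place[OF P])
    have ord_u: "order_ge P u (- Poly_Mapping.lookup B P)"
      using u P by (simp add: riemann_roch_space_iff)
    have not_Q: "P \<notin> Q ` {0..n}" if "i \<in> I" "x - \<iota> (\<beta> i) \<in> P" for i
      by (rule not_Q_of_unramified[OF P that(2) I(3)[OF that(1)]])
    consider "P = Q 0" | k where "k \<in> {1..n}" "P = Q k" | "P \<notin> Q ` {0..n}"
    proof (cases "P \<in> Q ` {0..n}")
      case True
      then obtain k where "k \<le> n" "P = Q k" by auto
      then show thesis using that(1) that(2)[of k] by (cases "k = 0") auto
    qed (rule that(3))
    then show "order_ge P (u * w) (- Poly_Mapping.lookup E P)"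
    proof cases
      case 1
      have "place_val P w = int m * int (card I) - s * int n"
        using val_w[OF P] unfolding 1 place_val_x_minus_Q_0 place_val_y_Q(1) by simp
      then show ?thesis
        using B_infinite unfolding 1 by (intro order_uw[OF P ord_u, unfolded 1]) linarith
    next
      case (2 k)
      have "P \<in> Q ` {0..n}" unfolding 2(2) using 2(1) by (intro imageI) simp
      then have "x - \<iota> (\<beta> i) \<notin> P" if "i \<in> I" for i using not_Q[OF that] by blast
      then have "(\<Sum>i\<in>I. place_val P (x - \<iota> (\<beta> i))) \<le> 0" by (rule sum_le_0[OF P])
      moreover have "place_val P y = 1" unfolding 2(2) by (rule place_val_y_Q(2)[OF 2(1)])
      ultimately have "place_val P w \<ge> s" using val_w[OF P] by simp
      then show ?thesis
        using B_finite[OF 2(1)] unfolding 2(2)[symmetric] by (intro order_uw[OF P ord_u]) linarith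
    next
      case 3
      then have E0: "Poly_Mapping.lookup E P = 0" using E by (meson in_keys_iff subsetD)
      have w: "place_val P w = - (\<Sum>i\<in>I. place_val P (x - \<iota> (\<beta> i)))"
        using val_w[OF P] unramified_place(3)[OF P 3] by simp
      show ?thesis
      proof (cases "\<exists>i\<in>I. x - \<iota> (\<beta> i) \<in> P")
        case False
        then have "place_val P w \<ge> 0" using w sum_le_0[OF P] by simp
        then show ?thesis using B_other[OF 3] by (intro order_uw[OF P ord_u]) (simp add: E0)
      next
        case True
        then obtain i where i: "i \<in> I" "x - \<iota> (\<beta> i) \<in> P" by blast
        have "x - \<iota> (\<beta> j) \<notin> P" if "j \<in> I - {i}" for j
          using P.residue_unique[OF i(2), of "\<beta> j"] I(2) i(1) that by (auto dest: inj_onD)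
        then have "(\<Sum>j\<in>I - {i}. place_val P (x - \<iota> (\<beta> j))) \<le> 0"
          by (intro sum_nonpos val_le_0 P)
        then have "place_val P w \<ge> - 1"
          using w val[OF i(1) P i(2)] sum.remove[OF I(1) i(1), of "\<lambda>j. place_val P (x - \<iota> (\<beta> j))"]
          by simp
        moreover have "order_ge P u 1" using vanish[OF i(1) P i(2)] by (simp add: P.order_ge_1_iff)
        ultimately show ?thesis by (intro order_uw[OF P, of 1]) (simp_all add: E0)
      qed
    qed
  qed
qed

text \<open>Each \<open>P i\<close> has \<open>m\<close> places above it, so there are at most \<open>m t\<close> places above all of them: if \<open>m t\<close>
  of these are rational, then all of them are.\<close>

lemma split_points:
  fixes P :: "nat \<Rightarrow> 'f set"
  assumes inj_P: "inj_on P {1..t}"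
    and split: "\<And>i. i \<in> {1..t} \<Longrightarrow> P i \<in> rational_places \<iota> (adjoin \<iota> {x})
                  \<and> splits_completely \<iota> (adjoin \<iota> {x}) (P i)"
    and card: "card (rational_places \<iota> UNIV \<inter> (\<Union>i\<in>{1..t}. places_over \<iota> (P i))) = m * t"
  obtains \<beta> where "inj_on \<beta> {1..t}" "\<And>i. i \<in> {1..t} \<Longrightarrow> \<beta> i \<notin> a ` {1..n}"
    "\<And>i. i \<in> {1..t} \<Longrightarrow> places_over \<iota> (P i) = {R \<in> places \<iota> UNIV. x - \<iota> (\<beta> i) \<in> R}"
    "\<And>i. i \<in> {1..t} \<Longrightarrow> card (places_over \<iota> (P i)) = m"
    "(\<Union>i\<in>{1..t}. places_over \<iota> (P i)) \<subseteq> rational_places \<iota> UNIV"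
proof -
  have "\<exists>b. x - \<iota> b \<in> P i \<and> b \<notin> a ` {1..n} \<and> places_over \<iota> (P i) = {R \<in> places \<iota> UNIV. x - \<iota> b \<in> R}
      \<and> card (places_over \<iota> (P i)) = m" if "i \<in> {1..t}" for i
  proof -
    have P: "P i \<in> rational_places \<iota> (adjoin \<iota> {x})" "splits_completely \<iota> (adjoin \<iota> {x}) (P i)"
      using split[OF that] by simp_all
    obtain b where "x - \<iota> b \<in> P i" "b \<notin> a ` {1..n}"
      "places_over \<iota> (P i) = {R \<in> places \<iota> UNIV. x - \<iota> b \<in> R}" "card (places_over \<iota> (P i)) = m"
      by (rule split_place[OF P])
    then show ?thesis by (intro exI[of _ b] conjI)
  qed
  then have "\<exists>\<beta>. \<forall>i\<in>{1..t}. x - \<iota> (\<beta> i) \<in> P i \<and> \<beta> i \<notin> a ` {1..n}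
      \<and> places_over \<iota> (P i) = {R \<in> places \<iota> UNIV. x - \<iota> (\<beta> i) \<in> R}
      \<and> card (places_over \<iota> (P i)) = m" by (intro bchoice ballI)
  then obtain \<beta> where "\<forall>i\<in>{1..t}. x - \<iota> (\<beta> i) \<in> P i \<and> \<beta> i \<notin> a ` {1..n}
      \<and> places_over \<iota> (P i) = {R \<in> places \<iota> UNIV. x - \<iota> (\<beta> i) \<in> R}
      \<and> card (places_over \<iota> (P i)) = m" by (rule exE)
  then have \<beta>: "x - \<iota> (\<beta> i) \<in> P i" "\<beta> i \<notin> a ` {1..n}"
    "places_over \<iota> (P i) = {R \<in> places \<iota> UNIV. x - \<iota> (\<beta> i) \<in> R}" "card (places_over \<iota> (P i)) = m"
    if "i \<in> {1..t}" for i
    using that by blast+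
  have place: "place \<iota> (adjoin \<iota> {x}) (P i)" if "i \<in> {1..t}" for i
    using split[OF that] by unfold_locales (auto simp: subfield_adjoin rational_places_def)
  have "inj_on \<beta> {1..t}"
  proof (rule inj_onI)
    fix i j assume ij: "i \<in> {1..t}" "j \<in> {1..t}" "\<beta> i = \<beta> j"
    have "z \<in> P i \<longleftrightarrow> z \<in> P j" for z
    proof (cases "z \<in> adjoin \<iota> {x}")
      case True
      then show ?thesis
        using rational_function_in_place_iff[OF place[OF ij(1)] _ place[OF ij(2)], of "\<beta> i" z]
          \<beta>(1)[OF ij(1)] \<beta>(1)[OF ij(2)] ij(3) True by simp
    next
      case False
      then show ?thesis
        using place.\<O>_subset_L[OF place place.P_subset_\<O>[OF place], OF ij(1) ij(1), of z]
          place.\<O>_subset_L[OF place place.P_subset_\<O>[OF place], OF ij(2) ij(2), of z] by blast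
    qed
    then have "P i = P j" by blast
    then show "i = j" by (rule inj_onD[OF inj_P _ ij(1,2)])
  qed
  moreover have "(\<Union>i\<in>{1..t}. places_over \<iota> (P i)) \<subseteq> rational_places \<iota> UNIV"
  proof -
    let ?U = "\<Union>i\<in>{1..t}. places_over \<iota> (P i)"
    have "finite (places_over \<iota> (P i))" if "i \<in> {1..t}" for i
      using \<beta>(4)[OF that] m by (intro card_ge_0_finite) simp
    then have fin: "finite ?U" by blast
    have "card ?U \<le> (\<Sum>i\<in>{1..t}. card (places_over \<iota> (P i)))" by (rule card_UN_le) simp
    also have "\<dots> = m * t" using \<beta>(4) by simp
    finally have "rational_places \<iota> UNIV \<inter> ?U = ?U" using card by (intro card_seteq fin) auto
    then show ?thesis by blast
  qed
  ultimately show thesis by (intro that[of \<beta>] \<beta>)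
qed

end

theorem theorem5p5:
  fixes \<iota> :: "'k::{field,finite} \<Rightarrow> 'f::field"
    and m n t N M :: nat
    and a :: "nat \<Rightarrow> 'k"
    and x y :: 'f
    and g s :: int
    and P Q R S :: "nat \<Rightarrow> 'f set"
    and \<alpha> :: "nat \<Rightarrow> int"
    and D E G H :: "'f divisor"
  assumes "m \<ge> 2" "n \<ge> 2" "\<not> CHAR('k) dvd m" "coprime m n"
    and "inj_on a {1..n}"
    and "kummer_function_field \<iota> m n a x y"
    and "has_genus \<iota> g" "g \<ge> 1"
    and "Q 0 \<in> places_over \<iota> (infinite_place \<iota> x)"
    and "\<forall>k\<in>{1..n}. Q k \<in> places_over \<iota> (finite_place \<iota> x (a k))"
    and "t \<ge> 1" "inj_on P {1..t}"
    and "\<forall>i\<in>{1..t}. P i \<in> rational_places \<iota> (adjoin \<iota> {x})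
                  \<and> splits_completely \<iota> (adjoin \<iota> {x}) (P i)"
    and "N = m * t"
    and "bij_betw R {1..N} (rational_places \<iota> UNIV \<inter> (\<Union>i\<in>{1..t}. places_over \<iota> (P i)))"
    and "R ` {1..m} = places_over \<iota> (P 1)"
    and "D = (\<Sum>k=m+1..N. Poly_Mapping.single (R k) 1) + Poly_Mapping.single (R 2) 1"
    and "E = (\<Sum>k=0..n. Poly_Mapping.single (Q k) (\<alpha> k))"
    and "non_special \<iota> g E" "divisor_degree \<iota> E = g"
    and "(real_of_int g - 1) / real n < real_of_int s"
    and "real_of_int s < (real N - real m - real_of_int g + 2) / real n"
    and "G = (\<Sum>k=1..n. Poly_Mapping.single (Q k) (\<alpha> k))
             + Poly_Mapping.single (Q 0) (int N - int m + \<alpha> 0 - s * int n)"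
    and "H = (\<Sum>k=1..n. Poly_Mapping.single (Q k) (s + \<alpha> k))
             + Poly_Mapping.single (Q 0) (\<alpha> 0) - Poly_Mapping.single (R 1) 1"
    and "M = N - m + 1"
    and "inj_on S {1..M}" "D = (\<Sum>i=1..M. Poly_Mapping.single (S i) 1)"
  shows "LCP M (ag_code \<iota> M S G) (ag_code \<iota> M S H)
       \<and> has_parameters (ag_code \<iota> M S G) M (int N - int m + 1 - s * int n)
       \<and> has_parameters (ag_code \<iota> M S H) M (s * int n)"
proof -
  have \<iota>: "field_embedding \<iota>" using assms(6) by (simp add: kummer_function_field_def)
  interpret kummer_curve \<iota> m n a x y Q
    using assms(1,4,5,6,9,10) \<iota> by unfold_locales auto
  let ?lookup = "Poly_Mapping.lookup :: 'f divisor \<Rightarrow> 'f set \<Rightarrow> int"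
  have m0: "of_nat m \<noteq> (0 :: 'k)" using assms(3) by (simp add: of_nat_eq_0_iff_char_dvd)

  \<comment> \<open>The bounds on \<open>s\<close> mean \<open>g \<le> s n \<le> N - m - g + 1\<close>. So both dimensions to be established are
    positive, which excludes the conventional value \<open>0\<close> of an infinite dimension, and
    \<open>N - m - s n \<ge> g - 1 \<ge> 0\<close>, which makes \<open>G - E\<close> effective.\<close>
  have "real_of_int g - 1 < real_of_int s * real n" "real_of_int s * real n < real N - real m - real_of_int g + 2"
    using assms(2,21,22) by (simp_all add: pos_divide_less_eq pos_less_divide_eq)
  then have "real_of_int (g - 1) < real_of_int (s * int n)"
    "real_of_int (s * int n) < real_of_int (int N - int m - g + 2)" by simp_all
  then have sn: "g \<le> s * int n" "s * int n \<le> int N - int m - g + 1"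
    unfolding of_int_less_iff by simp_all
  then have "s * int n > 0" using assms(8) by simp
  then have s0: "s > 0" using assms(2) by (simp add: zero_less_mult_iff)
  have Nm: "int N - int m = int m * int (card {2..t})" "m \<le> N"
  proof -
    obtain t' where "t = Suc t'" using assms(11) by (cases t) auto
    then show "int N - int m = int m * int (card {2..t})" "m \<le> N"
      using assms(14) by (simp_all add: algebra_simps)
  qed

  have R_bij: "inj_on R {1..N}"
    "R ` {1..N} = rational_places \<iota> UNIV \<inter> (\<Union>i\<in>{1..t}. places_over \<iota> (P i))"
    using assms(15) by (auto simp: bij_betw_def)
  have card_R: "card (rational_places \<iota> UNIV \<inter> (\<Union>i\<in>{1..t}. places_over \<iota> (P i))) = m * t"
    using bij_betw_same_card[OF assms(15)] assms(14) by simp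
  have split: "P i \<in> rational_places \<iota> (adjoin \<iota> {x})
      \<and> splits_completely \<iota> (adjoin \<iota> {x}) (P i)" if "i \<in> {1..t}" for i
    using assms(13) that by blast
  obtain \<beta> where inj_\<beta>: "inj_on \<beta> {1..t}" and \<beta>_a: "\<And>i. i \<in> {1..t} \<Longrightarrow> \<beta> i \<notin> a ` {1..n}"
    and over: "\<And>i. i \<in> {1..t} \<Longrightarrow> places_over \<iota> (P i) = {R \<in> places \<iota> UNIV. x - \<iota> (\<beta> i) \<in> R}"
    and card_over: "\<And>i. i \<in> {1..t} \<Longrightarrow> card (places_over \<iota> (P i)) = m"
    and rational: "(\<Union>i\<in>{1..t}. places_over \<iota> (P i)) \<subseteq> rational_places \<iota> UNIV"
    by (rule split_points[OF assms(12) split card_R]; (assumption | (rule that; blast)))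
  have R_all: "R ` {1..N} = (\<Union>i\<in>{1..t}. places_over \<iota> (P i))"
    using R_bij(2) rational by blast
  have degree_1: "place_degree \<iota> UNIV R' = 1"
    if "i \<in> {1..t}" "R' \<in> places \<iota> UNIV" "x - \<iota> (\<beta> i) \<in> R'" for i R'
  proof -
    have "R' \<in> rational_places \<iota> UNIV" using rational over[OF that(1)] that by blast
    then show ?thesis by (simp add: rational_places_def)
  qed
  have card_\<beta>: "card {R \<in> places \<iota> UNIV. x - \<iota> (\<beta> i) \<in> R} = m" if "i \<in> {1..t}" for i
    using card_over[OF that] over[OF that] by simp
  have one: "1 \<in> {1..t}" using assms(11) by simp
  have val_\<beta>: "place_val R' (x - \<iota> (\<beta> i)) = 1"
    if i: "i \<in> {1..t}" and R': "R' \<in> places \<iota> UNIV" "x - \<iota> (\<beta> i) \<in> R'" for i R'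
    by (rule roots_of_unity_of_split_point(1)[OF m0 \<beta>_a[OF i] card_\<beta>[OF i] degree_1[OF i] R'])
  have "\<exists>Z :: 'k set. card Z = m \<and> (\<forall>\<zeta>\<in>Z. \<zeta> ^ m = 1)"
    by (rule roots_of_unity_of_split_point(2)[OF m0 \<beta>_a[OF one] card_\<beta>[OF one] degree_1[OF one]])
  then obtain Z :: "'k set" where Z: "card Z = m" "\<And>\<zeta>. \<zeta> \<in> Z \<Longrightarrow> \<zeta> ^ m = 1" by blast
  have R_place: "R k \<in> places \<iota> UNIV" "place_degree \<iota> UNIV (R k) = 1" if "k \<in> {1..N}" for k
  proof -
    have "R k \<in> R ` {1..N}" using that by (rule imageI)
    then have "R k \<in> rational_places \<iota> UNIV" unfolding R_bij(2) by (rule IntD1)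
    then show "R k \<in> places \<iota> UNIV" "place_degree \<iota> UNIV (R k) = 1"
      by (simp_all add: rational_places_def)
  qed
  have R_not_Q: "R k \<notin> Q ` {0..n}" if "k \<in> {1..N}" for k
  proof -
    have "R k \<in> R ` {1..N}" using that by (rule imageI)
    then obtain i where i: "i \<in> {1..t}" "R k \<in> places_over \<iota> (P i)" unfolding R_all by blast
    then have "x - \<iota> (\<beta> i) \<in> R k" using over[OF i(1)] by blast
    then show ?thesis using not_Q_of_unramified[OF R_place(1)[OF that] _ \<beta>_a[OF i(1)]] by blast
  qed
  have "R 1 \<in> places_over \<iota> (P 1)" "R 2 \<in> places_over \<iota> (P 1)"
    unfolding assms(16)[symmetric] using assms(1) by simp_all
  then have R12: "x - \<iota> (\<beta> 1) \<in> R 1" "x - \<iota> (\<beta> 1) \<in> R 2" "1 \<in> {1..N}" "2 \<in> {1..N}"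
    using over[OF one] assms(1) Nm(2) by simp_all

  \<comment> \<open>The evaluation places are all places over \<open>\<beta>\<^sub>2, \<dots>, \<beta>\<^sub>t\<close>, and one place \<open>R\<^sub>2\<close> over \<open>\<beta>\<^sub>1\<close>.\<close>
  have R2_new: "R 2 \<notin> R ` {m+1..N}"
  proof
    assume "R 2 \<in> R ` {m+1..N}"
    then obtain k where k: "k \<in> {m+1..N}" "R 2 = R k" by blast
    then have "2 = k" using R12(4) by (intro inj_onD[OF R_bij(1)]) auto
    then show False using k(1) assms(1) by simp
  qed
  have inj_R': "inj_on R {m+1..N}" using R_bij(1) by (rule inj_on_subset) auto
  have S_image: "S ` {1..M} = R ` {m+1..N} \<union> {R 2}"
  proof (rule set_eqI)
    fix R'
    have "R' \<in> S ` {1..M} \<longleftrightarrow> ?lookup D R' \<noteq> 0"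
      using lookup_sum_single[OF assms(26), of _ "\<lambda>_. 1"] assms(27) by auto
    also have "\<dots> \<longleftrightarrow> R' \<in> R ` {m+1..N} \<union> {R 2}"
    proof -
      have "?lookup D R' = (if R' \<in> R ` {m+1..N} then 1 else 0) + (if R' = R 2 then 1 else 0)"
        using lookup_sum_single[OF inj_R', of _ "\<lambda>_. 1"]
        by (auto simp: assms(17) lookup_add lookup_single when_def)
      then show ?thesis using R2_new by auto
    qed
    finally show "R' \<in> S ` {1..M} \<longleftrightarrow> R' \<in> R ` {m+1..N} \<union> {R 2}" .
  qed
  have S_R: "\<exists>k\<in>{2..N}. S i = R k" if "i \<in> {1..M}" for i
  proof -
    have "S i \<in> R ` {m+1..N} \<union> {R 2}" unfolding S_image[symmetric] using that by (rule imageI)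
    then consider k where "k \<in> {m+1..N}" "S i = R k" | "S i = R 2" by blast
    then show ?thesis
    proof cases
      case (1 k)
      then show ?thesis using assms(1) by (intro bexI[of _ k]) simp_all
    qed (use R12(4) in \<open>intro bexI[of _ 2]; simp\<close>)
  qed
  have S_place: "S i \<in> places \<iota> UNIV \<and> place_degree \<iota> UNIV (S i) = 1" if i: "i \<in> {1..M}" for i
  proof -
    obtain k where k: "k \<in> {2..N}" "S i = R k" using S_R[OF i] by blast
    then have "k \<in> {1..N}" by simp
    then show ?thesis using R_place k(2) by simp
  qed
  have S_over: "R' \<in> S ` {1..M}"
    if i: "i \<in> {2..t}" and R': "R' \<in> places \<iota> UNIV" "x - \<iota> (\<beta> i) \<in> R'" for i R'
  proof -
    have i': "i \<in> {1..t}" using i by auto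
    have "R' \<in> R ` {1..N}" unfolding R_all using i' over[OF i'] R' by blast
    then obtain k where k: "k \<in> {1..N}" "R' = R k" by blast
    have "k \<notin> {1..m}"
    proof
      assume "k \<in> {1..m}"
      then have "R' \<in> places_over \<iota> (P 1)" using assms(16) k(2) by blast
      then have "x - \<iota> (\<beta> 1) \<in> R'" using over[OF one] by blast
      moreover interpret R': function_field_place \<iota> x m "\<lambda>j. y ^ j" R'
        by (rule places_function_field_place[OF R'(1)])
      have "\<beta> i = \<beta> 1" using R'.residue_unique[OF R'(2)] calculation by blast
      ultimately show False using inj_\<beta> i' one i by (auto dest: inj_onD)
    qed
    then have "k \<in> {m+1..N}" using k(1) by simp
    then show ?thesis unfolding S_image k(2) by blast
  qed

  have inj_Q': "inj_on Q {1..n}" using inj_Q by (rule inj_on_subset) auto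
  have Q0_new: "Q 0 \<notin> Q ` {1..n}" proof
    assume "Q 0 \<in> Q ` {1..n}"
    then obtain k where k: "k \<in> {1..n}" "Q 0 = Q k" by blast
    then have "0 = k" by (intro inj_onD[OF inj_Q]) simp_all
    then show False using k(1) by simp
  qed
  have Q0_Qk: "Q 0 \<noteq> Q k" if "k \<in> {1..n}" for k using Q0_new imageI[OF that, of Q] by metis
  have other: "R' \<notin> Q ` {1..n}" "Q 0 \<noteq> R'" if "R' \<notin> Q ` {0..n}" for R'
  proof -
    have "Q ` {1..n} \<subseteq> Q ` {0..n}" "Q 0 \<in> Q ` {0..n}" by (intro image_mono imageI; simp)+
    then show "R' \<notin> Q ` {1..n}" "Q 0 \<noteq> R'" using that by blast+
  qed
  have lookup_E: "?lookup E (Q k) = \<alpha> k" if "k \<le> n" for k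
    unfolding assms(18) using that by (intro lookup_sum_single(1)[OF inj_Q]) simp_all
  have lookup_E_other: "?lookup E R' = 0" if "R' \<notin> Q ` {0..n}" for R'
    unfolding assms(18) by (rule lookup_sum_single(2)[OF inj_Q _ that]) simp
  have lookup_G: "?lookup G (Q 0) = int N - int m + \<alpha> 0 - s * int n"
    "\<And>k. k \<in> {1..n} \<Longrightarrow> ?lookup G (Q k) = \<alpha> k"
    "\<And>R'. R' \<notin> Q ` {0..n} \<Longrightarrow> ?lookup G R' = 0"
  proof -
    show "?lookup G (Q 0) = int N - int m + \<alpha> 0 - s * int n"
      using lookup_sum_single(2)[OF inj_Q' _ Q0_new] by (simp add: assms(23) lookup_add)
    show "?lookup G (Q k) = \<alpha> k" if "k \<in> {1..n}" for k
      using lookup_sum_single(1)[OF inj_Q' _ that, of \<alpha>] Q0_Qk[OF that]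
      by (simp add: assms(23) lookup_add lookup_single when_def)
    show "?lookup G R' = 0" if "R' \<notin> Q ` {0..n}" for R'
      using lookup_sum_single(2)[OF inj_Q' _ other(1)[OF that], of \<alpha>] other(2)[OF that]
      by (simp add: assms(23) lookup_add lookup_single when_def)
  qed
  have lookup_H: "?lookup H (Q 0) = \<alpha> 0"
    "\<And>k. k \<in> {1..n} \<Longrightarrow> ?lookup H (Q k) = s + \<alpha> k"
    "?lookup H (R 1) = - 1"
    "\<And>R'. R' \<notin> Q ` {0..n} \<Longrightarrow> R' \<noteq> R 1 \<Longrightarrow> ?lookup H R' = 0"
  proof -
    have R1: "R 1 \<noteq> Q k" if "k \<le> n" for k using R_not_Q[OF R12(3)] that by auto
    show "?lookup H (Q 0) = \<alpha> 0"
      using lookup_sum_single(2)[OF inj_Q' _ Q0_new] R1[of 0]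
      by (simp add: assms(24) lookup_add lookup_minus lookup_single when_def)
    show "?lookup H (Q k) = s + \<alpha> k" if "k \<in> {1..n}" for k
      using lookup_sum_single(1)[OF inj_Q' _ that, of "\<lambda>k. s + \<alpha> k"] Q0_Qk[OF that] that R1[of k]
      by (simp add: assms(24) lookup_add lookup_minus lookup_single when_def)
    show "?lookup H (R 1) = - 1"
      using lookup_sum_single(2)[OF inj_Q' _ other(1)[OF R_not_Q[OF R12(3)]], of "\<lambda>k. s + \<alpha> k"]
        other(2)[OF R_not_Q[OF R12(3)]]
      by (simp add: assms(24) lookup_add lookup_minus lookup_single when_def)
    show "?lookup H R' = 0" if "R' \<notin> Q ` {0..n}" "R' \<noteq> R 1" for R'
      using lookup_sum_single(2)[OF inj_Q' _ other(1)[OF that(1)], of "\<lambda>k. s + \<alpha> k"]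
        other(2)[OF that(1)] that(2)
      by (simp add: assms(24) lookup_add lookup_minus lookup_single when_def)
  qed
  have keys: "Poly_Mapping.keys E \<subseteq> Q ` {0..n}" "Poly_Mapping.keys G \<subseteq> Q ` {0..n}"
    "Poly_Mapping.keys H \<subseteq> insert (R 1) (Q ` {0..n})"
    using lookup_E_other lookup_G(3) lookup_H(4) by (auto simp: in_keys_iff)

  \<comment> \<open>The genus bounds the dimensions only from below. They are exact because the two codes
    intersect trivially in a space whose dimension \<open>M\<close> is the sum of the two bounds.\<close>
  have sum_split: "(\<Sum>k=0..n. h k) = h 0 + (\<Sum>k=1..n. h k)" for h :: "nat \<Rightarrow> int"
    by (simp add: sum.atLeast_Suc_atMost)
  have sum_Q: "(\<Sum>R'\<in>Q ` {0..n}. h R' * int (place_degree \<iota> UNIV R')) = (\<Sum>k=0..n. h (Q k))"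
    for h :: "'f set \<Rightarrow> int"
    using place_degree_Q by (subst sum.reindex[OF inj_Q]) (simp add: o_def)
  have degree: "divisor_degree \<iota> A = ?lookup A (Q 0) + (\<Sum>k=1..n. ?lookup A (Q k))"
    if "Poly_Mapping.keys A \<subseteq> Q ` {0..n}" for A
    unfolding divisor_degree_superset[OF finite_imageI[OF finite_atLeastAtMost] that] sum_Q
    by (rule sum_split)
  have "(\<Sum>k=1..n. ?lookup E (Q k)) = (\<Sum>k=1..n. \<alpha> k)"
    by (intro sum.cong lookup_E) simp_all
  then have sum_\<alpha>: "\<alpha> 0 + (\<Sum>k=1..n. \<alpha> k) = g"
    using degree[OF keys(1)] assms(20) lookup_E[of 0] by simp
  have "(\<Sum>k=1..n. ?lookup G (Q k)) = (\<Sum>k=1..n. \<alpha> k)"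
    by (intro sum.cong lookup_G(2)) simp_all
  then have degree_G: "divisor_degree \<iota> G = g + int N - int m - s * int n"
    using degree[OF keys(2)] lookup_G(1) sum_\<alpha> by simp
  have "(\<Sum>k=1..n. ?lookup H (Q k)) = (\<Sum>k=1..n. s + \<alpha> k)"
    by (intro sum.cong lookup_H(2)) simp_all
  also have "\<dots> = s * int n + (\<Sum>k=1..n. \<alpha> k)" by (simp add: sum.distrib)
  finally have "(\<Sum>R'\<in>Q ` {0..n}. ?lookup H R' * int (place_degree \<iota> UNIV R')) = g + s * int n"
    unfolding sum_Q sum_split lookup_H(1) using sum_\<alpha> by simp
  then have degree_H: "divisor_degree \<iota> H = g + s * int n - 1"
    using divisor_degree_superset[OF _ keys(3), of \<iota>] lookup_H(3) R_not_Q[OF R12(3)]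
      R_place(2)[OF R12(3)] by simp
  have "G \<in> divisors \<iota>" "H \<in> divisors \<iota>"
    using keys(2,3) Q_place R_place(1)[OF R12(3)] by (auto simp: divisors_def)
  then have ell_G: "int (ell \<iota> G) \<ge> int N - int m + 1 - s * int n"
    and ell_H: "int (ell \<iota> H) \<ge> s * int n"
    using assms(7) degree_G degree_H by (force simp: has_genus_def)+

  have ell_E: "ell \<iota> E = 1" using assms(19,20) by (simp add: non_special_def)
  have no_vanishing: "u = 0"
    if "u \<in> riemann_roch_space \<iota> E" "R' \<in> places \<iota> UNIV" "x - \<iota> (\<beta> 1) \<in> R'" "u \<in> R'" for u R'
    by (rule no_vanishing_over_split_point[OF keys(1) ell_E Z \<beta>_a[OF one] val_\<beta>[OF one]
          that(2,3,1,4)])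
  \<comment> \<open>\<open>B\<close> is the coefficientwise maximum of \<open>G\<close> and \<open>H\<close>, and \<open>B - D\<close> is linearly equivalent to
    \<open>E - R\<^sub>2\<close>, by means of \<open>w = y\<^sup>s / \<Prod>\<^sub>i (x - \<beta>\<^sub>i)\<close>.\<close>
  define B :: "'f divisor" where "B = (\<Sum>k=1..n. Poly_Mapping.single (Q k) (s + \<alpha> k))
      + Poly_Mapping.single (Q 0) (int N - int m + \<alpha> 0 - s * int n)"
  have lookup_B: "?lookup B (Q 0) = int N - int m + \<alpha> 0 - s * int n"
    "\<And>k. k \<in> {1..n} \<Longrightarrow> ?lookup B (Q k) = s + \<alpha> k"
    "\<And>R'. R' \<notin> Q ` {0..n} \<Longrightarrow> ?lookup B R' = 0"
  proof -
    show "?lookup B (Q 0) = int N - int m + \<alpha> 0 - s * int n"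
      using lookup_sum_single(2)[OF inj_Q' _ Q0_new] by (simp add: B_def lookup_add)
    show "?lookup B (Q k) = s + \<alpha> k" if "k \<in> {1..n}" for k
      using lookup_sum_single(1)[OF inj_Q' _ that, of "\<lambda>k. s + \<alpha> k"] Q0_Qk[OF that]
      by (simp add: B_def lookup_add lookup_single when_def)
    show "?lookup B R' = 0" if "R' \<notin> Q ` {0..n}" for R'
      using lookup_sum_single(2)[OF inj_Q' _ other(1)[OF that], of "\<lambda>k. s + \<alpha> k"]
        other(2)[OF that]
      by (simp add: B_def lookup_add lookup_single when_def)
  qed
  have vanishing_B: "u = 0"
    if u: "u \<in> riemann_roch_space \<iota> B" and S: "\<And>i. i \<in> {1..M} \<Longrightarrow> u \<in> S i" for u
  proof -
    define w where "w = y powi s / (\<Prod>i\<in>{2..t}. x - \<iota> (\<beta> i))"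
    have t2: "i \<in> {1..t}" if "i \<in> {2..t}" for i using that by auto
    have inj2: "inj_on \<beta> {2..t}" using inj_\<beta> by (rule inj_on_subset) auto
    have vanish: "u \<in> R'" if "i \<in> {2..t}" "R' \<in> places \<iota> UNIV" "x - \<iota> (\<beta> i) \<in> R'" for i R'
      using S_over[OF that] S by blast
    have u_R2: "u \<in> R 2" using S S_image by (metis UnI2 imageE singletonI)
    have R2: "x - \<iota> (\<beta> i) \<notin> R 2" if "i \<in> {2..t}" for i
    proof
      assume in_R2: "x - \<iota> (\<beta> i) \<in> R 2"
      interpret R2: function_field_place \<iota> x m "\<lambda>j. y ^ j" "R 2"
        by (rule places_function_field_place[OF R_place(1)[OF R12(4)]])
      have "\<beta> i = \<beta> 1" using R2.residue_unique[OF in_R2 R12(2)] .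
      then show False using inj_\<beta> t2[OF that] one that by (auto dest: inj_onD)
    qed
    have finite: "\<And>k. k \<in> {1..n} \<Longrightarrow> ?lookup B (Q k) \<le> s + ?lookup E (Q k)"
      and infinite: "?lookup B (Q 0) \<le> int m * int (card {2..t}) + ?lookup E (Q 0) - s * int n"
      and other: "\<And>R'. R' \<notin> Q ` {0..n} \<Longrightarrow> ?lookup B R' \<le> 0"
      using lookup_B lookup_E Nm(1) by simp_all
    note mult = multiplication_into_riemann_roch_space[OF keys(1) finite_atLeastAtMost inj2
        \<beta>_a[OF t2] val_\<beta>[OF t2] finite infinite other u vanish, folded w_def]
    have uw: "u * w \<in> riemann_roch_space \<iota> E" by (rule mult(1))
    have w0: "w \<noteq> 0" by (rule mult(2))
    have uw_R2: "u * w \<in> R 2"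
      by (rule mult(3)[OF _ _ _ _ _ _ _ _ _ R_place(1)[OF R12(4)] R_not_Q[OF R12(4)] R2 u_R2])
    have "u * w = 0" by (rule no_vanishing[OF uw R_place(1)[OF R12(4)] R12(2) uw_R2])
    then show "u = 0" using w0 by simp
  qed
  have G_B: "z \<in> riemann_roch_space \<iota> B" if "z \<in> riemann_roch_space \<iota> G" for z
  proof -
    have "?lookup G R' \<le> ?lookup B R'" for R'
    proof (cases "R' \<in> Q ` {0..n}")
      case True
      then obtain k where "k \<le> n" "R' = Q k" by auto
      then show ?thesis using lookup_G(1,2) lookup_B(1,2) s0 by (cases "k = 0") auto
    qed (simp add: lookup_G lookup_B)
    then show ?thesis using that order_ge_mono by (fastforce simp: riemann_roch_space_iff)
  qed
  have H_B: "z \<in> riemann_roch_space \<iota> B" if "z \<in> riemann_roch_space \<iota> H" for z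
  proof -
    have "?lookup H R' \<le> ?lookup B R'" for R'
    proof (cases "R' \<in> Q ` {0..n}")
      case True
      then obtain k where "k \<le> n" "R' = Q k" by auto
      then show ?thesis using lookup_H(1,2) lookup_B(1,2) sn(2) assms(8) by (cases "k = 0") auto
    next
      case False
      then show ?thesis using lookup_H(3,4) lookup_B(3) by (cases "R' = R 1") auto
    qed
    then show ?thesis using that order_ge_mono by (fastforce simp: riemann_roch_space_iff)
  qed

  have G_S: "?lookup G (S i) \<le> 0" and H_S: "?lookup H (S i) \<le> 0" if i: "i \<in> {1..M}" for i
  proof -
    obtain k where k: "k \<in> {2..N}" "S i = R k" using S_R[OF i] by blast
    then have k': "k \<in> {1..N}" by auto
    show "?lookup G (S i) \<le> 0" using lookup_G(3)[OF R_not_Q[OF k']] k by simp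
    show "?lookup H (S i) \<le> 0"
      using lookup_H(3) lookup_H(4)[OF R_not_Q[OF k']] k by (cases "R k = R 1") simp_all
  qed
  have linear_G: "linear_code M (ag_code \<iota> M S G)" by (rule ag_code_linear(1)[OF S_place G_S])
  have linear_H: "linear_code M (ag_code \<iota> M S H)" by (rule ag_code_linear(1)[OF S_place H_S])
  have integral_G: "order_ge (S i) z 0" if "z \<in> riemann_roch_space \<iota> G" "i \<in> {1..M}" for z i
    by (rule ag_code_linear(2)[OF S_place G_S that])
  have integral_H: "order_ge (S i) z 0" if "z \<in> riemann_roch_space \<iota> H" "i \<in> {1..M}" for z i
    by (rule ag_code_linear(2)[OF S_place H_S that])
  have equal: "u = v"
    if u: "u \<in> riemann_roch_space \<iota> B" "\<And>i. i \<in> {1..M} \<Longrightarrow> order_ge (S i) u 0"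
      and v: "v \<in> riemann_roch_space \<iota> B" "\<And>i. i \<in> {1..M} \<Longrightarrow> order_ge (S i) v 0"
      and eq: "eval_word \<iota> M S u = eval_word \<iota> M S v" for u v
  proof -
    interpret K: vector_space "\<lambda>c z. \<iota> c * z" by (rule vector_space_\<iota>)
    have "u - v \<in> riemann_roch_space \<iota> B"
      by (rule K.subspace_diff[OF subspace_riemann_roch_space u(1) v(1)])
    moreover have "u - v \<in> S i" if "i \<in> {1..M}" for i
      by (rule eval_word_eq_imp[OF S_place u(2) v(2) eq that])
    ultimately have "u - v = 0" by (rule vanishing_B)
    then show ?thesis by simp
  qed
  have inj_G: "inj_on (eval_word \<iota> M S) (riemann_roch_space \<iota> G)"
    by (intro inj_onI equal G_B integral_G)
  have inj_H: "inj_on (eval_word \<iota> M S) (riemann_roch_space \<iota> H)"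
    by (intro inj_onI equal H_B integral_H)
  \<comment> \<open>A common codeword comes from one function in \<open>\<L>(G) \<inter> \<L>(H) = \<L>(E - R\<^sub>1)\<close>.\<close>
  have trivial: "ag_code \<iota> M S G \<inter> ag_code \<iota> M S H = {0}"
  proof (intro equalityI subsetI)
    fix c assume "c \<in> ag_code \<iota> M S G \<inter> ag_code \<iota> M S H"
    then obtain u v where u: "u \<in> riemann_roch_space \<iota> G" "c = eval_word \<iota> M S u"
      and v: "v \<in> riemann_roch_space \<iota> H" "c = eval_word \<iota> M S v" by (auto simp: ag_code_eq)
    have "eval_word \<iota> M S u = eval_word \<iota> M S v" using u(2) v(2) by simp
    then have "u = v" by (intro equal G_B H_B integral_G[OF u(1)] integral_H[OF v(1)] u(1) v(1))
    have "u \<in> riemann_roch_space \<iota> E"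
      unfolding riemann_roch_space_iff
    proof
      fix R' assume R': "R' \<in> places \<iota> UNIV"
      have ord: "order_ge R' u (- ?lookup G R')" "order_ge R' u (- ?lookup H R')"
        using u(1) v(1) R' \<open>u = v\<close> by (simp_all add: riemann_roch_space_iff)
      show "order_ge R' u (- ?lookup E R')"
      proof (cases "R' \<in> Q ` {0..n}")
        case True
        then obtain k where "k \<le> n" "R' = Q k" by auto
        then show ?thesis using ord lookup_E lookup_G(2) lookup_H(1) by (cases "k = 0") auto
      qed (use ord lookup_E_other lookup_G(3) in simp)
    qed
    moreover have "u \<in> R 1"
    proof -
      interpret R1: function_field_place \<iota> x m "\<lambda>j. y ^ j" "R 1"
        by (rule places_function_field_place[OF R_place(1)[OF R12(3)]])
      have "order_ge (R 1) u (- ?lookup H (R 1))"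
        using v(1) \<open>u = v\<close> R_place(1)[OF R12(3)] by (simp add: riemann_roch_space_iff)
      then have "order_ge (R 1) u 1" unfolding lookup_H(3) by simp
      then show ?thesis unfolding R1.order_ge_1_iff .
    qed
    ultimately have "u = 0" using no_vanishing R_place(1)[OF R12(3)] R12(1) by blast
    moreover have "eval_at \<iota> (S i) 0 = 0" if i: "i \<in> {1..M}" for i
    proof -
      interpret Si: function_field_place \<iota> x m "\<lambda>j. y ^ j" "S i"
        using places_function_field_place S_place[OF i] by blast
      show ?thesis by (rule Si.eval_at_eqI) simp
    qed
    ultimately have "c = 0" using u(2) by (auto simp: eval_word_def fun_eq_iff)
    then show "c \<in> {0}" by simp
  next
    fix c :: "nat \<Rightarrow> 'k" assume "c \<in> {0}"
    then show "c \<in> ag_code \<iota> M S G \<inter> ag_code \<iota> M S H"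
      using linear_G linear_H word.subspace_0 by (auto simp: linear_code_def)
  qed
  have M: "int M = int N - int m + 1" using assms(25) Nm(2) by simp
  have dim_G: "int (word.dim (ag_code \<iota> M S G)) \<ge> int N - int m + 1 - s * int n"
  proof -
    have pos: "ell \<iota> G > 0" using ell_G sn(2) assms(8) by linarith
    have "ell \<iota> G \<le> word.dim (ag_code \<iota> M S G)"
      by (rule ag_code_linear(3)[OF S_place G_S inj_G pos])
    then show ?thesis using ell_G by linarith
  qed
  have dim_H: "int (word.dim (ag_code \<iota> M S H)) \<ge> s * int n"
  proof -
    have pos: "ell \<iota> H > 0" using ell_H \<open>s * int n > 0\<close> by linarith
    have "ell \<iota> H \<le> word.dim (ag_code \<iota> M S H)"
      by (rule ag_code_linear(3)[OF S_place H_S inj_H pos])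
    then show ?thesis using ell_H by linarith
  qed
  have "M \<le> word.dim (ag_code \<iota> M S G) + word.dim (ag_code \<iota> M S H)"
    using dim_G dim_H M by linarith
  note LCP = LCP_of_trivial_intersection[OF linear_G linear_H trivial this]
  show ?thesis
    using LCP linear_G linear_H dim_G dim_H M unfolding has_parameters_def by simp
qed

end
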